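(* Let $X,Y$ be Banach spaces, $F:\mathbb{R}\times X\to Y$ a smooth nonlinear operator, and $(\lambda_\circ,u_\circ)\in\mathbb{R}\times X$ with $F(\lambda_\circ,u_\circ)=0$. Assume that $L=D_uF(\lambda_\circ,u_\circ)\in\mathcal{L}(X,Y)$ is a Fredholm operator of index zero with one-dimensional nullspace, and that $N(L)=\mathrm{span}[\varphi_\circ]$ and $R(L)=N(\psi_\circ^* )$ for some nonzero $\varphi_\circ\in X$ and $\psi_\circ^*\in Y^*$. Assume further that there are closed subspaces $X_{\mathrm{sym}}\subset X$ and $Y_{\mathrm{sym}}\subset Y$ with $F(\mathbb{R},X_{\mathrm{sym}})\subset Y_{\mathrm{sym}}$, that the restriction $L|_{X_{\mathrm{sym}}}:X_{\mathrm{sym}}\to Y_{\mathrm{sym}}$ is again a Fredholm operator of index zero, and that $u_\circ\in X_{\mathrm{sym}}$ and $\varphi_\circ\notin X_{\mathrm{sym}}$. Then there exists a unique $\xi_\circ\in X_{\mathrm{sym}}$ such that $$L\xi_\circ+D_\lambda F(\lambda_\circ,u_\circ)=0 .$$ If moreover the nondegeneracy condition $$D_{\lambda u}F(\lambda_\circ,u_\circ)[\varphi_\circ]+D_{uu}F(\lambda_\circ,u_\circ)[\varphi_\circ,\xi_\circ]\notin R(L)$$ is satisfied, then $(\lambda_\circ,u_\circ)$ is a bifurcation point of $F(\lambda,u)=0$, and the following hold: (a) If $D_{uu}F(\lambda_\circ,u_\circ)[\varphi_\circ,\varphi_\circ]\notin R(L)$, then there is a transcritical bifurcation at $(\lambda_\circ,u_\circ)$.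 (b) If $D_{uu}F(\lambda_\circ,u_\circ)[\varphi_\circ,\varphi_\circ]\in R(L)$, then there is a pitchfork bifurcation at $(\lambda_\circ,u_\circ)$. In both cases the bifurcating solution branch is not a subset of the symmetry space $X_{\mathrm{sym}}$; that is, $(\lambda_\circ,u_\circ)$ is a symmetry-breaking bifurcation point.
   Context: $N(\cdot)$ and $R(\cdot)$ denote nullspace and range; $\mathcal{L}(X,Y)$ is the space of bounded linear operators; $Y^*$ is the dual of $Y$. $D_\lambda F, D_uF, D_{\lambda u}F, D_{uu}F$ are (partial) Fréchet derivatives. Terminology: $(\lambda_\circ,u_\circ)$ is a bifurcation point (in the present setting) if in a neighborhood of $(\lambda_\circ,u_\circ)$ in $\mathbb{R}\times X$ the solution set of $F(\lambda,u)=0$ is the union of two smooth curves through $(\lambda_\circ,u_\circ)$: a primary branch $\{(\lambda,p(\lambda))\}$, with $p$ defined and smooth near $\lambda_\circ$, taking values in $X_{\mathrm{sym}}$ and $p(\lambda_\circ)=u_\circ$, and a second (bifurcating) branch $\alpha\mapsto(h(\alpha),u(\alpha))$, defined and smooth for $\alpha$ near $0$, with $h(0)=\lambda_\circ$, $u(0)=u_\circ$ and $u'(0)\notin X_{\mathrm{sym}}$. The bifurcation is called transcritical if $h'(0)\neq0$, and it is called a pitchfork bifurcation if $h'(0)=0$ (the degenerate case $h''(0)=0$ is included in this terminology). *)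

theory Defs
  imports "HOL-Analysis.Analysis"
begin

section \<open>Smooth maps between normed spaces\<close>

text \<open>A bounded \<^term>\<open>n\<close>-linear map is represented by a function on lists, of which only the
  values on lists of length \<^term>\<open>n\<close> matter.\<close>

definition bounded_multilinear ::
  "nat \<Rightarrow> ('a::real_normed_vector list \<Rightarrow> 'b::real_normed_vector) \<Rightarrow> bool" where
  "bounded_multilinear n M \<longleftrightarrow>
     (\<forall>vs i. length vs = n \<longrightarrow> i < n \<longrightarrow> linear (\<lambda>v. M (vs[i := v]))) \<and>
     (\<exists>K. \<forall>vs. length vs = n \<longrightarrow> norm (M vs) \<le> K * prod_list (map norm vs))"

text \<open>Infinite Frechet differentiability on an open set. The iterated derivatives live in the
  different spaces of bounded \<^term>\<open>n\<close>-linear maps, so they cannot be obtained by recursion within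
  one HOL type; instead \<^term>\<open>D n x\<close> is the \<^term>\<open>n\<close>-th derivative at \<^term>\<open>x\<close>. The last clause
  says that \<^term>\<open>D (Suc n) x\<close> is the Frechet derivative of \<^term>\<open>D n\<close> at \<^term>\<open>x\<close> with respect
  to the operator norm of \<^term>\<open>n\<close>-linear maps; the newest direction is the head of the list.\<close>

definition smooth_on ::
  "'a::real_normed_vector set \<Rightarrow> ('a \<Rightarrow> 'b::real_normed_vector) \<Rightarrow> bool" where
  "smooth_on S f \<longleftrightarrow> open S \<and>
     (\<exists>D :: nat \<Rightarrow> 'a \<Rightarrow> 'a list \<Rightarrow> 'b.
        (\<forall>x\<in>S. D 0 x [] = f x) \<and>
        (\<forall>n. \<forall>x\<in>S. bounded_multilinear n (D n x)) \<and>
        (\<forall>n. \<forall>x\<in>S. \<forall>e>0. \<exists>d>0. \<forall>y\<in>S. norm (y - x) < d \<longrightarrow>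
           (\<forall>vs. length vs = n \<longrightarrow>
              norm (D n y vs - D n x vs - D (Suc n) x ((y - x) # vs))
                \<le> e * norm (y - x) * prod_list (map norm vs))))"

section \<open>Partial Frechet derivatives\<close>

definition D_u ::
  "(real \<times> 'a::real_normed_vector \<Rightarrow> 'b::real_normed_vector) \<Rightarrow> real \<Rightarrow> 'a \<Rightarrow> 'a \<Rightarrow>\<^sub>L 'b" where
  "D_u F l u = Blinfun (frechet_derivative (\<lambda>v. F (l, v)) (at u))"

text \<open>Derivatives in the real parameter are identified with their values at \<^term>\<open>1::real\<close>.\<close>

definition D_lam ::
  "(real \<times> 'a::real_normed_vector \<Rightarrow> 'b::real_normed_vector) \<Rightarrow> real \<Rightarrow> 'a \<Rightarrow> 'b" where
  "D_lam F l u = vector_derivative (\<lambda>k. F (k, u)) (at l)"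

definition D_lam_u ::
  "(real \<times> 'a::real_normed_vector \<Rightarrow> 'b::real_normed_vector) \<Rightarrow> real \<Rightarrow> 'a \<Rightarrow> 'a \<Rightarrow>\<^sub>L 'b" where
  "D_lam_u F l u = vector_derivative (\<lambda>k. D_u F k u) (at l)"

definition D_uu ::
  "(real \<times> 'a::real_normed_vector \<Rightarrow> 'b::real_normed_vector) \<Rightarrow> real \<Rightarrow> 'a
     \<Rightarrow> 'a \<Rightarrow>\<^sub>L ('a \<Rightarrow>\<^sub>L 'b)" where
  "D_uu F l u = Blinfun (frechet_derivative (\<lambda>v. D_u F l v) (at u))"

section \<open>Fredholm operators\<close>

text \<open>The library's \<^const>\<open>dim\<close> is 0 on infinite-dimensional spaces, so finiteness of the
  dimension is made explicit.\<close>

definition has_dim :: "'a::real_vector set \<Rightarrow> nat \<Rightarrow> bool" where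
  "has_dim V n \<longleftrightarrow> (\<exists>B. finite B \<and> independent B \<and> card B = n \<and> span B = V)"

text \<open>The quotient of \<^term>\<open>B\<close> by \<^term>\<open>R\<close> is represented by an algebraic complement of
  \<^term>\<open>R\<close> in \<^term>\<open>B\<close>.\<close>

definition has_codim :: "'a::real_vector set \<Rightarrow> 'a set \<Rightarrow> nat \<Rightarrow> bool" where
  "has_codim R B n \<longleftrightarrow>
     (\<exists>W. has_dim W n \<and> R \<inter> W = {0} \<and> {r + w |r w. r \<in> R \<and> w \<in> W} = B)"

text \<open>\<^term>\<open>T\<close>, restricted to \<^term>\<open>A\<close>, is a Fredholm operator from \<^term>\<open>A\<close> to \<^term>\<open>B\<close> of
  index \<^term>\<open>k\<close>. For closed subspaces of Banach spaces, finite codimension of the range implies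
  that the range is closed, so closedness is not listed.\<close>

definition fredholm_of_index ::
  "'a::real_normed_vector set \<Rightarrow> 'b::real_normed_vector set \<Rightarrow> ('a \<Rightarrow>\<^sub>L 'b) \<Rightarrow> int \<Rightarrow> bool" where
  "fredholm_of_index A B T k \<longleftrightarrow> T ` A \<subseteq> B \<and>
     (\<exists>m n. has_dim {x\<in>A. T x = 0} m \<and> has_codim (T ` A) B n \<and> k = int m - int n)"

section \<open>Bifurcation points\<close>

text \<open>In some neighbourhood \<^term>\<open>U\<close> of \<^term>\<open>(l0, u0)\<close> the solution set is the union of the
  primary branch, parametrised by \<^term>\<open>p\<close> over the \<^term>\<open>e\<close>-interval around \<^term>\<open>l0\<close>, and the
  bifurcating branch, parametrised by \<^term>\<open>h\<close> and \<^term>\<open>u\<close> over the \<^term>\<open>d\<close>-interval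
  around 0.\<close>

definition bifurcation_branches ::
  "(real \<times> 'a::real_normed_vector \<Rightarrow> 'b::real_normed_vector) \<Rightarrow> 'a set \<Rightarrow> real \<Rightarrow> 'a
     \<Rightarrow> real \<Rightarrow> (real \<Rightarrow> 'a) \<Rightarrow> real \<Rightarrow> (real \<Rightarrow> real) \<Rightarrow> (real \<Rightarrow> 'a) \<Rightarrow> bool" where
  "bifurcation_branches F Xsym l0 u0 e p d h u \<longleftrightarrow>
     e > 0 \<and> smooth_on {l0 - e<..<l0 + e} p \<and> p ` {l0 - e<..<l0 + e} \<subseteq> Xsym \<and> p l0 = u0 \<and>
     d > 0 \<and> smooth_on {-d<..<d} h \<and> smooth_on {-d<..<d} u \<and> h 0 = l0 \<and> u 0 = u0 \<and>
     vector_derivative u (at 0) \<notin> Xsym \<and>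
     (\<exists>U. open U \<and> (l0, u0) \<in> U \<and>
        {z\<in>U. F z = 0} =
          (\<lambda>l. (l, p l)) ` {l0 - e<..<l0 + e} \<union> (\<lambda>a. (h a, u a)) ` {-d<..<d})"

definition bifurcation_point ::
  "(real \<times> 'a::real_normed_vector \<Rightarrow> 'b::real_normed_vector) \<Rightarrow> 'a set \<Rightarrow> real \<Rightarrow> 'a \<Rightarrow> bool" where
  "bifurcation_point F Xsym l0 u0 \<longleftrightarrow> (\<exists>e p d h u. bifurcation_branches F Xsym l0 u0 e p d h u)"

text \<open>The type of a bifurcation is a property of the two curves, not of a chosen parametrisation;
  so the conditions below are required of every admissible parametrisation, besides the
  existence of one.\<close>

definition transcritical_bifurcation ::
  "(real \<times> 'a::real_normed_vector \<Rightarrow> 'b::real_normed_vector) \<Rightarrow> 'a set \<Rightarrow> real \<Rightarrow> 'a \<Rightarrow> bool" where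
  "transcritical_bifurcation F Xsym l0 u0 \<longleftrightarrow> bifurcation_point F Xsym l0 u0 \<and>
     (\<forall>e p d h u. bifurcation_branches F Xsym l0 u0 e p d h u \<longrightarrow> deriv h 0 \<noteq> 0)"

definition pitchfork_bifurcation ::
  "(real \<times> 'a::real_normed_vector \<Rightarrow> 'b::real_normed_vector) \<Rightarrow> 'a set \<Rightarrow> real \<Rightarrow> 'a \<Rightarrow> bool" where
  "pitchfork_bifurcation F Xsym l0 u0 \<longleftrightarrow> bifurcation_point F Xsym l0 u0 \<and>
     (\<forall>e p d h u. bifurcation_branches F Xsym l0 u0 e p d h u \<longrightarrow> deriv h 0 = 0)"

definition symmetry_breaking_bifurcation ::
  "(real \<times> 'a::real_normed_vector \<Rightarrow> 'b::real_normed_vector) \<Rightarrow> 'a set \<Rightarrow> real \<Rightarrow> 'a \<Rightarrow> bool" where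
  "symmetry_breaking_bifurcation F Xsym l0 u0 \<longleftrightarrow> bifurcation_point F Xsym l0 u0 \<and>
     (\<forall>e p d h u. bifurcation_branches F Xsym l0 u0 e p d h u \<longrightarrow> \<not> u ` {-d<..<d} \<subseteq> Xsym)"

end

theory Submission
  imports Defs
begin

text \<open>Since \<open>L\<close> is injective on the symmetry space and has index zero there, it maps it onto
  \<open>Ysym\<close>; so \<open>psi0\<close> vanishes on \<open>Ysym\<close>, and so does on \<open>Xsym\<close> the functional
  \<open>\<alpha> v = psi0 (F_lu [v] + F_uu [v, xi])\<close>, which the nondegeneracy condition makes nonzero at
  \<open>phi0\<close>. With \<open>\<alpha> phi0 = 1\<close> and \<open>psi0 y1 = 1\<close> the bordered operator \<open>L + \<alpha> y1\<close> is invertible, and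
  \<open>F (l, u) = (t - \<alpha> (u - u0)) y1\<close> can be solved for \<open>u = U (l, t)\<close>. Newton's iteration preserves
  \<open>Xsym\<close> for \<open>t = 0\<close>, so \<open>U (l, 0)\<close> is the primary branch, and the remaining scalar equation
  \<open>t - \<alpha> (U (l, t) - u0) = 0\<close> can be divided by \<open>t\<close>. The quotient has \<open>l\<close>-derivative
  \<open>psi0 (F_lu [phi0] + F_uu [phi0, xi])\<close> at the bifurcation point, which gives \<open>l = h (t)\<close>.
  The type of the bifurcation follows from differentiating \<open>psi0 (F (h a, u a)) = 0\<close> twice.\<close>

section \<open>Bounded inverses\<close>

text \<open>Bordering by a functional that vanishes on \<open>Xsym\<close> lets one reduction serve
  both branches: t is then the amplitude \<open>\<alpha> (u - u0)\<close>, which is zero on the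
  symmetric branch and equals the curve parameter on the other, so the tangent of the second branch
  has \<alpha>-value 1 and cannot be symmetric. The obstacle is smoothness to all orders.
  Derivatives of order n live in a space that depends on n; \<open>ndiff_on\<close> therefore
  differentiates along fixed directions only, and the derivative of U solves a linear equation whose
  coefficients are jets of F along the graph of U, which raises the order by one at each turn. For
  curves on the real line this already yields \<open>smooth_on\<close>. The inverse of the bordered
  operator must be bounded, with a bound that survives perturbation, which is where Baire category
  comes in. The type of the bifurcation is claimed for every admissible parametrisation, hence it is
  read off from an arbitrary solution curve and not from the constructed h.\<close>

lemma Baire_countable_closed_cover:
  fixes T :: "nat \<Rightarrow> 'a::{complete_space} set"
  assumes "\<And>n. closed (T n)" and "(\<Union>n. T n) = UNIV"
  obtains n where "interior (T n) \<noteq> {}"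
proof -
  have "\<exists>n. interior (T n) \<noteq> {}"
  proof (rule ccontr)
    assume *: "\<nexists>n. interior (T n) \<noteq> {}"
    have "Met_TC.mtopology interior_of \<Union> (range T) = {}"
    proof (rule Met_TC.metric_Baire_category_alt)
      show "Met_TC.mcomplete TYPE('a)"
        by (simp add: complete_UNIV mcomplete_iff_complete)
    qed (use * assms in auto)
    then show False
      using assms by simp
  qed
  with that show ?thesis by blast
qed

text \<open>The Baire half of the open mapping theorem. The closure of the image of some ball
  contains a ball around a point \<open>y0\<close>; subtracting approximate preimages of
  \<open>y0\<close> from those of \<open>y0 + y\<close> recentres it at 0, and homogeneity reaches
  every y.\<close>

lemma approximate_solutions_of_surj:
  fixes f :: "'a::banach \<Rightarrow> 'b::banach"
  assumes "bounded_linear f" and "surj f"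
  obtains K where "K > 0" and
    "\<And>y e. e > 0 \<Longrightarrow> \<exists>x. norm x \<le> K * norm y \<and> norm (y - f x) \<le> e"
proof -
  interpret bounded_linear f by fact
  define T where "T n = closure (f ` cball 0 (real n))" for n
  have "(\<Union>n. T n) = UNIV"
  proof -
    have "y \<in> (\<Union>n. T n)" for y
    proof -
      obtain x where "y = f x" using \<open>surj f\<close> by auto
      moreover obtain n where "norm x \<le> real n" using real_arch_simple by blast
      ultimately have "y \<in> T n"
        unfolding T_def using closure_subset by fastforce
      then show ?thesis by blast
    qed
    then show ?thesis by blast
  qed
  then obtain n where "interior (T n) \<noteq> {}"
    using Baire_countable_closed_cover[of T] unfolding T_def by (metis closed_closure)
  then obtain y0 d where d: "d > 0" "ball y0 d \<subseteq> T n"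
    by (metis ex_in_conv mem_interior)
  \<comment> \<open>\<open>2 * n\<close> bounds a difference of two points of the ball of radius n,
    and \<open>2 * norm y / d\<close> undoes the scaling by c; n + 1 in place of n keeps K
    positive.\<close>
  define K where "K = 4 * (real n + 1) / d"
  have near: "\<exists>x. norm x \<le> 2 * real n \<and> norm (y - f x) \<le> e" if "norm y < d" "e > 0" for y e
  proof -
    have "y0 + y \<in> T n" "y0 \<in> T n"
      using d that by (auto simp: dist_norm subset_iff)
    then obtain x1 x2 where x: "norm x1 \<le> n" "dist (f x1) (y0 + y) < e/2"
        "norm x2 \<le> n" "dist (f x2) y0 < e/2"
      unfolding T_def closure_approachable using \<open>e > 0\<close>
      by (smt (verit) half_gt_zero imageE mem_cball_0)
    have "norm (y - f (x1 - x2)) = norm ((f x2 - y0) - (f x1 - (y0 + y)))"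
      by (simp add: diff algebra_simps)
    also have "\<dots> \<le> e"
      using x norm_triangle_ineq4[of "f x2 - y0" "f x1 - (y0 + y)"] by (simp add: dist_norm)
    finally have "norm (y - f (x1 - x2)) \<le> e" .
    moreover have "norm (x1 - x2) \<le> 2 * real n"
      using x norm_triangle_ineq4[of x1 x2] by simp
    ultimately show ?thesis by blast
  qed
  have "\<exists>x. norm x \<le> K * norm y \<and> norm (y - f x) \<le> e" if "e > 0" for y e
  proof (cases "y = 0")
    case True
    then show ?thesis using that by (intro exI[of _ 0]) (simp add: zero)
  next
    case False
    define c where "c = d / (2 * norm y)"
    have c: "c > 0" using False d by (simp add: c_def)
    have "norm (c *\<^sub>R y) < d" using False d by (simp add: c_def)
    then obtain x where x: "norm x \<le> 2 * real n" "norm (c *\<^sub>R y - f x) \<le> c * e"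
      using near[of "c *\<^sub>R y" "c * e"] c \<open>e > 0\<close> by auto
    have "norm (x /\<^sub>R c) \<le> K * norm y"
    proof -
      have "norm (x /\<^sub>R c) = norm x / c" using c by (simp add: divide_inverse mult.commute)
      also have "\<dots> \<le> 2 * (real n + 1) / c" using x c by (intro divide_right_mono) auto
      also have "\<dots> = K * norm y" by (simp add: c_def K_def)
      finally show ?thesis .
    qed
    moreover have "norm (y - f (x /\<^sub>R c)) \<le> e"
    proof -
      have "y - f (x /\<^sub>R c) = (c *\<^sub>R y - f x) /\<^sub>R c"
        using c by (simp add: scaleR algebra_simps)
      then have "norm (y - f (x /\<^sub>R c)) = norm (c *\<^sub>R y - f x) / c"
        using c by (simp add: divide_inverse mult.commute)
      also have "\<dots> \<le> e" using x c by (simp add: field_simps)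
      finally show ?thesis .
    qed
    ultimately show ?thesis by blast
  qed
  moreover have "K > 0" using d by (simp add: K_def)
  ultimately show ?thesis using that by blast
qed

text \<open>Each correction by an approximate preimage halves the residual, so the corrections are
  dominated by a geometric series and sum to an exact preimage of norm at most
  \<open>2 * K * norm y\<close>.\<close>

theorem bounded_linear_inv:
  fixes f :: "'a::banach \<Rightarrow> 'b::banach"
  assumes f: "bounded_linear f" and "bij f"
  shows "bounded_linear (inv f)"
proof -
  interpret bounded_linear f by fact
  have surj: "surj f" and inj: "inj f" using \<open>bij f\<close> by (auto simp: bij_def)
  obtain K where K: "K > 0"
    and ap: "\<And>y e. e > 0 \<Longrightarrow> \<exists>x. norm x \<le> K * norm y \<and> norm (y - f x) \<le> e"
    using approximate_solutions_of_surj[OF f surj] by blast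
  have "\<exists>x. norm x \<le> K * norm y \<and> norm (y - f x) \<le> norm y / 2" for y
  proof (cases "y = 0")
    case True
    then show ?thesis by (intro exI[of _ 0]) (simp add: zero)
  qed (use ap[of "norm y / 2" y] in simp)
  then obtain g where g: "\<And>y. norm (g y) \<le> K * norm y" "\<And>y. norm (y - f (g y)) \<le> norm y / 2"
    by metis
  have bound: "norm (inv f y) \<le> norm y * (2 * K)" for y
  proof -
    \<comment> \<open>The residual left after k corrections; the images \<open>f (g (r k))\<close>
      telescope to \<open>r 0 = y\<close>.\<close>
    define r where "r k = ((\<lambda>y. y - f (g y)) ^^ k) y" for k
    have r_Suc: "r (Suc k) = r k - f (g (r k))" for k by (simp add: r_def)
    have r: "norm (r k) \<le> norm y * (1/2) ^ k" for k
    proof (induction k)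
      case (Suc k)
      have "norm (r (Suc k)) \<le> norm (r k) / 2" using g(2) by (simp add: r_Suc)
      with Suc show ?case by simp
    qed (simp add: r_def)
    have gr: "norm (g (r k)) \<le> K * norm y * (1/2) ^ k" for k
      using order_trans[OF g(1) mult_left_mono[OF r less_imp_le[OF K]]] by (simp add: mult.assoc)
    have sb: "summable (\<lambda>k. K * norm y * (1/2) ^ k)"
      by (intro summable_mult summable_geometric) simp
    then have sm: "summable (\<lambda>k. norm (g (r k)))"
      using gr by (intro summable_comparison_test'[OF sb, of 0]) simp
    define X where "X = (\<Sum>k. g (r k))"
    have "(\<lambda>k. g (r k)) sums X"
      unfolding X_def using summable_norm_cancel[OF sm] by (rule summable_sums)
    then have "(\<lambda>k. f (g (r k))) sums f X"
      by (rule sums)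
    moreover have "(\<lambda>k. r k - r (Suc k)) sums (r 0 - 0)"
    proof (rule telescope_sums')
      have "(\<lambda>k. norm y * (1/2) ^ k) \<longlonglongrightarrow> 0"
        by (intro tendsto_mult_right_zero LIMSEQ_power_zero) simp
      then show "r \<longlonglongrightarrow> 0"
        by (rule Lim_null_comparison[rotated]) (simp add: r)
    qed
    ultimately have "f X = y"
      by (simp add: r_Suc sums_unique2 r_def)
    then have "inv f y = X" using inj by (auto simp: inv_f_f)
    moreover have "norm X \<le> (\<Sum>k. K * norm y * (1/2) ^ k)"
      unfolding X_def by (rule order_trans[OF summable_norm[OF sm] suminf_le[OF gr sm sb]])
    moreover have "(\<Sum>k. K * norm y * (1/2) ^ k) = norm y * (2 * K)"
      using suminf_geometric[of "1/2::real"] by (simp add: suminf_mult)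
    ultimately show ?thesis by simp
  qed
  have f_inv: "f (inv f y) = y" for y by (simp add: surj surj_f_inv_f)
  show ?thesis
  proof (rule bounded_linear_intro[OF _ _ bound])
    show "inv f (x + y) = inv f x + inv f y" for x y
      by (rule injD[OF inj]) (simp add: add f_inv)
    show "inv f (r *\<^sub>R x) = r *\<^sub>R inv f x" for r x
      by (rule injD[OF inj]) (simp add: scaleR f_inv)
  qed
qed

section \<open>Perturbations of isomorphisms and implicit functions\<close>

text \<open>The setting of a simplified Newton iteration \<open>x - B (f x)\<close> with a fixed
  left inverse B of a model operator A; \<open>M * e \<le> 1 / 2\<close> makes it contract by the
  factor 1/2. It is used for perturbed linear operators, for scalar equations and for the bordered
  equation.\<close>

locale near_isomorphism =
  fixes A :: "'a::banach \<Rightarrow> 'b::real_normed_vector" and B :: "'b \<Rightarrow> 'a" and M e r :: real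
    and x0 :: 'a and f :: "'a \<Rightarrow> 'b"
  assumes B: "linear B" and BA: "\<And>x. B (A x) = x"
    and M: "\<And>y. norm (B y) \<le> M * norm y" and M_pos: "M > 0" and Me: "M * e \<le> 1 / 2"
    and near: "\<And>x x'. x \<in> cball x0 r \<Longrightarrow> x' \<in> cball x0 r \<Longrightarrow>
      norm (f x - f x' - A (x - x')) \<le> e * norm (x - x')"
begin

lemma newton_contraction:
  assumes "x \<in> cball x0 r" "x' \<in> cball x0 r"
  shows "norm ((x - B (f x)) - (x' - B (f x'))) \<le> 1 / 2 * norm (x - x')"
proof -
  have "(x - B (f x)) - (x' - B (f x')) = - B (f x - f x' - A (x - x'))"
    using BA[of "x - x'"] by (simp add: linear_diff[OF B])
  then have "norm ((x - B (f x)) - (x' - B (f x'))) \<le> M * (e * norm (x - x'))"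
    using M[of "f x - f x' - A (x - x')"]
      mult_left_mono[OF near[OF assms] less_imp_le[OF M_pos]] by (simp only: norm_minus_cancel)
  also have "\<dots> \<le> 1 / 2 * norm (x - x')"
    using mult_right_mono[OF Me, of "norm (x - x')"] by (simp add: mult.assoc)
  finally show ?thesis .
qed

text \<open>The half that the contraction leaves over is absorbed on the left, hence the factor 2.
  The estimate gives uniqueness of zeros and bounds the distance from a zero by the
  residual.\<close>

lemma stability:
  assumes "x \<in> cball x0 r" "x' \<in> cball x0 r"
  shows "norm (x - x') \<le> 2 * M * norm (f x - f x')"
proof -
  have "norm (x - x') \<le> norm ((x - B (f x)) - (x' - B (f x'))) + norm (B (f x - f x'))"
    using norm_triangle_ineq[of "(x - B (f x)) - (x' - B (f x'))" "B (f x - f x')"]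
    by (simp add: linear_diff[OF B])
  with newton_contraction[OF assms] M[of "f x - f x'"] show ?thesis by simp
qed

text \<open>Banach's fixed point theorem on the part of the ball inside K. The bound on
  \<open>f x0\<close> uses up half of the radius, the contraction the other half. The closed set K
  carries a constraint that the iteration respects, such as membership in
  \<open>Xsym\<close>.\<close>

lemma zero_exists:
  assumes "r \<ge> 0" and f0: "M * norm (f x0) \<le> r / 2"
    and inj: "\<And>y. B y = 0 \<Longrightarrow> y = 0"
    and K: "closed K" "x0 \<in> K" "\<And>x. x \<in> K \<Longrightarrow> x \<in> cball x0 r \<Longrightarrow> x - B (f x) \<in> K"
  obtains x where "x \<in> K" "x \<in> cball x0 r" "f x = 0"
proof -
  let ?S = "cball x0 r \<inter> K"
  have "\<exists>!x\<in>?S. x - B (f x) = x"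
  proof (rule Banach_fix)
    show "complete ?S" using K by (simp add: closed_Int complete_eq_closed)
    have "x0 \<in> ?S" using K \<open>r \<ge> 0\<close> by simp
    then show "?S \<noteq> {}" by blast
    show "(\<lambda>x. x - B (f x)) ` ?S \<subseteq> ?S"
    proof clarify
      fix x assume x: "x \<in> cball x0 r" "x \<in> K"
      have "norm (x - B (f x) - x0) \<le> 1 / 2 * norm (x - x0) + norm (B (f x0))"
        using newton_contraction[OF x(1), of x0] \<open>r \<ge> 0\<close>
          norm_triangle_ineq4[of "(x - B (f x)) - (x0 - B (f x0))" "B (f x0)"] by simp
      also have "\<dots> \<le> r"
        using M[of "f x0"] f0 x(1) by (simp add: dist_norm norm_minus_commute)
      finally show "x - B (f x) \<in> ?S"
        using x K by (simp add: dist_norm norm_minus_commute)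
    qed
    show "dist (x - B (f x)) (y - B (f y)) \<le> 1/2 * dist x y" if "x \<in> ?S" "y \<in> ?S" for x y
      using newton_contraction that by (simp add: dist_norm)
  qed auto
  then obtain x where "x \<in> ?S" "x - B (f x) = x" by blast
  then show ?thesis using inj that by auto
qed

end

text \<open>Newton's iteration for \<open>A' x - y\<close> gives a preimage of y, and stability
  gives injectivity and the bound. As the bound depends on M only, it is uniform over all operators
  near A.\<close>

lemma isomorphism_perturbation:
  fixes A A' :: "'a::banach \<Rightarrow> 'b::real_normed_vector"
  assumes B: "linear B" and BA: "\<And>x. B (A x) = x" and AB: "\<And>y. A (B y) = y"
    and M: "\<And>y. norm (B y) \<le> M * norm y" "M > 0" "M * e \<le> 1 / 2"
    and A': "linear A'" and near: "\<And>x. norm (A' x - A x) \<le> e * norm x" and A: "linear A"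
  obtains B' where "linear B'" "\<And>x. B' (A' x) = x" "\<And>y. A' (B' y) = y"
    "\<And>y. norm (B' y) \<le> 2 * M * norm y"
proof -
  have ni: "near_isomorphism A B M e r 0 (\<lambda>x. A' x - y)" for r y
  proof (rule near_isomorphism.intro[OF B BA M])
    show "norm (A' x - y - (A' x' - y) - A (x - x')) \<le> e * norm (x - x')" for x x'
      using near[of "x - x'"] by (simp add: linear_diff[OF A'])
  qed
  have ex: "\<exists>x. A' x = y" for y
  proof -
    \<comment> \<open>The residual at the start 0 has norm \<open>norm y\<close>, so this is the
      smallest radius that \<open>zero_exists\<close> admits.\<close>
    interpret near_isomorphism A B M e "2 * M * norm y" 0 "\<lambda>x. A' x - y" by (rule ni)
    obtain x where "A' x - y = 0"
    proof (rule zero_exists[of UNIV])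
      show "y = 0" if "B y = 0" for y using AB[of y] that by (simp add: linear_0[OF A])
      show "M * norm (A' 0 - y) \<le> 2 * M * norm y / 2" by (simp add: linear_0[OF A'])
      show "0 \<le> 2 * M * norm y" using M_pos by simp
    qed auto
    then show ?thesis by auto
  qed
  have bd: "norm x \<le> 2 * M * norm (A' x)" for x
  proof -
    interpret near_isomorphism A B M e "norm x" 0 "\<lambda>x. A' x - 0" by (rule ni)
    show ?thesis using stability[of x 0] by (simp add: linear_0[OF A'])
  qed
  have inj: "x = x'" if "A' x = A' x'" for x x'
    using bd[of "x - x'"] that by (simp add: linear_diff[OF A'])
  obtain B' where B': "\<And>y. A' (B' y) = y" using ex by metis
  show ?thesis
  proof
    show "linear B'"
      by (rule linearI; rule inj) (simp_all add: linear_add[OF A'] linear_scale[OF A'] B')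
    show "B' (A' x) = x" for x by (rule inj) (rule B')
    show "norm (B' y) \<le> 2 * M * norm y" for y using bd[of "B' y"] by (simp add: B')
  qed (rule B')
qed

text \<open>The function U and the bound through C come from elsewhere, typically from
  \<open>stability\<close>. The bound makes U Lipschitz at \<open>z0\<close>; the first-order
  expansion of G along the graph of U can then be solved for the increment of U by B.\<close>

lemma implicit_has_derivative:
  fixes U :: "'p::real_normed_vector \<Rightarrow> 'x::real_normed_vector" and G :: "'p \<times> 'x \<Rightarrow> 'y::real_normed_vector"
  assumes G: "(G has_derivative G') (at (z0, U z0))"
    and zero: "eventually (\<lambda>z. G (z, U z) = 0) (nhds z0)"
    and C: "eventually (\<lambda>z. norm (U z - U z0) \<le> C * norm (G (z, U z0))) (nhds z0)"
    and B: "bounded_linear B" "\<And>x. B (G' (0, x)) = x"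
  shows "(U has_derivative (\<lambda>w. - B (G' (w, 0)))) (at z0)"
proof -
  interpret G': bounded_linear G' using G by (rule has_derivative_bounded_linear)
  interpret B: bounded_linear B by fact
  have G0: "G (z0, U z0) = 0" using zero by (rule eventually_nhds_x_imp_x)
  define C' where "C' = max C 0"
  have C': "C' \<ge> 0" "\<And>x. norm x \<ge> 0 \<Longrightarrow> C * norm x \<le> C' * norm x"
    by (auto simp: C'_def mult_right_mono)
  obtain K1 where K1: "K1 \<ge> 0" "\<And>z. norm (G' z) \<le> norm z * K1"
    using G'.nonneg_bounded by blast
  obtain K2 where K2: "K2 \<ge> 0" "\<And>z. norm (B z) \<le> norm z * K2"
    using B.nonneg_bounded by blast
  have approx: "\<exists>d>0. \<forall>z x. norm (z - z0) < d \<longrightarrow> norm (x - U z0) < d \<longrightarrow>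
     norm (G (z, x) - G' (z - z0, x - U z0)) \<le> e * (norm (z - z0) + norm (x - U z0))" if "e > 0" for e
  proof -
    obtain d where d: "d > 0" "\<And>y. norm (y - (z0, U z0)) < d \<Longrightarrow>
       norm (G y - G (z0, U z0) - G' (y - (z0, U z0))) \<le> e * norm (y - (z0, U z0))"
      using G \<open>e > 0\<close> unfolding has_derivative_at_alt by blast
    have pn: "norm (z - z0, x - U z0) \<le> norm (z - z0) + norm (x - U z0)" for z x
      by (rule norm_Pair_le)
    show ?thesis
    proof (intro exI[of _ "d/2"] conjI allI impI)
      fix z x assume "norm (z - z0) < d/2" "norm (x - U z0) < d/2"
      then have "norm ((z, x) - (z0, U z0)) < d" using pn[of z x] by simp
      from d(2)[OF this] have "norm (G (z, x) - G' (z - z0, x - U z0)) \<le> e * norm (z - z0, x - U z0)"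
        by (simp add: G0)
      also have "\<dots> \<le> e * (norm (z - z0) + norm (x - U z0))"
        using pn \<open>e > 0\<close> by (intro mult_left_mono) auto
      finally show "norm (G (z, x) - G' (z - z0, x - U z0)) \<le> e * (norm (z - z0) + norm (x - U z0))" .
    qed (use d in auto)
  qed
  \<comment> \<open>\<open>G (z, U z0)\<close> is at most \<open>(K1 + 1) * norm (z - z0)\<close>
    near \<open>z0\<close>: K1 from the derivative, 1 from the remainder taken with tolerance
    1.\<close>
  define L where "L = C' * (K1 + 1)"
  have L: "L \<ge> 0" using C' K1 by (simp add: L_def)
  have "eventually (\<lambda>z. norm (U z - U z0) \<le> L * norm (z - z0)) (nhds z0)"
  proof -
    obtain d where d: "d > 0" "\<And>z x. norm (z - z0) < d \<Longrightarrow> norm (x - U z0) < d \<Longrightarrow>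
       norm (G (z, x) - G' (z - z0, x - U z0)) \<le> 1 * (norm (z - z0) + norm (x - U z0))"
      using approx[of 1] by auto
    have "eventually (\<lambda>z. norm (z - z0) < d) (nhds z0)"
      using d(1) unfolding eventually_nhds_metric dist_norm by blast
    then show ?thesis using C
    proof eventually_elim
      case (elim z)
      have "norm (G (z, U z0)) \<le> norm (G' (z - z0, 0)) + norm (z - z0)"
        using d(2)[OF elim(1), of "U z0"] d(1) norm_triangle_sub[of "G (z, U z0)" "G' (z - z0, 0)"]
        by simp
      also have "\<dots> \<le> (K1 + 1) * norm (z - z0)"
        using K1(2)[of "(z - z0, 0)"] by (simp add: algebra_simps)
      finally have "C' * norm (G (z, U z0)) \<le> C' * ((K1 + 1) * norm (z - z0))"
        using C' by (intro mult_left_mono) auto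
      with elim(2) C'(2)[of "G (z, U z0)"] show ?case by (simp add: L_def mult.assoc)
    qed
  qed
  note lip = this
  have bl: "bounded_linear (\<lambda>w. - B (G' (w, 0)))"
    by (intro bounded_linear_minus bounded_linear_compose[OF B(1)]
        bounded_linear_compose[OF G'.bounded_linear_axioms] bounded_linear_Pair
        bounded_linear_ident bounded_linear_zero)
  show ?thesis unfolding has_derivative_at_alt
  proof (intro conjI allI impI bl)
    fix e :: real assume "e > 0"
    \<comment> \<open>The remainder of G along the graph is at most
      \<open>e' * (1 + L) * norm (z - z0)\<close> and then passes through B, which multiplies it by
      at most K2.\<close>
    define e' where "e' = e / ((K2 + 1) * (1 + L))"
    have e': "e' > 0" "K2 * (e' * (1 + L)) \<le> e"
    proof -
      show "e' > 0" using \<open>e > 0\<close> K2(1) L by (simp add: e'_def)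
      have "K2 * (e' * (1 + L)) = e * (K2 / (K2 + 1))"
        using L by (simp add: e'_def)
      also have "\<dots> \<le> e * 1"
        using \<open>e > 0\<close> K2(1) by (intro mult_left_mono) auto
      finally show "K2 * (e' * (1 + L)) \<le> e" by simp
    qed
    obtain d where d: "d > 0" "\<And>z x. norm (z - z0) < d \<Longrightarrow> norm (x - U z0) < d \<Longrightarrow>
       norm (G (z, x) - G' (z - z0, x - U z0)) \<le> e' * (norm (z - z0) + norm (x - U z0))"
      using approx[OF e'(1)] by blast
    define d' where "d' = min d (d / (L + 1))"
    have "d' > 0" using d L by (simp add: d'_def)
    then have "eventually (\<lambda>z. norm (z - z0) < d') (nhds z0)"
      unfolding eventually_nhds_metric dist_norm by blast
    then have "eventually (\<lambda>z. norm (U z - U z0 - - B (G' (z - z0, 0))) \<le> e * norm (z - z0)) (nhds z0)"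
      using lip zero
    proof eventually_elim
      case (elim z)
      have "norm (U z - U z0) < d"
      proof (cases "z = z0")
        case False
        have "norm (U z - U z0) \<le> (L + 1) * norm (z - z0)"
          using elim(2) norm_ge_zero[of "z - z0"] unfolding distrib_right by linarith
        also have "\<dots> < (L + 1) * (d / (L + 1))"
          using elim(1) L by (intro mult_strict_left_mono) (auto simp: d'_def)
        also have "\<dots> = d" using L by simp
        finally show ?thesis .
      qed (use d in simp)
      with d(2)[of z "U z"] elim
      have "norm (G' (z - z0, U z - U z0)) \<le> e' * (norm (z - z0) + norm (U z - U z0))"
        by (simp add: d'_def)
      also have "\<dots> \<le> e' * ((1 + L) * norm (z - z0))"
        using elim(2) e'(1) by (intro mult_left_mono) (auto simp: algebra_simps)
      finally have *: "norm (G' (z - z0, U z - U z0)) \<le> e' * ((1 + L) * norm (z - z0))" .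
      have "G' (z - z0, U z - U z0) = G' (z - z0, 0) + G' (0, U z - U z0)"
        using G'.add[of "(z - z0, 0)" "(0, U z - U z0)"] by simp
      then have "B (G' (z - z0, U z - U z0)) = U z - U z0 - - B (G' (z - z0, 0))"
        by (simp add: B.add B(2))
      then have "norm (U z - U z0 - - B (G' (z - z0, 0))) \<le> K2 * norm (G' (z - z0, U z - U z0))"
        using K2(2)[of "G' (z - z0, U z - U z0)"] by (simp add: mult.commute)
      also have "\<dots> \<le> K2 * (e' * (1 + L)) * norm (z - z0)"
        using mult_left_mono[OF * K2(1)] by (simp add: mult.assoc)
      also have "\<dots> \<le> e * norm (z - z0)"
        using e' by (intro mult_right_mono) auto
      finally show ?case .
    qed
    then show "\<exists>d>0. \<forall>y. norm (y - z0) < d \<longrightarrow>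
       norm (U y - U z0 - - B (G' (y - z0, 0))) \<le> e * norm (y - z0)"
      unfolding eventually_nhds_metric dist_norm by blast
  qed
qed

section \<open>Iterated derivatives given by multilinear maps\<close>

lemma prod_list_norm_nonneg: "prod_list (map norm vs) \<ge> (0::real)"
  by (induction vs) auto

lemma bounded_multilinear_bound:
  assumes "bounded_multilinear n M"
  obtains K where "K \<ge> 0" "\<And>vs. length vs = n \<Longrightarrow> norm (M vs) \<le> K * prod_list (map norm vs)"
proof -
  obtain K where K: "\<And>vs. length vs = n \<Longrightarrow> norm (M vs) \<le> K * prod_list (map norm vs)"
    using assms unfolding bounded_multilinear_def by blast
  have "norm (M vs) \<le> max K 0 * prod_list (map norm vs)" if "length vs = n" for vs
    using K[OF that] mult_right_mono[OF max.cobounded1[of K 0] prod_list_norm_nonneg[of vs]] by linarith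
  then show ?thesis using that[of "max K 0"] by simp
qed

lemma linear_multilinear_head:
  assumes "bounded_multilinear (Suc n) M" "length vs = n"
  shows "linear (\<lambda>v. M (v # vs))"
proof -
  have "linear (\<lambda>v. M ((0 # vs)[0 := v]))"
    using assms unfolding bounded_multilinear_def by (metis length_Cons zero_less_Suc)
  then show ?thesis by simp
qed

lemma bounded_linear_multilinear_head:
  assumes M: "bounded_multilinear (Suc n) M" "length vs = n"
  shows "bounded_linear (\<lambda>v. M (v # vs))"
proof -
  obtain K where "\<And>vs. length vs = Suc n \<Longrightarrow> norm (M vs) \<le> K * prod_list (map norm vs)"
    using bounded_multilinear_bound[OF M(1)] by metis
  then have "norm (M (v # vs)) \<le> norm v * (K * prod_list (map norm vs))" for v
    using M(2) by (metis (no_types, opaque_lifting) length_Cons list.simps(9) mult.left_commute prod_list.Cons)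
  then show ?thesis
    using linear_multilinear_head[OF M] by (auto simp: bounded_linear_def bounded_linear_axioms_def)
qed

lemma bounded_multilinear_Cons:
  assumes M: "bounded_multilinear (Suc n) M"
  shows "bounded_multilinear n (\<lambda>vs. M (v # vs))"
  unfolding bounded_multilinear_def
proof (intro conjI allI impI)
  fix vs :: "'a list" and i assume "length vs = n" "i < n"
  then have "linear (\<lambda>u. M ((v # vs)[Suc i := u]))"
    using M unfolding bounded_multilinear_def by (metis Suc_less_eq length_Cons)
  then show "linear (\<lambda>u. M (v # vs[i := u]))" by simp
next
  obtain K where K: "\<And>vs. length vs = Suc n \<Longrightarrow> norm (M vs) \<le> K * prod_list (map norm vs)"
    using bounded_multilinear_bound[OF M] by metis
  show "\<exists>K. \<forall>vs. length vs = n \<longrightarrow> norm (M (v # vs)) \<le> K * prod_list (map norm vs)"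
    using K[of "v # _"] by (intro exI[of _ "K * norm v"]) (auto simp: mult.assoc)
qed

lemma bounded_multilinear_add:
  assumes "bounded_multilinear n M" "bounded_multilinear n N"
  shows "bounded_multilinear n (\<lambda>vs. M vs + N vs)"
  unfolding bounded_multilinear_def
proof (intro conjI allI impI)
  fix vs :: "'a list" and i assume "length vs = n" "i < n"
  then show "linear (\<lambda>u. M (vs[i := u]) + N (vs[i := u]))"
    using assms unfolding bounded_multilinear_def by (intro linear_compose_add) auto
next
  obtain K where K: "\<And>vs. length vs = n \<Longrightarrow> norm (M vs) \<le> K * prod_list (map norm vs)"
    using bounded_multilinear_bound[OF assms(1)] by metis
  obtain L where L: "\<And>vs. length vs = n \<Longrightarrow> norm (N vs) \<le> L * prod_list (map norm vs)"
    using bounded_multilinear_bound[OF assms(2)] by metis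
  show "\<exists>K. \<forall>vs. length vs = n \<longrightarrow> norm (M vs + N vs) \<le> K * prod_list (map norm vs)"
    using K L by (intro exI[of _ "K + L"]) (auto simp: distrib_right intro: norm_triangle_mono)
qed

text \<open>Differentiability at a point, uniformly on bounded sets of arguments, of a family of
  multilinear maps. Substituting the arguments one at a time reduces the product rule to this notion.\<close>

definition multilinear_family_derivative ::
  "nat \<Rightarrow> ('p::real_normed_vector \<Rightarrow> 'a::real_normed_vector list \<Rightarrow> 'b::real_normed_vector)
    \<Rightarrow> ('p \<Rightarrow> 'a list \<Rightarrow> 'b) \<Rightarrow> 'p \<Rightarrow> bool" where
  "multilinear_family_derivative n M M' z0 \<longleftrightarrow>
     (\<forall>z. bounded_multilinear n (M z)) \<and> (\<forall>w. bounded_multilinear n (M' w)) \<and>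
     (\<forall>us. length us = n \<longrightarrow> linear (\<lambda>w. M' w us)) \<and>
     (\<exists>K. \<forall>w us. length us = n \<longrightarrow> norm (M' w us) \<le> K * norm w * prod_list (map norm us)) \<and>
     (\<forall>e>0. \<forall>\<^sub>F z in nhds z0. \<forall>us. length us = n \<longrightarrow>
        norm (M z us - M z0 us - M' (z - z0) us) \<le> e * norm (z - z0) * prod_list (map norm us))"

lemma has_derivative_eventually:
  assumes "(f has_derivative f') (at x)" "e > 0"
  shows "\<forall>\<^sub>F y in nhds x. norm (f y - f x - f' (y - x)) \<le> e * norm (y - x)"
  using assms unfolding has_derivative_at_alt eventually_nhds_metric dist_norm by blast

text \<open>One step of the product rule. The increment splits into the change of M at the moved
  argument \<open>v z\<close>, the value of \<open>M'\<close> at \<open>v z - v z0\<close>, and the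
  remainder of v fed into \<open>M z0\<close>. The other arguments stay free, so the step can be
  repeated.\<close>

lemma multilinear_family_derivative_Cons:
  assumes M: "multilinear_family_derivative (Suc n) M M' z0"
    and v: "(v has_derivative v') (at z0)"
  shows "multilinear_family_derivative n (\<lambda>z us. M z (v z # us))
     (\<lambda>w us. M' w (v z0 # us) + M z0 (v' w # us)) z0"
  unfolding multilinear_family_derivative_def
proof (intro conjI allI impI)
  interpret v': bounded_linear v' using v by (rule has_derivative_bounded_linear)
  have ml: "bounded_multilinear (Suc n) (M z)" "bounded_multilinear (Suc n) (M' w)"
    "length us = Suc n \<Longrightarrow> linear (\<lambda>w. M' w us)" for z w us
    using M by (auto simp: multilinear_family_derivative_def)
  obtain K where "\<And>w us. length us = Suc n \<Longrightarrow> norm (M' w us) \<le> K * norm w * prod_list (map norm us)"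
    using M unfolding multilinear_family_derivative_def by meson
  then have K: "length us = n \<Longrightarrow> norm (M' w (x # us)) \<le> K * norm w * norm x * prod_list (map norm us)"
    for us w x by (metis length_Cons list.simps(9) mult.assoc prod_list.Cons)
  obtain K0 where K0': "K0 \<ge> 0"
    "\<And>us. length us = Suc n \<Longrightarrow> norm (M z0 us) \<le> K0 * prod_list (map norm us)"
    using bounded_multilinear_bound[OF ml(1)] by metis
  then have K0: "length us = n \<Longrightarrow> norm (M z0 (x # us)) \<le> K0 * norm x * prod_list (map norm us)"
    for us x by (metis length_Cons list.simps(9) mult.assoc prod_list.Cons)
  show "bounded_multilinear n (\<lambda>us. M z (v z # us))" for z
    by (rule bounded_multilinear_Cons[OF ml(1)])
  show "bounded_multilinear n (\<lambda>us. M' w (v z0 # us) + M z0 (v' w # us))" for w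
    by (intro bounded_multilinear_add bounded_multilinear_Cons ml)
  show "linear (\<lambda>w. M' w (v z0 # us) + M z0 (v' w # us))" if "length us = n" for us
    using linear_compose[OF v'.linear linear_multilinear_head[OF ml(1) that]] that
    by (intro linear_compose_add ml(3)) (simp_all add: o_def)
  obtain Kv where Kv: "Kv \<ge> 0" "\<And>w. norm (v' w) \<le> norm w * Kv"
    using v'.nonneg_bounded by blast
  have "norm (M' w (v z0 # us) + M z0 (v' w # us))
      \<le> (K * norm (v z0) + K0 * Kv) * norm w * prod_list (map norm us)" if "length us = n" for w us
  proof -
    have "K0 * norm (v' w) \<le> K0 * (norm w * Kv)"
      using Kv(2) K0' by (intro mult_left_mono) auto
    from mult_right_mono[OF this prod_list_norm_nonneg[of us]] K0[OF that, of "v' w"]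
    have "norm (M z0 (v' w # us)) \<le> K0 * (norm w * Kv) * prod_list (map norm us)" by linarith
    with K[OF that, of w "v z0"] show ?thesis
      using norm_triangle_ineq[of "M' w (v z0 # us)" "M z0 (v' w # us)"]
      by (simp add: algebra_simps)
  qed
  then show "\<exists>K. \<forall>w us. length us = n \<longrightarrow> norm (M' w (v z0 # us) + M z0 (v' w # us))
      \<le> K * norm w * prod_list (map norm us)" by blast
  fix e :: real assume "e > 0"
  \<comment> \<open>Each of the three terms gets e / 3; the cap 1 in \<open>e2\<close> bounds
    \<open>norm (v z)\<close> by \<open>norm (v z0) + 1\<close>, on which \<open>e1\<close>
    relies.\<close>
  define e1 where "e1 = e / 3 / (norm (v z0) + 1)"
  define e2 where "e2 = min 1 (e / 3 / (\<bar>K\<bar> + 1))"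
  define e3 where "e3 = e / 3 / (K0 + 1)"
  have e1: "e1 > 0" "e1 * (norm (v z0) + 1) = e / 3"
  proof -
    have pos: "norm (v z0) + 1 > 0" by (simp add: add_nonneg_pos)
    then show "e1 > 0" using \<open>e > 0\<close> by (simp add: e1_def)
    show "e1 * (norm (v z0) + 1) = e / 3"
      by (rule nonzero_eq_divide_eq[THEN iffD1, OF _ e1_def]) (use pos in simp)
  qed
  have e2: "e2 > 0" "e2 \<le> 1" "\<bar>K\<bar> * e2 \<le> e / 3"
  proof -
    show "e2 > 0" "e2 \<le> 1" using \<open>e > 0\<close> by (auto simp: e2_def)
    have "\<bar>K\<bar> * e2 \<le> (\<bar>K\<bar> + 1) * (e / 3 / (\<bar>K\<bar> + 1))"
      using \<open>e2 > 0\<close> by (intro mult_mono) (auto simp: e2_def)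
    also have "\<dots> = e / 3"
      by (subst times_divide_eq_right, intro nonzero_mult_div_cancel_left) simp
    finally show "\<bar>K\<bar> * e2 \<le> e / 3" .
  qed
  have e3: "e3 > 0" "K0 * e3 \<le> e / 3"
  proof -
    show "e3 > 0" using \<open>e > 0\<close> K0' by (simp add: e3_def)
    have "K0 * e3 \<le> (K0 + 1) * e3" using \<open>e3 > 0\<close> by (intro mult_right_mono) auto
    also have "\<dots> = e / 3"
      unfolding e3_def using K0'(1) by (subst times_divide_eq_right, intro nonzero_mult_div_cancel_left) simp
    finally show "K0 * e3 \<le> e / 3" .
  qed
  have "\<forall>\<^sub>F z in nhds z0. \<forall>us. length us = Suc n \<longrightarrow>
     norm (M z us - M z0 us - M' (z - z0) us) \<le> e1 * norm (z - z0) * prod_list (map norm us)"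
    using M e1(1) unfolding multilinear_family_derivative_def by blast
  moreover have "\<forall>\<^sub>F z in nhds z0. dist (v z) (v z0) < e2"
  proof -
    have "isCont v z0" using v by (rule has_derivative_continuous)
    then show ?thesis
      using tendstoD[OF _ e2(1), of v "v z0" "nhds z0"]
      by (simp add: continuous_at tendsto_nhds_iff)
  qed
  ultimately show "\<forall>\<^sub>F z in nhds z0. \<forall>us. length us = n \<longrightarrow>
     norm (M z (v z # us) - M z0 (v z0 # us) - (M' (z - z0) (v z0 # us) + M z0 (v' (z - z0) # us)))
     \<le> e * norm (z - z0) * prod_list (map norm us)"
    using has_derivative_eventually[OF v e3(1)]
  proof eventually_elim
    case (elim z)
    show ?case
    proof (intro allI impI)
      fix us :: "'b list" assume us: "length us = n"
      let ?P = "prod_list (map norm us)" and ?d = "z - z0"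
      have P: "?P \<ge> 0" by (rule prod_list_norm_nonneg)
      note lin = linear_diff[OF linear_multilinear_head[OF ml(1) us]]
        linear_diff[OF linear_multilinear_head[OF ml(2) us]]
      have "norm (v z) \<le> norm (v z0) + 1"
        using elim(2) e2(2) norm_triangle_sub[of "v z" "v z0"] by (simp add: dist_norm)
      then have "e1 * norm ?d * (norm (v z) * ?P) \<le> e1 * norm ?d * ((norm (v z0) + 1) * ?P)"
        using e1(1) P by (intro mult_left_mono mult_right_mono) auto
      moreover have "norm (M z (v z # us) - M z0 (v z # us) - M' ?d (v z # us))
          \<le> e1 * norm ?d * (norm (v z) * ?P)"
        using elim(1)[rule_format, of "v z # us"] us by simp
      ultimately have "norm (M z (v z # us) - M z0 (v z # us) - M' ?d (v z # us)) \<le>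
          (e1 * (norm (v z0) + 1)) * (norm ?d * ?P)"
        by (simp only: mult_ac)
      moreover have "norm (M' ?d ((v z - v z0) # us)) \<le> e / 3 * (norm ?d * ?P)"
      proof -
        have "K * norm (v z - v z0) \<le> \<bar>K\<bar> * e2"
          using elim(2) by (intro mult_mono) (auto simp: dist_norm)
        also note e2(3)
        finally have "K * norm (v z - v z0) * (norm ?d * ?P) \<le> e / 3 * (norm ?d * ?P)"
          using P by (intro mult_right_mono) auto
        then show ?thesis using K[OF us, of ?d "v z - v z0"] by (simp add: mult_ac)
      qed
      moreover have "norm (M z0 ((v z - v z0 - v' ?d) # us)) \<le> e / 3 * (norm ?d * ?P)"
      proof -
        have "K0 * norm (v z - v z0 - v' ?d) \<le> K0 * (e3 * norm ?d)"
          using elim(3) K0' by (intro mult_left_mono) auto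
        also have "\<dots> \<le> e / 3 * norm ?d"
          unfolding mult.assoc[symmetric] by (rule mult_right_mono[OF e3(2) norm_ge_zero])
        finally have "K0 * norm (v z - v z0 - v' ?d) * ?P \<le> e / 3 * norm ?d * ?P"
          using P by (intro mult_right_mono) auto
        then show ?thesis using K0[OF us, of "v z - v z0 - v' ?d"] by (simp add: mult.assoc)
      qed
      moreover have "M z (v z # us) - M z0 (v z0 # us) - (M' ?d (v z0 # us) + M z0 (v' ?d # us)) =
        (M z (v z # us) - M z0 (v z # us) - M' ?d (v z # us)) + M' ?d ((v z - v z0) # us)
         + M z0 ((v z - v z0 - v' ?d) # us)"
        by (simp add: lin)
      moreover have tri: "norm (a + b + c) \<le> e * norm ?d * ?P"
        if "norm a \<le> e / 3 * (norm ?d * ?P)" "norm b \<le> e / 3 * (norm ?d * ?P)"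
          "norm c \<le> e / 3 * (norm ?d * ?P)" for a b c :: 'c
      proof -
        have "norm (a + b + c) \<le> e / 3 * (norm ?d * ?P) + e / 3 * (norm ?d * ?P) + e / 3 * (norm ?d * ?P)"
          by (rule norm_triangle_mono[OF norm_triangle_mono[OF that(1,2)] that(3)])
        also have "\<dots> = e * norm ?d * ?P" by (simp only: mult.assoc flip: distrib_right) simp
        finally show ?thesis .
      qed
      ultimately show "norm (M z (v z # us) - M z0 (v z0 # us) -
          (M' ?d (v z0 # us) + M z0 (v' ?d # us))) \<le> e * norm ?d * ?P"
        by (metis (no_types) e1(2) tri)
    qed
  qed
qed

text \<open>Each argument in turn is absorbed into the family, whose derivative grows by one
  summand; with no arguments left the family is an ordinary function of z.\<close>

lemma multilinear_family_has_derivative: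
  assumes "multilinear_family_derivative (length vs) M M' z0"
    and "\<And>v. v \<in> set vs \<Longrightarrow> (v has_derivative d v) (at z0)"
  shows "((\<lambda>z. M z (map (\<lambda>v. v z) vs)) has_derivative
     (\<lambda>w. M' w (map (\<lambda>v. v z0) vs) +
        (\<Sum>i<length vs. M z0 ((map (\<lambda>v. v z0) vs)[i := d (vs ! i) w])))) (at z0)"
  using assms
proof (induction vs arbitrary: M M')
  case Nil
  note M = Nil(1)[unfolded multilinear_family_derivative_def list.size]
  obtain K where "\<And>w us. length us = 0 \<Longrightarrow> norm (M' w us) \<le> K * norm w * prod_list (map norm us)"
    using M by auto
  from this[of "[]"] have K: "norm (M' w []) \<le> K * norm w" for w by simp
  have "bounded_linear (\<lambda>w. M' w [])"
    using M K by (intro linear_conv_bounded_linear[THEN iffD1, rotated] bounded_linear.intro)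
      (auto simp: bounded_linear_axioms_def mult.commute)
  moreover have "\<forall>\<^sub>F z in nhds z0. norm (M z [] - M z0 [] - M' (z - z0) []) \<le> e * norm (z - z0)"
    if "e > 0" for e
  proof -
    have "\<forall>\<^sub>F z in nhds z0. \<forall>us. length us = 0 \<longrightarrow>
        norm (M z us - M z0 us - M' (z - z0) us) \<le> e * norm (z - z0) * prod_list (map norm us)"
      using M that by simp
    then show ?thesis by (rule eventually_mono) auto
  qed
  ultimately show ?case
    unfolding has_derivative_at_alt eventually_nhds_metric dist_norm by simp
next
  case (Cons v vs)
  have "(v has_derivative d v) (at z0)" using Cons.prems(2) by simp
  with Cons.prems(1) have "multilinear_family_derivative (length vs) (\<lambda>z us. M z (v z # us))
     (\<lambda>w us. M' w (v z0 # us) + M z0 (d v w # us)) z0"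
    by (intro multilinear_family_derivative_Cons) auto
  from Cons.IH[OF this] Cons.prems(2) show ?case
    by (simp add: sum.lessThan_Suc_shift add.assoc del: sum.lessThan_Suc)
qed

section \<open>Jets of smooth maps and their chain rule\<close>

locale smooth_jet =
  fixes D :: "nat \<Rightarrow> 'a::real_normed_vector \<Rightarrow> 'a list \<Rightarrow> 'b::real_normed_vector"
  assumes ml: "bounded_multilinear n (D n x)"
    and jet: "e > 0 \<Longrightarrow> \<exists>d>0. \<forall>y. norm (y - x) < d \<longrightarrow>
      (\<forall>vs. length vs = n \<longrightarrow> norm (D n y vs - D n x vs - D (Suc n) x ((y - x) # vs))
          \<le> e * norm (y - x) * prod_list (map norm vs))"
begin

lemma family_derivative_id:
  "multilinear_family_derivative n (D n) (\<lambda>w us. D (Suc n) x (w # us)) x"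
  unfolding multilinear_family_derivative_def
proof (intro conjI allI impI ml bounded_multilinear_Cons linear_multilinear_head[OF ml])
  obtain K where "\<And>us. length us = Suc n \<Longrightarrow> norm (D (Suc n) x us) \<le> K * prod_list (map norm us)"
    using bounded_multilinear_bound[OF ml] by metis
  from this[of "_ # _"]
  show "\<exists>K. \<forall>w us. length us = n \<longrightarrow> norm (D (Suc n) x (w # us)) \<le> K * norm w * prod_list (map norm us)"
    by (auto simp: mult.assoc)
  show "\<forall>\<^sub>F z in nhds x. \<forall>us. length us = n \<longrightarrow> norm (D n z us - D n x us - D (Suc n) x ((z - x) # us))
       \<le> e * norm (z - x) * prod_list (map norm us)" if "e > 0" for e
    using jet[OF that, of x n] unfolding eventually_nhds_metric dist_norm by blast
qed auto

text \<open>Two remainders appear along \<gamma>: that of the jet at increments of \<gamma>, and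
  that of \<gamma> itself passed through the next derivative. Both are uniform in the list
  arguments, as the product rule with moving arguments requires.\<close>

lemma family_derivative:
  assumes g: "(\<gamma> has_derivative \<gamma>') (at z0)"
  shows "multilinear_family_derivative n (\<lambda>z. D n (\<gamma> z)) (\<lambda>w us. D (Suc n) (\<gamma> z0) (\<gamma>' w # us)) z0"
  unfolding multilinear_family_derivative_def
proof (intro conjI allI impI ml bounded_multilinear_Cons)
  interpret g: bounded_linear \<gamma>' using g by (rule has_derivative_bounded_linear)
  show "linear (\<lambda>w. D (Suc n) (\<gamma> z0) (\<gamma>' w # us))" if "length us = n" for us
    using linear_compose[OF g.linear linear_multilinear_head[OF ml that]] by (simp add: o_def)
  obtain K where K': "K \<ge> 0"
    "\<And>us. length us = Suc n \<Longrightarrow> norm (D (Suc n) (\<gamma> z0) us) \<le> K * prod_list (map norm us)"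
    using bounded_multilinear_bound[OF ml] by metis
  have K: "norm (D (Suc n) (\<gamma> z0) (x # us)) \<le> K * norm x * prod_list (map norm us)"
    if "length us = n" for us x
    using K'(2)[of "x # us"] that by (simp add: mult.assoc)
  obtain L where L: "L \<ge> 0" "\<And>w. norm (\<gamma>' w) \<le> norm w * L"
    using g.nonneg_bounded by blast
  have "norm (D (Suc n) (\<gamma> z0) (\<gamma>' w # us)) \<le> (K * L) * norm w * prod_list (map norm us)"
    if "length us = n" for w us
  proof -
    have "K * norm (\<gamma>' w) \<le> K * L * norm w"
      using mult_left_mono[OF L(2)[of w] K'(1)] by (simp add: mult_ac)
    from mult_right_mono[OF this prod_list_norm_nonneg[of us]] K[OF that, of "\<gamma>' w"]
    show ?thesis by linarith
  qed
  then show "\<exists>K. \<forall>w us. length us = n \<longrightarrow> norm (D (Suc n) (\<gamma> z0) (\<gamma>' w # us))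
      \<le> K * norm w * prod_list (map norm us)" by blast
  fix e :: real assume "e > 0"
  \<comment> \<open>Half of e for each remainder; the cap 1 in \<open>e2\<close> bounds the
    increment of \<gamma> by \<open>(L + 1) * norm (z - z0)\<close>.\<close>
  define e1 where "e1 = e / 2 / (L + 1)"
  define e2 where "e2 = min 1 (e / 2 / (K + 1))"
  have e1: "e1 > 0" "e1 * (L + 1) = e / 2"
  proof -
    show "e1 > 0" using \<open>e > 0\<close> L(1) by (simp add: e1_def)
    show "e1 * (L + 1) = e / 2"
      by (rule nonzero_eq_divide_eq[THEN iffD1, OF _ e1_def]) (use L(1) in simp)
  qed
  have e2: "e2 > 0" "e2 \<le> 1" "K * e2 \<le> e / 2"
  proof -
    show "e2 > 0" "e2 \<le> 1" using \<open>e > 0\<close> K'(1) by (auto simp: e2_def)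
    have "K * e2 \<le> (K + 1) * (e / 2 / (K + 1))"
      using \<open>e2 > 0\<close> K'(1) by (intro mult_mono) (auto simp: e2_def)
    also have "\<dots> = e / 2"
      using K'(1) by (subst times_divide_eq_right, intro nonzero_mult_div_cancel_left) simp
    finally show "K * e2 \<le> e / 2" .
  qed
  have "\<forall>\<^sub>F y in nhds (\<gamma> z0). \<forall>us. length us = n \<longrightarrow>
     norm (D n y us - D n (\<gamma> z0) us - D (Suc n) (\<gamma> z0) ((y - \<gamma> z0) # us))
       \<le> e1 * norm (y - \<gamma> z0) * prod_list (map norm us)"
    using family_derivative_id[of n "\<gamma> z0"] e1(1) unfolding multilinear_family_derivative_def by blast
  moreover have "filterlim \<gamma> (nhds (\<gamma> z0)) (nhds z0)"
    using has_derivative_continuous[OF g] by (simp add: continuous_at tendsto_nhds_iff)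
  ultimately have "\<forall>\<^sub>F z in nhds z0. \<forall>us. length us = n \<longrightarrow>
     norm (D n (\<gamma> z) us - D n (\<gamma> z0) us - D (Suc n) (\<gamma> z0) ((\<gamma> z - \<gamma> z0) # us))
       \<le> e1 * norm (\<gamma> z - \<gamma> z0) * prod_list (map norm us)"
    by (rule eventually_compose_filterlim)
  then show "\<forall>\<^sub>F z in nhds z0. \<forall>us. length us = n \<longrightarrow>
      norm (D n (\<gamma> z) us - D n (\<gamma> z0) us - D (Suc n) (\<gamma> z0) (\<gamma>' (z - z0) # us))
       \<le> e * norm (z - z0) * prod_list (map norm us)"
    using has_derivative_eventually[OF g e2(1)]
  proof eventually_elim
    case (elim z)
    show ?case
    proof (intro allI impI)
      fix us :: "'a list" assume us: "length us = n"
      let ?P = "prod_list (map norm us)" and ?d = "z - z0" and ?r = "\<gamma> z - \<gamma> z0 - \<gamma>' (z - z0)"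
      have P: "?P \<ge> 0" by (rule prod_list_norm_nonneg)
      have r1: "norm ?r \<le> norm ?d"
        using elim(2) e2(2) mult_right_mono[of e2 1 "norm ?d"] by simp
      have "norm (\<gamma> z - \<gamma> z0) \<le> (L + 1) * norm ?d"
        using r1 L(2)[of ?d] norm_triangle_sub[of "\<gamma> z - \<gamma> z0" "\<gamma>' ?d"]
        by (simp add: algebra_simps)
      then have "e1 * norm (\<gamma> z - \<gamma> z0) \<le> e / 2 * norm ?d"
        using mult_left_mono[OF _ less_imp_le[OF e1(1)], of "norm (\<gamma> z - \<gamma> z0)" "(L + 1) * norm ?d"]
        unfolding mult.assoc[symmetric] e1(2) by blast
      from mult_right_mono[OF this P] elim(1) us
      have 1: "norm (D n (\<gamma> z) us - D n (\<gamma> z0) us - D (Suc n) (\<gamma> z0) ((\<gamma> z - \<gamma> z0) # us))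
          \<le> e / 2 * norm ?d * ?P" by fastforce
      have "K * norm ?r \<le> K * (e2 * norm ?d)"
        using elim(2) K'(1) by (intro mult_left_mono) auto
      also have "\<dots> \<le> e / 2 * norm ?d"
        using mult_right_mono[OF e2(3), of "norm ?d"] by (simp add: mult.assoc)
      finally have 2: "norm (D (Suc n) (\<gamma> z0) (?r # us)) \<le> e / 2 * norm ?d * ?P"
        using K[OF us, of ?r] P by (meson mult_right_mono order_trans)
      have "D n (\<gamma> z) us - D n (\<gamma> z0) us - D (Suc n) (\<gamma> z0) (\<gamma>' ?d # us) =
         (D n (\<gamma> z) us - D n (\<gamma> z0) us - D (Suc n) (\<gamma> z0) ((\<gamma> z - \<gamma> z0) # us)) + D (Suc n) (\<gamma> z0) (?r # us)"
        by (simp add: linear_diff[OF linear_multilinear_head[OF ml us]])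
      then show "norm (D n (\<gamma> z) us - D n (\<gamma> z0) us - D (Suc n) (\<gamma> z0) (\<gamma>' ?d # us)) \<le> e * norm ?d * ?P"
        using norm_triangle_mono[OF 1 2] by (simp add: field_simps)
    qed
  qed
qed

lemma chain_has_derivative:
  assumes "(\<gamma> has_derivative \<gamma>') (at z0)"
    and "\<And>v. v \<in> set vs \<Longrightarrow> (v has_derivative d v) (at z0)"
  shows "((\<lambda>z. D (length vs) (\<gamma> z) (map (\<lambda>v. v z) vs)) has_derivative
     (\<lambda>w. D (Suc (length vs)) (\<gamma> z0) (\<gamma>' w # map (\<lambda>v. v z0) vs) +
        (\<Sum>i<length vs. D (length vs) (\<gamma> z0) ((map (\<lambda>v. v z0) vs)[i := d (vs ! i) w])))) (at z0)"
  by (rule multilinear_family_has_derivative[OF family_derivative[OF assms(1)] assms(2)])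

lemma has_derivative_const_args:
  "((\<lambda>z. D (length us) z us) has_derivative (\<lambda>w. D (Suc (length us)) x (w # us))) (at x)"
proof -
  let ?vs = "map (\<lambda>u (_ :: 'a). u) us" and ?n = "length us"
  have "((\<lambda>z. D (length ?vs) z (map (\<lambda>v. v z) ?vs)) has_derivative
     (\<lambda>w. D (Suc (length ?vs)) x (w # map (\<lambda>v. v x) ?vs) +
        (\<Sum>i<length ?vs. D (length ?vs) x ((map (\<lambda>v. v x) ?vs)[i := 0])))) (at x)"
    by (rule chain_has_derivative[where d="\<lambda>_ _. 0"]) (auto intro: has_derivative_ident)
  moreover have "D ?n x (us[i := 0]) = 0" if "i < ?n" for i
  proof -
    have "linear (\<lambda>v. D ?n x (us[i := v]))"
      using ml[of ?n x] that unfolding bounded_multilinear_def by blast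
    then show ?thesis by (rule linear_0)
  qed
  ultimately show ?thesis by (simp add: o_def)
qed

text \<open>Continuity in the operator norm, inherited from differentiability in that norm. With n =
  1 it provides the ball on which the derivative of F stays close to its value at the bifurcation
  point.\<close>

lemma uniformly_continuous_args:
  assumes "e > 0"
  shows "\<forall>\<^sub>F y in nhds x. \<forall>vs. length vs = n \<longrightarrow> norm (D n y vs - D n x vs) \<le> e * prod_list (map norm vs)"
proof -
  obtain K where K: "K \<ge> 0"
    "\<And>us. length us = Suc n \<Longrightarrow> norm (D (Suc n) x us) \<le> K * prod_list (map norm us)"
    using bounded_multilinear_bound[OF ml] by metis
  have "\<forall>\<^sub>F y in nhds x. \<forall>us. length us = n \<longrightarrow>
     norm (D n y us - D n x us - D (Suc n) x ((y - x) # us)) \<le> 1 * norm (y - x) * prod_list (map norm us)"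
    using family_derivative_id[of n x] unfolding multilinear_family_derivative_def by (meson zero_less_one)
  moreover have "\<forall>\<^sub>F y in nhds x. norm (y - x) < e / (K + 1)"
    using assms K(1) unfolding eventually_nhds_metric dist_norm by (intro exI[of _ "e / (K + 1)"]) auto
  ultimately show ?thesis
  proof eventually_elim
    case (elim y)
    show ?case
    proof (intro allI impI)
      fix vs :: "'a list" assume vs: "length vs = n"
      let ?P = "prod_list (map norm vs)"
      have "norm (D n y vs - D n x vs) \<le> norm (D (Suc n) x ((y - x) # vs)) + norm (y - x) * ?P"
        using elim(1) vs norm_triangle_sub[of "D n y vs - D n x vs" "D (Suc n) x ((y - x) # vs)"]
        by fastforce
      also have "\<dots> \<le> ((K + 1) * norm (y - x)) * ?P"
        using K(2)[of "(y - x) # vs"] vs by (simp add: algebra_simps)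
      also have "(K + 1) * norm (y - x) \<le> e"
        using elim(2) K(1) by (simp add: pos_less_divide_eq mult.commute)
      finally show "norm (D n y vs - D n x vs) \<le> e * ?P"
        using prod_list_norm_nonneg[of vs] by (simp add: mult_right_mono)
    qed
  qed
qed

end

lemma smooth_on_UNIV_jet:
  assumes "smooth_on UNIV f"
  obtains D where "smooth_jet D" "\<And>x. D 0 x [] = f x"
  using assms unfolding smooth_on_def smooth_jet_def by (simp, metis)

section \<open>Symmetry of the second derivative\<close>

context smooth_jet
begin

text \<open>The second difference of \<^term>\<open>D 0\<close> over the parallelogram spanned by \<open>h a\<close> and \<open>h b\<close> is
  \<open>h\<^sup>2 D\<^sup>2[a, b] + o(h\<^sup>2)\<close>, and it is symmetric in \<open>a\<close> and \<open>b\<close>.\<close>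

lemma second_difference:
  assumes "e > 0"
  shows "\<exists>h0>0. \<forall>h. 0 < h \<and> h < h0 \<longrightarrow>
    norm (D 0 (x + h *\<^sub>R a + h *\<^sub>R b) [] - D 0 (x + h *\<^sub>R a) [] - D 0 (x + h *\<^sub>R b) [] + D 0 x []
       - (h * h) *\<^sub>R D 2 x [a, b]) \<le> e * (h * h)"
proof -
  \<comment> \<open>The two increments in the estimate of \<open>\<phi>'\<close> add up to at most
    \<open>h * (norm a + 2 * norm b)\<close>; the summand 1 makes c positive.\<close>
  define c where "c = norm b * (norm a + 2 * norm b) + 1"
  have c: "c > 0" by (simp add: c_def add_nonneg_pos)
  define e' where "e' = e / c"
  have e': "e' > 0" using assms c by (simp add: e'_def)
  obtain d where d0: "d > 0" "\<And>y vs. norm (y - x) < d \<Longrightarrow> length vs = 1 \<Longrightarrow>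
      norm (D 1 y vs - D 1 x vs - D (Suc 1) x ((y - x) # vs)) \<le> e' * norm (y - x) * prod_list (map norm vs)"
    using jet[OF e', of x 1] by blast
  have d: "d > 0" "\<And>y. norm (y - x) < d \<Longrightarrow>
      norm (D 1 y [b] - D 1 x [b] - D 2 x [y - x, b]) \<le> e' * norm (y - x) * norm b"
    using d0(1) d0(2)[of _ "[b]"] by (simp_all add: numeral_2_eq_2)
  have lin: "linear (\<lambda>v. D 2 x [v, b])"
    using linear_multilinear_head[OF ml, of "[b]" 1] by (simp add: numeral_2_eq_2)
  define h0 where "h0 = d / (norm a + norm b + 1)"
  have pos: "norm a + norm b + 1 > 0" by (simp add: add_nonneg_pos)
  show ?thesis
  proof (intro exI[of _ h0] conjI allI impI)
    show "h0 > 0" using d pos by (simp add: h0_def)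
    fix h assume h: "0 < h \<and> h < h0"
    then have hd: "h * (norm a + norm b + 1) < d" using pos by (simp add: h0_def pos_less_divide_eq)
    \<comment> \<open>The increment of \<phi> over [0, h] is the quantity to be estimated. Its
      derivative is small because the first-order terms of \<open>D 1\<close> at the two base points
      differ by exactly \<open>h *\<^sub>R D 2 x [a, b]\<close>.\<close>
    define \<phi> where "\<phi> t = D 0 (x + h *\<^sub>R a + t *\<^sub>R b) [] - D 0 (x + t *\<^sub>R b) [] - (t * h) *\<^sub>R D 2 x [a, b]" for t
    define \<phi>' where "\<phi>' t = D 1 (x + h *\<^sub>R a + t *\<^sub>R b) [b] - D 1 (x + t *\<^sub>R b) [b] - h *\<^sub>R D 2 x [a, b]" for t
    have D0: "((\<lambda>z. D 0 z []) has_derivative (\<lambda>w. D 1 z [w])) (at z)" for z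
      using has_derivative_const_args[of "[]" z] by simp
    have sc: "D 1 z [s *\<^sub>R b] = s *\<^sub>R D 1 z [b]" for z s
      using linear_scale[OF linear_multilinear_head[OF ml, of "[]" 0]] by simp
    have "(\<phi> has_derivative (\<lambda>s. s *\<^sub>R \<phi>' t)) (at t within {0..h})" for t
    proof -
      have l: "((\<lambda>t. D 0 (y + t *\<^sub>R b) []) has_derivative (\<lambda>s. s *\<^sub>R D 1 (y + t *\<^sub>R b) [b])) (at t within {0..h})" for y
      proof -
        have "((\<lambda>t. y + t *\<^sub>R b) has_derivative (\<lambda>s. s *\<^sub>R b)) (at t within {0..h})"
          by (auto intro!: derivative_eq_intros)
        from has_derivative_compose[OF this D0] show ?thesis unfolding sc .
      qed
      show ?thesis unfolding \<phi>_def \<phi>'_def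
        by (rule derivative_eq_intros l refl)+ (auto simp: algebra_simps)
    qed
    moreover have "norm (\<phi>' t) \<le> e * h" if t: "t \<in> {0..h}" for t
    proof -
      let ?u = "h *\<^sub>R a + t *\<^sub>R b" and ?v = "t *\<^sub>R b"
      have tb: "t * norm b \<le> h * norm b" using t by (intro mult_right_mono) auto
      have nu: "norm ?u \<le> h * (norm a + norm b)"
        using norm_triangle_ineq[of "h *\<^sub>R a" "t *\<^sub>R b"] t h tb by (simp add: distrib_left)
      have nv: "norm ?v \<le> h * norm b" using t tb by simp
      have "norm ?u < d" using nu hd h by (simp add: distrib_left)
      from d(2)[of "x + ?u"] this have 1: "norm (D 1 (x + ?u) [b] - D 1 x [b] - D 2 x [?u, b]) \<le> e' * norm ?u * norm b"
        by simp
      have "0 \<le> h * norm a" using h by simp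
      then have "norm ?v < d" using nv hd h unfolding distrib_left by linarith
      from d(2)[of "x + ?v"] this have 2: "norm (D 1 (x + ?v) [b] - D 1 x [b] - D 2 x [?v, b]) \<le> e' * norm ?v * norm b"
        by simp
      have "\<phi>' t = (D 1 (x + ?u) [b] - D 1 x [b] - D 2 x [?u, b]) - (D 1 (x + ?v) [b] - D 1 x [b] - D 2 x [?v, b])"
        unfolding \<phi>'_def by (simp add: linear_add[OF lin] linear_scale[OF lin] add.assoc)
      then have "norm (\<phi>' t) \<le> e' * norm ?u * norm b + e' * norm ?v * norm b"
        using norm_triangle_le_diff[OF add_mono[OF 1 2]] by simp
      also have "\<dots> = (e' * norm b) * (norm ?u + norm ?v)" by (simp add: algebra_simps)
      also have "\<dots> \<le> (e' * norm b) * (h * (norm a + norm b) + h * norm b)"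
        using nu nv e' by (intro mult_left_mono add_mono) auto
      also have "\<dots> = e' * h * (norm b * (norm a + 2 * norm b))" by (simp add: algebra_simps)
      also have "\<dots> \<le> e' * h * c" using e' h by (intro mult_left_mono) (auto simp: c_def)
      also have "\<dots> = e * h" using c by (simp add: e'_def)
      finally show ?thesis .
    qed
    ultimately have "norm (\<phi> h - \<phi> 0) \<le> e * h * norm (h - 0)"
      using h by (intro differentiable_bound[of "{0..h}" \<phi> "\<lambda>t s. s *\<^sub>R \<phi>' t"] onorm_le)
        (auto simp: mult.commute mult_left_mono)
    then show "norm (D 0 (x + h *\<^sub>R a + h *\<^sub>R b) [] - D 0 (x + h *\<^sub>R a) [] - D 0 (x + h *\<^sub>R b) [] + D 0 x []
       - (h * h) *\<^sub>R D 2 x [a, b]) \<le> e * (h * h)"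
      using h by (simp add: \<phi>_def algebra_simps)
  qed
qed

lemma second_derivative_symmetric: "D 2 x [a, b] = D 2 x [b, a]"
proof (rule ccontr)
  assume ne: "D 2 x [a, b] \<noteq> D 2 x [b, a]"
  \<comment> \<open>With a third of the gap, two errors of e h^2 cannot make up the difference 3 e
    h^2.\<close>
  define e where "e = norm (D 2 x [a, b] - D 2 x [b, a]) / 3"
  have e: "e > 0" using ne by (simp add: e_def)
  let ?q = "\<lambda>h a b. D 0 (x + h *\<^sub>R a + h *\<^sub>R b) [] - D 0 (x + h *\<^sub>R a) [] - D 0 (x + h *\<^sub>R b) [] + D 0 x []"
  obtain h1 where h1: "h1 > 0" "\<And>h. 0 < h \<Longrightarrow> h < h1 \<Longrightarrow> norm (?q h a b - (h * h) *\<^sub>R D 2 x [a, b]) \<le> e * (h * h)"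
    using second_difference[OF e, of x a b] by blast
  obtain h2 where h2: "h2 > 0" "\<And>h. 0 < h \<Longrightarrow> h < h2 \<Longrightarrow> norm (?q h b a - (h * h) *\<^sub>R D 2 x [b, a]) \<le> e * (h * h)"
    using second_difference[OF e, of x b a] by blast
  define h where "h = min h1 h2 / 2"
  have h: "0 < h" "h < h1" "h < h2" using h1(1) h2(1) by (auto simp: h_def)
  have q: "?q h a b = ?q h b a" by (simp add: algebra_simps)
  have "(h * h) *\<^sub>R (D 2 x [a, b] - D 2 x [b, a]) =
      (?q h b a - (h * h) *\<^sub>R D 2 x [b, a]) - (?q h a b - (h * h) *\<^sub>R D 2 x [a, b])"
    unfolding q by (simp add: scaleR_diff_right)
  then have "norm ((h * h) *\<^sub>R (D 2 x [a, b] - D 2 x [b, a])) \<le> e * (h * h) + e * (h * h)"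
    using norm_triangle_le_diff[OF add_mono[OF h2(2)[OF h(1,3)] h1(2)[OF h(1,2)]]] by simp
  then have "(h * h) * (3 * e) \<le> (h * h) * (2 * e)" by (simp add: e_def)
  then show False using e h(1) by simp
qed

end

section \<open>Repeated differentiability\<close>

text \<open>Only derivatives in a fixed direction are differentiated again, so that all iterated
  derivatives have the type of the function.\<close>

primrec ndiff_on :: "nat \<Rightarrow> 'p::real_normed_vector set \<Rightarrow> ('p \<Rightarrow> 'e::real_normed_vector) \<Rightarrow> bool" where
  "ndiff_on 0 S f = True"
| "ndiff_on (Suc k) S f = (\<exists>f'. (\<forall>z\<in>S. (f has_derivative f' z) (at z)) \<and> (\<forall>w. ndiff_on k S (\<lambda>z. f' z w)))"

lemma ndiff_on_SucI:
  assumes "\<And>z. z \<in> S \<Longrightarrow> (f has_derivative f' z) (at z)" "\<And>w. ndiff_on k S (\<lambda>z. f' z w)"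
  shows "ndiff_on (Suc k) S f"
  using assms by auto

lemma ndiff_on_SucE:
  assumes "ndiff_on (Suc k) S f"
  obtains f' where "\<And>z. z \<in> S \<Longrightarrow> (f has_derivative f' z) (at z)" "\<And>w. ndiff_on k S (\<lambda>z. f' z w)"
  using assms by auto

lemma ndiff_on_Suc_imp: "ndiff_on (Suc k) S f \<Longrightarrow> ndiff_on k S f"
proof (induction k arbitrary: f)
  case (Suc k)
  then obtain f' where f': "\<And>z. z \<in> S \<Longrightarrow> (f has_derivative f' z) (at z)" "\<And>w. ndiff_on (Suc k) S (\<lambda>z. f' z w)"
    by (metis ndiff_on_SucE)
  show ?case by (rule ndiff_on_SucI[OF f'(1) Suc.IH[OF f'(2)]])
qed simp

lemma ndiff_on_continuous:
  assumes "ndiff_on (Suc k) S f" shows "continuous_on S f"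
  using assms
  by (metis continuous_at_imp_continuous_on has_derivative_continuous ndiff_on_SucE)

lemma ndiff_on_cong:
  assumes "ndiff_on k S f" "open S" "\<And>z. z \<in> S \<Longrightarrow> f z = g z"
  shows "ndiff_on k S g"
proof (cases k)
  case (Suc n)
  then obtain f' where f': "\<And>z. z \<in> S \<Longrightarrow> (f has_derivative f' z) (at z)" "\<And>w. ndiff_on n S (\<lambda>z. f' z w)"
    using assms(1) by (metis ndiff_on_SucE)
  have "(g has_derivative f' z) (at z)" if "z \<in> S" for z
    by (rule has_derivative_transform_within_open[OF f'(1)[OF that] assms(2) that assms(3)])
  then show ?thesis unfolding Suc using f'(2) by (rule ndiff_on_SucI)
qed simp

lemma ndiff_on_subset: "ndiff_on k S f \<Longrightarrow> T \<subseteq> S \<Longrightarrow> ndiff_on k T f"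
proof (induction k arbitrary: f)
  case (Suc k)
  then obtain f' where f': "\<And>z. z \<in> S \<Longrightarrow> (f has_derivative f' z) (at z)" "\<And>w. ndiff_on k S (\<lambda>z. f' z w)"
    by (metis ndiff_on_SucE)
  show ?case
    by (rule ndiff_on_SucI[of T f f']) (use Suc f' in auto)
qed simp

lemma ndiff_on_const: "ndiff_on k S (\<lambda>z. c)"
proof (induction k arbitrary: c)
  case (Suc k)
  show ?case by (rule ndiff_on_SucI[OF has_derivative_const Suc])
qed simp

lemma ndiff_on_bounded_linear:
  assumes "bounded_linear f" shows "ndiff_on k S f"
proof (cases k)
  case (Suc n)
  show ?thesis unfolding Suc
    by (rule ndiff_on_SucI[of _ _ "\<lambda>_. f"]) (use assms in \<open>auto intro: bounded_linear_imp_has_derivative ndiff_on_const\<close>)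
qed simp

lemma ndiff_on_compose_linear:
  assumes "bounded_linear g" "ndiff_on k S f" shows "ndiff_on k S (\<lambda>z. g (f z))"
  using assms(2)
proof (induction k arbitrary: f)
  case (Suc k)
  then obtain f' where f': "\<And>z. z \<in> S \<Longrightarrow> (f has_derivative f' z) (at z)" "\<And>w. ndiff_on k S (\<lambda>z. f' z w)"
    by (metis ndiff_on_SucE)
  show ?case
    by (rule ndiff_on_SucI[OF bounded_linear.has_derivative[OF assms(1) f'(1)] Suc.IH[OF f'(2)]])
qed simp

lemma ndiff_on_add:
  assumes "ndiff_on k S f" "ndiff_on k S g" shows "ndiff_on k S (\<lambda>z. f z + g z)"
  using assms
proof (induction k arbitrary: f g)
  case (Suc k)
  obtain f' where f': "\<And>z. z \<in> S \<Longrightarrow> (f has_derivative f' z) (at z)" "\<And>w. ndiff_on k S (\<lambda>z. f' z w)"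
    using Suc.prems(1) by (metis ndiff_on_SucE)
  obtain g' where g': "\<And>z. z \<in> S \<Longrightarrow> (g has_derivative g' z) (at z)" "\<And>w. ndiff_on k S (\<lambda>z. g' z w)"
    using Suc.prems(2) by (metis ndiff_on_SucE)
  show ?case
    by (rule ndiff_on_SucI[OF has_derivative_add[OF f'(1) g'(1)] Suc.IH[OF f'(2) g'(2)]])
qed simp

lemma ndiff_on_minus: "ndiff_on k S f \<Longrightarrow> ndiff_on k S (\<lambda>z. - f z)"
  using ndiff_on_compose_linear[OF bounded_linear_minus[OF bounded_linear_ident]] .

lemma ndiff_on_diff:
  "ndiff_on k S f \<Longrightarrow> ndiff_on k S g \<Longrightarrow> ndiff_on k S (\<lambda>z. f z - g z)"
  using ndiff_on_add[OF _ ndiff_on_minus, of k S f g] by simp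

lemma ndiff_on_sum:
  assumes "\<And>i. i \<in> I \<Longrightarrow> ndiff_on k S (f i)"
  shows "ndiff_on k S (\<lambda>z. \<Sum>i\<in>I. f i z)"
  using assms by (induction I rule: infinite_finite_induct) (auto intro: ndiff_on_const ndiff_on_add)

lemma ndiff_on_Pair:
  assumes "ndiff_on k S f" "ndiff_on k S g" shows "ndiff_on k S (\<lambda>z. (f z, g z))"
proof -
  have "bounded_linear (\<lambda>x. (x, 0))" "bounded_linear (\<lambda>x. (0, x))"
    by (intro bounded_linear_Pair bounded_linear_ident bounded_linear_zero)+
  from ndiff_on_add[OF ndiff_on_compose_linear[OF this(1) assms(1)] ndiff_on_compose_linear[OF this(2) assms(2)]]
  show ?thesis by simp
qed

section \<open>Products, reciprocals and compositions\<close>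

lemma (in bounded_bilinear) ndiff_on:
  assumes "ndiff_on k S f" "ndiff_on k S g" shows "ndiff_on k S (\<lambda>z. prod (f z) (g z))"
  using assms
proof (induction k arbitrary: f g)
  case (Suc k)
  obtain f' where f': "\<And>z. z \<in> S \<Longrightarrow> (f has_derivative f' z) (at z)" "\<And>w. ndiff_on k S (\<lambda>z. f' z w)"
    using Suc.prems(1) by (metis ndiff_on_SucE)
  obtain g' where g': "\<And>z. z \<in> S \<Longrightarrow> (g has_derivative g' z) (at z)" "\<And>w. ndiff_on k S (\<lambda>z. g' z w)"
    using Suc.prems(2) by (metis ndiff_on_SucE)
  show ?case
    by (rule ndiff_on_SucI[OF FDERIV[OF f'(1) g'(1)]])
      (assumption | intro ndiff_on_add Suc.IH f'(2) g'(2) Suc.prems[THEN ndiff_on_Suc_imp])+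
qed simp

lemmas ndiff_on_scaleR = bounded_bilinear.ndiff_on[OF bounded_bilinear_scaleR]
lemmas ndiff_on_mult = bounded_bilinear.ndiff_on[OF bounded_bilinear_mult]

lemma ndiff_on_inverse:
  fixes f :: "'p::real_normed_vector \<Rightarrow> real"
  assumes "ndiff_on k S f" "\<And>z. z \<in> S \<Longrightarrow> f z \<noteq> 0"
  shows "ndiff_on k S (\<lambda>z. inverse (f z))"
  using assms
proof (induction k arbitrary: f)
  case (Suc k)
  obtain f' where f': "\<And>z. z \<in> S \<Longrightarrow> (f has_derivative f' z) (at z)" "\<And>w. ndiff_on k S (\<lambda>z. f' z w)"
    using Suc.prems(1) by (metis ndiff_on_SucE)
  have "((\<lambda>z. inverse (f z)) has_derivative (\<lambda>w. - (inverse (f z) * f' z w * inverse (f z)))) (at z)"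
    if "z \<in> S" for z
    using Deriv.has_derivative_inverse[OF Suc.prems(2)[OF that] f'(1)[OF that]] .
  moreover have "ndiff_on k S (\<lambda>z. - (inverse (f z) * f' z w * inverse (f z)))" for w
    by (intro ndiff_on_minus ndiff_on_mult f'(2) Suc.IH Suc.prems(1)[THEN ndiff_on_Suc_imp] Suc.prems(2))
  ultimately show ?case by (rule ndiff_on_SucI)
qed simp

text \<open>The chain rule evaluates \<open>f'\<close> at the moving direction
  \<open>g' z w\<close>, while \<open>ndiff_on\<close> speaks of fixed directions only. On the plane
  the direction splits into two scalar coordinates with fixed basis vectors, so the product rule
  suffices.\<close>

lemma ndiff_on_compose_plane:
  fixes f :: "real \<times> real \<Rightarrow> 'e::real_normed_vector"
  assumes "ndiff_on k S f" "ndiff_on k T \<gamma>" "\<gamma> ` T \<subseteq> S"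
  shows "ndiff_on k T (\<lambda>z. f (\<gamma> z))"
  using assms(1,2)
proof (induction k arbitrary: f)
  case (Suc k)
  obtain f' where f': "\<And>z. z \<in> S \<Longrightarrow> (f has_derivative f' z) (at z)" "\<And>w. ndiff_on k S (\<lambda>z. f' z w)"
    using Suc.prems(1) by (metis ndiff_on_SucE)
  obtain g' where g': "\<And>z. z \<in> T \<Longrightarrow> (\<gamma> has_derivative g' z) (at z)" "\<And>w. ndiff_on k T (\<lambda>z. g' z w)"
    using Suc.prems(2) by (metis ndiff_on_SucE)
  have *: "f' (\<gamma> z) w = fst w *\<^sub>R f' (\<gamma> z) (1, 0) + snd w *\<^sub>R f' (\<gamma> z) (0, 1)" if "z \<in> T" for z w
  proof -
    have "linear (f' (\<gamma> z))"
      using f'(1)[of "\<gamma> z"] assms(3) that by (intro has_derivative_linear) auto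
    from linear_add[OF this, of "fst w *\<^sub>R (1, 0)" "snd w *\<^sub>R (0, 1)"]
      linear_scale[OF this, of "fst w" "(1, 0)"] linear_scale[OF this, of "snd w" "(0, 1)"]
    show ?thesis by simp
  qed
  have "((\<lambda>z. f (\<gamma> z)) has_derivative (\<lambda>w. fst (g' z w) *\<^sub>R f' (\<gamma> z) (1, 0) + snd (g' z w) *\<^sub>R f' (\<gamma> z) (0, 1))) (at z)"
    if "z \<in> T" for z
  proof -
    have "\<gamma> z \<in> S" using assms(3) that by blast
    from has_derivative_compose[OF g'(1)[OF that] f'(1)[OF this]] show ?thesis
      by (rule has_derivative_eq_rhs) (rule ext, rule *[OF that])
  qed
  moreover have "ndiff_on k T (\<lambda>z. fst (g' z w) *\<^sub>R f' (\<gamma> z) (1, 0) + snd (g' z w) *\<^sub>R f' (\<gamma> z) (0, 1))" for w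
    by (intro ndiff_on_add ndiff_on_scaleR Suc.IH f'(2) ndiff_on_Suc_imp[OF Suc.prems(2)]
        ndiff_on_compose_linear[OF bounded_linear_fst] ndiff_on_compose_linear[OF bounded_linear_snd] g'(2))
  ultimately show ?case by (rule ndiff_on_SucI)
qed simp

text \<open>For jets a moving direction is harmless, since it enters as one more list argument. The
  derivative is a sum of expressions of the same form with other lists, so the induction on k runs
  over all lists at once.\<close>

lemma (in smooth_jet) ndiff_on_compose:
  assumes "ndiff_on k S \<gamma>" "\<And>v. v \<in> set vs \<Longrightarrow> ndiff_on k S v"
  shows "ndiff_on k S (\<lambda>z. D (length vs) (\<gamma> z) (map (\<lambda>v. v z) vs))"
  using assms
proof (induction k arbitrary: vs)
  case (Suc k)
  obtain g' where g': "\<And>z. z \<in> S \<Longrightarrow> (\<gamma> has_derivative g' z) (at z)" "\<And>w. ndiff_on k S (\<lambda>z. g' z w)"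
    using Suc.prems(1) by (metis ndiff_on_SucE)
  have "\<forall>v\<in>set vs. \<exists>v'. (\<forall>z\<in>S. (v has_derivative v' z) (at z)) \<and> (\<forall>w. ndiff_on k S (\<lambda>z. v' z w))"
    using Suc.prems(2) by (metis ndiff_on_SucE)
  then obtain d where d: "\<And>v z. v \<in> set vs \<Longrightarrow> z \<in> S \<Longrightarrow> (v has_derivative d v z) (at z)"
    "\<And>v w. v \<in> set vs \<Longrightarrow> ndiff_on k S (\<lambda>z. d v z w)"
    by metis
  let ?n = "length vs"
  note deriv = chain_has_derivative[OF g'(1) d(1)]
  have "ndiff_on k S (\<lambda>z. D (Suc ?n) (\<gamma> z) (g' z w # map (\<lambda>v. v z) vs) +
        (\<Sum>i<?n. D ?n (\<gamma> z) ((map (\<lambda>v. v z) vs)[i := d (vs ! i) z w])))" for w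
  proof (intro ndiff_on_add ndiff_on_sum)
    have \<gamma>: "ndiff_on k S \<gamma>" using Suc.prems(1) by (rule ndiff_on_Suc_imp)
    have vs: "ndiff_on k S v" if "v \<in> set vs" for v
      using Suc.prems(2)[OF that] by (rule ndiff_on_Suc_imp)
    show "ndiff_on k S (\<lambda>z. D (Suc ?n) (\<gamma> z) (g' z w # map (\<lambda>v. v z) vs))"
      using Suc.IH[of "(\<lambda>z. g' z w) # vs"] \<gamma> vs g'(2) by auto
    fix i assume i: "i \<in> {..<?n}"
    have "ndiff_on k S v" if "v \<in> set (vs[i := \<lambda>z. d (vs ! i) z w])" for v
      using that set_update_subset_insert[of vs i] vs d(2)[of "vs ! i" w] i by auto
    from Suc.IH[OF \<gamma>, of "vs[i := \<lambda>z. d (vs ! i) z w]"] this show "ndiff_on k S (\<lambda>z. D ?n (\<gamma> z) ((map (\<lambda>v. v z) vs)[i := d (vs ! i) z w]))"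
      by (simp add: map_update)
  qed
  with deriv show ?case by (rule ndiff_on_SucI)
qed simp

text \<open>Differentiating \<open>A(z) x(z) = y(z)\<close> gives an equation of the same form for the derivative
  of \<open>x\<close>, which drives the induction.\<close>

lemma (in smooth_jet) ndiff_on_linear_solution:
  fixes J :: "'x::real_normed_vector \<Rightarrow> 'a" and K :: "'x \<Rightarrow> 'b"
    and \<gamma> :: "'p::real_normed_vector \<Rightarrow> 'a"
  assumes S: "open S" and J: "bounded_linear J" and K: "bounded_linear K"
    and B: "\<And>z. z \<in> S \<Longrightarrow> linear (B z)" "\<And>z y. z \<in> S \<Longrightarrow> norm (B z y) \<le> C * norm y"
    and BA: "\<And>z x. z \<in> S \<Longrightarrow> B z (D 1 (\<gamma> z) [J x] + K x) = x"
    and AB: "\<And>z y. z \<in> S \<Longrightarrow> D 1 (\<gamma> z) [J (B z y)] + K (B z y) = y"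
    and "ndiff_on k S \<gamma>" "ndiff_on k S y"
    and "\<And>z. z \<in> S \<Longrightarrow> D 1 (\<gamma> z) [J (x z)] + K (x z) = y z"
  shows "ndiff_on k S x"
  using assms(8-)
proof (induction k arbitrary: x y)
  case (Suc k)
  obtain g' where g': "\<And>z. z \<in> S \<Longrightarrow> (\<gamma> has_derivative g' z) (at z)" "\<And>w. ndiff_on k S (\<lambda>z. g' z w)"
    using Suc.prems(1) by (metis ndiff_on_SucE)
  obtain y' where y': "\<And>z. z \<in> S \<Longrightarrow> (y has_derivative y' z) (at z)" "\<And>w. ndiff_on k S (\<lambda>z. y' z w)"
    using Suc.prems(2) by (metis ndiff_on_SucE)
  have \<gamma>: "ndiff_on k S \<gamma>" using Suc.prems(1) by (rule ndiff_on_Suc_imp)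
  have xk: "ndiff_on k S x"
    by (rule Suc.IH[OF \<gamma> ndiff_on_Suc_imp[OF Suc.prems(2)] Suc.prems(3)])
  \<comment> \<open>Solves the differentiated equation: the term in which the derivative falls on
    \<open>D 1 (\<gamma> z)\<close> goes to the right-hand side, and \<open>B z\<close> inverts the
    operator.\<close>
  define x' where "x' z w = B z (y' z w - D 2 (\<gamma> z) [g' z w, J (x z)])" for z w
  have lin0: "D 1 (\<gamma> z) [J 0] + K 0 = 0" for z
    using linear_0[OF linear_multilinear_head[OF ml, of "[]" 0]] linear_0[OF bounded_linear.linear[OF J]]
      linear_0[OF bounded_linear.linear[OF K]] by simp
  have "(x has_derivative x' z0) (at z0)" if z0: "z0 \<in> S" for z0
  proof -
    define G where "G = (\<lambda>p. D 1 (\<gamma> (fst p)) [J (snd p)] + K (snd p) - y (fst p))"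
    define G' where "G' = (\<lambda>w. D 2 (\<gamma> z0) [g' z0 (fst w), J (x z0)] + D 1 (\<gamma> z0) [J (snd w)] + K (snd w) - y' z0 (fst w))"
    have \<gamma>': "((\<lambda>p. \<gamma> (fst p)) has_derivative (\<lambda>w. g' z0 (fst w))) (at (z0, x z0))"
      using has_derivative_compose[OF has_derivative_fst[OF has_derivative_ident], of \<gamma> _ "(z0, x z0)"] g'(1)[OF z0] by simp
    have "((\<lambda>p :: 'p \<times> 'x. J (snd p)) has_derivative (\<lambda>w. J (snd w))) (at (z0, x z0))"
      by (intro bounded_linear_imp_has_derivative bounded_linear_compose[OF J bounded_linear_snd])
    with chain_has_derivative[OF \<gamma>', of "[\<lambda>p :: 'p \<times> 'x. J (snd p)]" "\<lambda>_ w. J (snd w)"]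
    have 1: "((\<lambda>p. D 1 (\<gamma> (fst p)) [J (snd p)]) has_derivative
       (\<lambda>w. D 2 (\<gamma> z0) [g' z0 (fst w), J (x z0)] + D 1 (\<gamma> z0) [J (snd w)])) (at (z0, x z0))"
      by (simp add: numeral_2_eq_2)
    have 2: "((\<lambda>p. y (fst p)) has_derivative (\<lambda>w. y' z0 (fst w))) (at (z0, x z0))"
      using has_derivative_compose[OF has_derivative_fst[OF has_derivative_ident], of y _ "(z0, x z0)"] y'(1)[OF z0] by simp
    have G: "(G has_derivative G') (at (z0, x z0))"
      unfolding G_def G'_def
      by (intro has_derivative_diff has_derivative_add 1 2 bounded_linear_imp_has_derivative
          bounded_linear_compose[OF K bounded_linear_snd])
    have ev: "\<forall>\<^sub>F z in nhds z0. z \<in> S" using S z0 by (rule eventually_nhds_in_open)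
    have BL: "bounded_linear (B z0)"
      using B[OF z0] by (auto simp: bounded_linear_def bounded_linear_axioms_def mult.commute)
    interpret B0: bounded_linear "B z0" by (rule BL)
    interpret Dl: linear "\<lambda>v. D 2 (\<gamma> z0) [v, J (x z0)]"
      using linear_multilinear_head[OF ml, of "[J (x z0)]" 1] by (simp add: numeral_2_eq_2)
    have g0: "g' z0 0 = 0" "y' z0 0 = 0"
      using g'(1)[OF z0] y'(1)[OF z0] has_derivative_linear linear_0 by blast+
    have "(x has_derivative (\<lambda>w. - B z0 (G' (w, 0)))) (at z0)"
    proof (rule implicit_has_derivative[where U=x, OF G _ _ BL])
      show "\<forall>\<^sub>F z in nhds z0. G (z, x z) = 0"
        using ev by eventually_elim (simp add: G_def Suc.prems(3)[unfolded One_nat_def])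
      show "B z0 (G' (0, \<xi>)) = \<xi>" for \<xi>
        using BA[OF z0] by (simp add: G'_def g0 Dl.zero)
      show "\<forall>\<^sub>F z in nhds z0. norm (x z - x z0) \<le> C * norm (G (z, x z0))"
        using ev
      proof eventually_elim
        case (elim z)
        \<comment> \<open>The uniform bound C on the inverses controls the increment of x by the
          residual of \<open>x z0\<close> in the equation at z.\<close>
        have "x z - x z0 = B z (y z) - B z (D 1 (\<gamma> z) [J (x z0)] + K (x z0))"
          using BA[OF elim] Suc.prems(3)[OF elim] by metis
        also have "\<dots> = B z (- G (z, x z0))"
          by (simp add: G_def linear_diff[OF B(1)[OF elim], symmetric])
        finally show ?case using B(2)[OF elim, of "- G (z, x z0)"] by simp
      qed
    qed
    moreover have "- B z0 (G' (w, 0)) = x' z0 w" for w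
      using lin0[of z0] by (simp add: G'_def x'_def add.assoc flip: B0.neg)
    ultimately show ?thesis by simp
  qed
  moreover have "ndiff_on k S (\<lambda>z. x' z w)" for w
  proof (rule Suc.IH[OF \<gamma>])
    show "D 1 (\<gamma> z) [J (x' z w)] + K (x' z w) = y' z w - D 2 (\<gamma> z) [g' z w, J (x z)]" if "z \<in> S" for z
      using AB[OF that] by (simp add: x'_def)
    show "ndiff_on k S (\<lambda>z. y' z w - D 2 (\<gamma> z) [g' z w, J (x z)])"
      using ndiff_on_compose[OF \<gamma>, of "[\<lambda>z. g' z w, \<lambda>z. J (x z)]"] g'(2) ndiff_on_compose_linear[OF J xk]
      by (intro ndiff_on_diff y'(2)) (auto simp: numeral_2_eq_2)
  qed
  ultimately show ?case by (rule ndiff_on_SucI)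
qed simp

section \<open>Hadamard's lemma\<close>

text \<open>For m = 0 and f a partial derivative in t this is the quotient by t in Hadamard's lemma.
  Each derivative in t brings out a factor \<tau>; the weight \<open>\<tau> ^ m\<close> makes the
  family closed under that.\<close>

definition hadamard :: "nat \<Rightarrow> (real \<times> real \<Rightarrow> real) \<Rightarrow> real \<times> real \<Rightarrow> real" where
  "hadamard m f z = integral {0..1} (\<lambda>\<tau>. \<tau> ^ m * f (fst z, \<tau> * snd z))"

lemma hadamard_has_derivative:
  assumes S: "open S" "convex S" "\<And>x t \<tau>. (x, t) \<in> S \<Longrightarrow> 0 \<le> \<tau> \<Longrightarrow> \<tau> \<le> 1 \<Longrightarrow> (x, \<tau> * t) \<in> S"
    and f: "\<And>z. z \<in> S \<Longrightarrow> (f has_derivative (\<lambda>w. fst w * f1 z + snd w * f2 z)) (at z)"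
    and cont: "continuous_on S f1" "continuous_on S f2"
    and z: "z \<in> S"
  shows "(hadamard m f has_derivative (\<lambda>w. fst w * hadamard m f1 z + snd w * hadamard (Suc m) f2 z)) (at z)"
proof -
  have contf: "continuous_on S f"
    using f by (meson continuous_at_imp_continuous_on has_derivative_continuous)
  \<comment> \<open>The derivative of the integrand as a bounded operator, since the Leibniz rule
    integrates operator-valued functions; it is evaluated at w only after the integration.\<close>
  define E where "E z \<tau> = (\<tau> ^ m * f1 (fst z, \<tau> * snd z)) *\<^sub>R (fst_blinfun :: (real \<times> real) \<Rightarrow>\<^sub>L real) +
     (\<tau> ^ Suc m * f2 (fst z, \<tau> * snd z)) *\<^sub>R (snd_blinfun :: (real \<times> real) \<Rightarrow>\<^sub>L real)" for z \<tau>
  have c\<tau>: "continuous_on {0..1} (\<lambda>\<tau>. g (fst z, \<tau> * snd z))" if "continuous_on S g" "z \<in> S" for g :: "real \<times> real \<Rightarrow> real" and z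
    by (rule continuous_on_compose2[OF that(1)]) (use S(3) that(2) in \<open>auto intro!: continuous_intros\<close>)
  have cS: "continuous_on (S \<times> cbox 0 1) (\<lambda>p. g (fst (fst p), snd p * snd (fst p)))" if "continuous_on S g" for g :: "real \<times> real \<Rightarrow> real"
    by (rule continuous_on_compose2[OF that]) (use S(3) in \<open>auto intro!: continuous_intros\<close>)
  have "((\<lambda>x. integral (cbox 0 1) (\<lambda>\<tau>. \<tau> ^ m * f (fst x, \<tau> * snd x))) has_derivative
      blinfun_apply (integral (cbox 0 1) (E z))) (at z within S)"
  proof (rule leibniz_rule[OF _ _ _ z S(2)])
    fix x and \<tau> :: real assume x: "x \<in> S" "\<tau> \<in> cbox 0 1"
    then have "(fst x, \<tau> * snd x) \<in> S" using S(3)[of "fst x" "snd x" \<tau>] by auto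
    then have "(f has_derivative (\<lambda>w. fst w * f1 (fst x, \<tau> * snd x) + snd w * f2 (fst x, \<tau> * snd x))) (at (fst x, \<tau> * snd x))"
      by (rule f)
    moreover have "((\<lambda>x. (fst x, \<tau> * snd x)) has_derivative (\<lambda>w. (fst w, \<tau> * snd w))) (at x within S)"
      by (auto intro!: derivative_eq_intros)
    ultimately have "((\<lambda>x. f (fst x, \<tau> * snd x)) has_derivative
       (\<lambda>w. fst w * f1 (fst x, \<tau> * snd x) + \<tau> * snd w * f2 (fst x, \<tau> * snd x))) (at x within S)"
      using has_derivative_compose[of "\<lambda>x. (fst x, \<tau> * snd x)" _ x S f] by fastforce
    note deriv = has_derivative_mult_right[OF this, of "\<tau> ^ m"]
    show "((\<lambda>x. \<tau> ^ m * f (fst x, \<tau> * snd x)) has_derivative blinfun_apply (E x \<tau>)) (at x within S)"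
      by (rule has_derivative_eq_rhs[OF deriv], rule ext) (simp add: E_def blinfun.bilinear_simps algebra_simps)
  next
    fix x assume "x \<in> S"
    then show "(\<lambda>\<tau>. \<tau> ^ m * f (fst x, \<tau> * snd x)) integrable_on cbox 0 1"
      using c\<tau>[OF contf] by (intro integrable_continuous) (auto intro!: continuous_intros)
  next
    show "continuous_on (S \<times> cbox 0 1) (\<lambda>(x, t). E x t)"
      unfolding E_def split_beta by (intro continuous_intros cS cont)
  qed
  then have 1: "(hadamard m f has_derivative blinfun_apply (integral (cbox 0 1) (E z))) (at z)"
    unfolding at_within_open[OF z S(1)]
    by (rule has_derivative_transform[rotated 2]) (simp_all add: hadamard_def)
  have int: "E z integrable_on cbox 0 1"
    unfolding E_def[abs_def] using c\<tau>[OF cont(1) z] c\<tau>[OF cont(2) z]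
    by (intro integrable_continuous) (auto intro!: continuous_intros)
  have i1: "(\<lambda>\<tau>. \<tau> ^ m * f1 (fst z, \<tau> * snd z)) integrable_on {0..1}"
    "(\<lambda>\<tau>. \<tau> ^ Suc m * f2 (fst z, \<tau> * snd z)) integrable_on {0..1}"
    using c\<tau>[OF cont(1) z] c\<tau>[OF cont(2) z] by (auto intro!: integrable_continuous_real continuous_intros)
  have "blinfun_apply (integral (cbox 0 1) (E z)) w = fst w * hadamard m f1 z + snd w * hadamard (Suc m) f2 z" for w
  proof -
    have "blinfun_apply (integral (cbox 0 1) (E z)) w = integral {0..1} (\<lambda>\<tau>. blinfun_apply (E z \<tau>) w)"
      using blinfun_apply_integral[OF int] by simp
    also have "\<dots> = integral {0..1} (\<lambda>\<tau>. fst w * (\<tau> ^ m * f1 (fst z, \<tau> * snd z)) + snd w * (\<tau> ^ Suc m * f2 (fst z, \<tau> * snd z)))"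
      by (simp add: E_def blinfun.bilinear_simps mult_ac)
    also have "\<dots> = fst w * hadamard m f1 z + snd w * hadamard (Suc m) f2 z"
      unfolding hadamard_def using i1
      by (subst integral_add) (auto intro!: integrable_on_mult_right simp del: power_Suc)
    finally show ?thesis .
  qed
  then show ?thesis by (intro has_derivative_eq_rhs[OF 1] ext)
qed

lemma ndiff_on_plane_SucE:
  fixes f :: "real \<times> real \<Rightarrow> real"
  assumes "ndiff_on (Suc k) S f"
  obtains f1 f2 where "\<And>z. z \<in> S \<Longrightarrow> (f has_derivative (\<lambda>w. fst w * f1 z + snd w * f2 z)) (at z)"
    "ndiff_on k S f1" "ndiff_on k S f2"
proof -
  obtain f' where f': "\<And>z. z \<in> S \<Longrightarrow> (f has_derivative f' z) (at z)" "\<And>w. ndiff_on k S (\<lambda>z. f' z w)"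
    using assms by (metis ndiff_on_SucE)
  have "f' z w = fst w * f' z (1, 0) + snd w * f' z (0, 1)" if "z \<in> S" for z w
  proof -
    have "linear (f' z)" using f'(1)[OF that] by (rule has_derivative_linear)
    from linear_add[OF this, of "fst w *\<^sub>R (1, 0)" "snd w *\<^sub>R (0, 1)"]
      linear_scale[OF this, of "fst w" "(1, 0)"] linear_scale[OF this, of "snd w" "(0, 1)"]
    show ?thesis by simp
  qed
  then have "(f has_derivative (\<lambda>w. fst w * f' z (1, 0) + snd w * f' z (0, 1))) (at z)" if "z \<in> S" for z
    using f'(1)[OF that] that by (metis (no_types, lifting) ext)
  then show ?thesis using f'(2) by (intro that[of "\<lambda>z. f' z (1, 0)" "\<lambda>z. f' z (0, 1)"])
qed

text \<open>The induction covers all m together, as a derivative in t raises the exponent. One order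
  is lost because differentiation under the integral takes continuous partial derivatives.\<close>

lemma ndiff_on_hadamard:
  assumes S: "open S" "convex S" "\<And>x t \<tau>. (x, t) \<in> S \<Longrightarrow> 0 \<le> \<tau> \<Longrightarrow> \<tau> \<le> 1 \<Longrightarrow> (x, \<tau> * t) \<in> S"
    and "ndiff_on (Suc k) S f"
  shows "ndiff_on k S (hadamard m f)"
  using assms(4)
proof (induction k arbitrary: f m)
  case (Suc k)
  obtain f1 f2 where f: "\<And>z. z \<in> S \<Longrightarrow> (f has_derivative (\<lambda>w. fst w * f1 z + snd w * f2 z)) (at z)"
    "ndiff_on (Suc k) S f1" "ndiff_on (Suc k) S f2"
    by (rule ndiff_on_plane_SucE[OF Suc.prems]) blast
  show ?case
    by (rule ndiff_on_SucI[OF hadamard_has_derivative[OF S f(1) f(2,3)[THEN ndiff_on_continuous]]])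
      (intro ndiff_on_add ndiff_on_mult ndiff_on_const Suc.IH f | assumption)+
qed simp

text \<open>The fundamental theorem of calculus for \<open>f (x, \<tau> * t)\<close> as a function
  of \<tau> on [0, 1].\<close>

lemma hadamard_division:
  assumes S: "\<And>\<tau>. 0 \<le> \<tau> \<Longrightarrow> \<tau> \<le> 1 \<Longrightarrow> (x, \<tau> * t) \<in> S"
    and f: "\<And>z. z \<in> S \<Longrightarrow> (f has_derivative (\<lambda>w. fst w * f1 z + snd w * f2 z)) (at z)"
  shows "t * hadamard 0 f2 (x, t) = f (x, t) - f (x, 0)"
proof -
  have "((\<lambda>\<tau>. f (x, \<tau> * t)) has_vector_derivative (t * f2 (x, \<tau> * t))) (at \<tau> within {0..1})"
    if "\<tau> \<in> {0..1}" for \<tau>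
  proof -
    have "((\<lambda>\<tau>. (x, \<tau> * t)) has_derivative (\<lambda>s. (0, s * t))) (at \<tau> within {0..1})"
      by (auto intro!: derivative_eq_intros)
    from has_derivative_compose[OF this f] S that show ?thesis
      by (simp add: has_vector_derivative_def mult_ac)
  qed
  then have "((\<lambda>\<tau>. t * f2 (x, \<tau> * t)) has_integral (f (x, 1 * t) - f (x, 0 * t))) {0..1}"
    by (intro fundamental_theorem_of_calculus) auto
  then show ?thesis by (simp add: hadamard_def has_integral_iff)
qed

section \<open>Smooth curves\<close>

text \<open>On the line an n-linear map is determined by its value at a list of ones, so evaluation
  there turns the jet into ordinary iterated derivatives.\<close>

lemma smooth_on_real_derivatives:
  fixes f :: "real \<Rightarrow> 'e::real_normed_vector"
  assumes S: "smooth_on S f"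
  obtains g where "\<And>x. x \<in> S \<Longrightarrow> g 0 x = f x"
    "\<And>n x. x \<in> S \<Longrightarrow> (g n has_vector_derivative g (Suc n) x) (at x)"
proof -
  from S obtain D where S: "open S" and D: "\<And>x. x \<in> S \<Longrightarrow> D 0 x [] = f x"
      "\<And>n x. x \<in> S \<Longrightarrow> bounded_multilinear n (D n x)"
    and jet: "\<And>n x e. x \<in> S \<Longrightarrow> e > 0 \<Longrightarrow> \<exists>d>0. \<forall>y\<in>S. norm (y - x) < d \<longrightarrow>
           (\<forall>vs. length vs = n \<longrightarrow>
              norm (D n y vs - D n x vs - D (Suc n) x ((y - x) # vs))
                \<le> e * norm (y - x) * prod_list (map norm vs))"
    unfolding smooth_on_def by (elim conjE exE) blast
  define g where "g n x = D n x (replicate n 1)" for n x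
  have "(g n has_vector_derivative g (Suc n) x) (at x)" if x: "x \<in> S" for n x
  proof -
    have lin: "D (Suc n) x (s # replicate n 1) = s *\<^sub>R g (Suc n) x" for s
    proof -
      have "linear (\<lambda>v. D (Suc n) x (v # replicate n 1))"
        by (rule linear_multilinear_head[OF D(2)[OF x]]) simp
      from linear_scale[OF this, of s 1] show ?thesis by (simp add: g_def)
    qed
    have "(g n has_derivative (\<lambda>s. s *\<^sub>R g (Suc n) x)) (at x within S)"
      unfolding has_derivative_within_alt
    proof (intro conjI allI impI bounded_linear_scaleR_left)
      fix e :: real assume "e > 0"
      from jet[OF x this, of n] obtain d where d: "d > 0"
        "\<And>y vs. y \<in> S \<Longrightarrow> norm (y - x) < d \<Longrightarrow> length vs = n \<Longrightarrow> norm (D n y vs - D n x vs -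
             D (Suc n) x ((y - x) # vs)) \<le> e * norm (y - x) * prod_list (map norm vs)"
        by blast
      have P: "prod_list (map norm (replicate n (1::real))) = 1" by (induction n) auto
      have "norm (g n y - g n x - (y - x) *\<^sub>R g (Suc n) x) \<le> e * norm (y - x)"
        if "y \<in> S" "norm (y - x) < d" for y
        using d(2)[OF that length_replicate[of n 1]] unfolding lin P g_def[of n] by simp
      with d(1) show "\<exists>d>0. \<forall>y\<in>S. norm (y - x) < d \<longrightarrow>
          norm (g n y - g n x - (y - x) *\<^sub>R g (Suc n) x) \<le> e * norm (y - x)"
        by blast
    qed
    then show ?thesis
      unfolding has_vector_derivative_def at_within_open[OF x S] .
  qed
  then show ?thesis using that[of g] D(1) by (simp add: g_def)
qed

lemma ndiff_on_vector_derivative: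
  fixes f :: "real \<Rightarrow> 'e::real_normed_vector"
  assumes "ndiff_on (Suc k) S f" "open S"
  shows "ndiff_on k S (\<lambda>x. vector_derivative f (at x))"
proof -
  obtain f' where f': "\<And>z. z \<in> S \<Longrightarrow> (f has_derivative f' z) (at z)" "\<And>w. ndiff_on k S (\<lambda>z. f' z w)"
    using assms(1) by (metis ndiff_on_SucE)
  have "f' z 1 = vector_derivative f (at z)" if "z \<in> S" for z
  proof -
    have "f' z s = s *\<^sub>R f' z 1" for s
      using linear_scale[OF has_derivative_linear[OF f'(1)[OF that]], of s 1] by simp
    then have "(f has_vector_derivative f' z 1) (at z)"
      unfolding has_vector_derivative_def
      by (intro has_derivative_eq_rhs[OF f'(1)[OF that]] ext)
    then show ?thesis by (simp add: vector_derivative_at)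
  qed
  then show ?thesis by (rule ndiff_on_cong[OF f'(2) assms(2)])
qed

text \<open>The converse passage: on the line one direction is all there is, and the n-linear map
  with value \<open>g n x\<close> at the ones multiplies it by \<open>prod_list\<close>. The
  estimate for the n-th derivative thus becomes one in operator norm.\<close>

lemma smooth_on_realI:
  fixes f :: "real \<Rightarrow> 'e::real_normed_vector"
  assumes S: "open S" and f: "\<And>k. ndiff_on k S f"
  shows "smooth_on S f"
proof -
  define g where "g n = ((\<lambda>h x. vector_derivative h (at x)) ^^ n) f" for n
  have nd: "ndiff_on k S (g n)" for n k
    by (induction n arbitrary: k) (auto simp: g_def f intro: ndiff_on_vector_derivative S)
  have g: "(g n has_vector_derivative g (Suc n) x) (at x)" if "x \<in> S" for n x
  proof -
    have "g n differentiable (at x)"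
      using nd[of 1 n] that by (auto simp: differentiable_def)
    then show ?thesis by (simp add: g_def vector_derivative_works)
  qed
  define D where "D n x vs = prod_list vs *\<^sub>R g n x" for n x and vs :: "real list"
  have upd: "prod_list (vs[i := v]) = v * prod_list (vs[i := 1])" if "i < length vs" for vs i and v :: real
    using that by (simp add: upd_conv_take_nth_drop)
  have np: "\<bar>prod_list vs\<bar> = prod_list (map norm vs)" for vs :: "real list"
    by (induction vs) (auto simp: abs_mult)
  show ?thesis unfolding smooth_on_def
  proof (intro conjI S exI[of _ D] ballI allI impI)
    show "D 0 x [] = f x" for x by (simp add: D_def g_def)
    show "bounded_multilinear n (D n x)" for n x
      unfolding bounded_multilinear_def
    proof (intro conjI allI impI)
      fix vs :: "real list" and i assume "length vs = n" "i < n"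
      then show "linear (\<lambda>v. D n x (vs[i := v]))"
        unfolding D_def by (subst upd) (auto intro!: linearI simp: algebra_simps)
    next
      show "\<exists>K. \<forall>vs. length vs = n \<longrightarrow> norm (D n x vs) \<le> K * prod_list (map norm vs)"
        using np by (intro exI[of _ "norm (g n x)"]) (auto simp: D_def mult.commute)
    qed
  next
    fix n x and e :: real assume x: "x \<in> S" and e: "e > 0"
    from g[OF x] e obtain d where d: "d > 0"
      "\<And>y. norm (y - x) < d \<Longrightarrow> norm (g n y - g n x - (y - x) *\<^sub>R g (Suc n) x) \<le> e * norm (y - x)"
      unfolding has_vector_derivative_def has_derivative_at_alt by blast
    show "\<exists>d>0. \<forall>y\<in>S. norm (y - x) < d \<longrightarrow> (\<forall>vs. length vs = n \<longrightarrow>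
        norm (D n y vs - D n x vs - D (Suc n) x ((y - x) # vs)) \<le> e * norm (y - x) * prod_list (map norm vs))"
    proof (intro exI[of _ d] conjI ballI allI impI d(1))
      fix y and vs :: "real list" assume "norm (y - x) < d"
      from mult_left_mono[OF d(2)[OF this] abs_ge_zero[of "prod_list vs"]]
      have "norm (prod_list vs *\<^sub>R (g n y - g n x - (y - x) *\<^sub>R g (Suc n) x))
          \<le> prod_list (map norm vs) * (e * norm (y - x))"
        unfolding norm_scaleR np .
      moreover have "D n y vs - D n x vs - D (Suc n) x ((y - x) # vs) =
          prod_list vs *\<^sub>R (g n y - g n x - (y - x) *\<^sub>R g (Suc n) x)"
        by (simp add: D_def scaleR_diff_right mult.commute)
      ultimately show "norm (D n y vs - D n x vs - D (Suc n) x ((y - x) # vs)) \<le> e * norm (y - x) * prod_list (map norm vs)"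
        by (simp only: mult_ac)
    qed
  qed
qed

text \<open>Each order k comes with its own witness for the derivative; by uniqueness all of them
  agree with \<open>frechet_derivative\<close> on S, which serves every order at once.\<close>

lemma ndiff_on_derivativeE:
  assumes S: "open S" and f: "\<And>k. ndiff_on k S f"
  obtains f' where "\<And>z. z \<in> S \<Longrightarrow> (f has_derivative f' z) (at z)" "\<And>k w. ndiff_on k S (\<lambda>z. f' z w)"
proof
  have d: "f differentiable (at z)" if "z \<in> S" for z
    using f[of 1] that by (auto simp: differentiable_def)
  show "(f has_derivative frechet_derivative f (at z)) (at z)" if "z \<in> S" for z
    using d[OF that] by (simp add: frechet_derivative_works)
  show "ndiff_on k S (\<lambda>z. frechet_derivative f (at z) w)" for k w
  proof -
    obtain f' where f': "\<And>z. z \<in> S \<Longrightarrow> (f has_derivative f' z) (at z)" "\<And>w. ndiff_on k S (\<lambda>z. f' z w)"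
      using f[of "Suc k"] by (metis ndiff_on_SucE)
    show ?thesis
      by (rule ndiff_on_cong[OF f'(2)[of w] S]) (simp add: frechet_derivative_at[OF f'(1)])
  qed
qed

lemma ndiff_on_plane_derivativeE:
  fixes f :: "real \<times> real \<Rightarrow> real"
  assumes "open S" "\<And>k. ndiff_on k S f"
  obtains f1 f2 where "\<And>z. z \<in> S \<Longrightarrow> (f has_derivative (\<lambda>w. fst w * f1 z + snd w * f2 z)) (at z)"
    "\<And>k. ndiff_on k S f1" "\<And>k. ndiff_on k S f2"
proof -
  obtain f' where f': "\<And>z. z \<in> S \<Longrightarrow> (f has_derivative f' z) (at z)" "\<And>k w. ndiff_on k S (\<lambda>z. f' z w)"
    using ndiff_on_derivativeE[OF assms] by blast
  have "f' z w = fst w * f' z (1, 0) + snd w * f' z (0, 1)" if "z \<in> S" for z w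
  proof -
    have "linear (f' z)" using f'(1)[OF that] by (rule has_derivative_linear)
    from linear_add[OF this, of "fst w *\<^sub>R (1, 0)" "snd w *\<^sub>R (0, 1)"]
      linear_scale[OF this, of "fst w" "(1, 0)"] linear_scale[OF this, of "snd w" "(0, 1)"]
    show ?thesis by simp
  qed
  then have "(f has_derivative (\<lambda>w. fst w * f' z (1, 0) + snd w * f' z (0, 1))) (at z)" if "z \<in> S" for z
    using that by (intro has_derivative_eq_rhs[OF f'(1)[OF that]] ext)
  then show ?thesis using f'(2) by (intro that[of "\<lambda>z. f' z (1, 0)" "\<lambda>z. f' z (0, 1)"])
qed

section \<open>Implicitly defined smooth curves in the plane\<close>

text \<open>Newton's iteration in the first variable with the slope frozen at a, on a box where
  \<open>g1\<close> stays within \<open>\<bar>a\<bar> / 2\<close> of a. Uniqueness on the whole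
  interval of radius r makes the zeros of g in the resulting box exactly the graph of h.\<close>

lemma implicit_curve:
  fixes g :: "real \<times> real \<Rightarrow> real"
  assumes S: "open S" and g: "\<And>k. ndiff_on k S g"
    and x0: "(x0, 0) \<in> S" "g (x0, 0) = 0" "(g has_derivative (\<lambda>w. fst w * a + snd w * b)) (at (x0, 0))" "a \<noteq> 0"
  obtains r \<rho> h where "r > 0" "\<rho> > 0" "\<And>k. ndiff_on k {-\<rho><..<\<rho>} h"
    "\<And>t. \<bar>t\<bar> < \<rho> \<Longrightarrow> \<bar>h t - x0\<bar> \<le> r \<and> (h t, t) \<in> S \<and> g (h t, t) = 0"
    "\<And>t x. \<bar>t\<bar> < \<rho> \<Longrightarrow> \<bar>x - x0\<bar> \<le> r \<Longrightarrow> g (x, t) = 0 \<Longrightarrow> x = h t"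
proof -
  obtain g1 g2 where g12: "\<And>z. z \<in> S \<Longrightarrow> (g has_derivative (\<lambda>w. fst w * g1 z + snd w * g2 z)) (at z)"
    "\<And>k. ndiff_on k S g1" "\<And>k. ndiff_on k S g2"
    using ndiff_on_plane_derivativeE[OF S g] by blast
  have a: "g1 (x0, 0) = a"
    using has_derivative_unique[OF x0(3) g12(1)[OF x0(1)]] by (auto dest: fun_cong[of _ _ "(1, 0)"])
  have c1: "continuous_on S g1" "continuous_on S g" using g12(2) g by (auto intro: ndiff_on_continuous)
  have "\<exists>d>0. \<forall>z. dist z (x0, 0) < d \<longrightarrow> z \<in> S \<and> dist (g1 z) a < \<bar>a\<bar> / 2"
  proof -
    have "\<forall>\<^sub>F z in nhds (x0, 0). dist (g1 z) a < \<bar>a\<bar> / 2"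
      using c1(1) S x0(1,4) a
      by (intro tendstoD) (auto simp: continuous_on_eq_continuous_at continuous_at tendsto_nhds_iff)
    moreover have "\<forall>\<^sub>F z in nhds (x0, 0). z \<in> S" using S x0(1) by (rule eventually_nhds_in_open)
    ultimately have "\<forall>\<^sub>F z in nhds (x0, 0). z \<in> S \<and> dist (g1 z) a < \<bar>a\<bar> / 2"
      by eventually_elim simp
    then show ?thesis by (simp add: eventually_nhds_metric)
  qed
  then obtain d where d: "d > 0" "\<And>z. dist z (x0, 0) < d \<Longrightarrow> z \<in> S \<and> dist (g1 z) a < \<bar>a\<bar> / 2" by blast
  define r where "r = d / 2"
  have r: "r > 0" using d by (simp add: r_def)
  have in_S: "(x, t) \<in> S" "\<bar>g1 (x, t) - a\<bar> < \<bar>a\<bar> / 2" if "\<bar>x - x0\<bar> \<le> r" "\<bar>t\<bar> < r" for x t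
  proof -
    have "dist (x, t) (x0, 0) \<le> \<bar>x - x0\<bar> + \<bar>t\<bar>"
      using norm_Pair_le[of "x - x0" t] by (simp add: dist_norm)
    then have "dist (x, t) (x0, 0) < d" using that by (simp add: r_def)
    from d(2)[OF this] show "(x, t) \<in> S" "\<bar>g1 (x, t) - a\<bar> < \<bar>a\<bar> / 2" by (auto simp: dist_real_def)
  qed
  have deriv_x: "((\<lambda>x. g (x, t)) has_derivative (\<lambda>s. s * g1 (x, t))) (at x within T)" if "(x, t) \<in> S" for x t T
  proof -
    have "((\<lambda>x. (x, t)) has_derivative (\<lambda>s. (s, 0))) (at x within T)"
      by (auto intro!: derivative_eq_intros)
    from has_derivative_compose[OF this g12(1)[OF that]] show ?thesis by simp
  qed
  have ni: "near_isomorphism (\<lambda>x. a * x) (\<lambda>y. y / a) (1 / \<bar>a\<bar>) (\<bar>a\<bar> / 2) r x0 (\<lambda>x. g (x, t))" if t: "\<bar>t\<bar> < r" for t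
  proof
    fix x x' assume xx: "x \<in> cball x0 r" "x' \<in> cball x0 r"
    have "norm ((g (x, t) - a * x) - (g (x', t) - a * x')) \<le> \<bar>a\<bar> / 2 * norm (x - x')"
    proof (rule differentiable_bound[of "cball x0 r" _ "\<lambda>x s. s * g1 (x, t) - a * s"])
      fix y assume "y \<in> cball x0 r"
      then have y: "\<bar>y - x0\<bar> \<le> r" by (simp add: dist_real_def abs_minus_commute)
      show "((\<lambda>x. g (x, t) - a * x) has_derivative (\<lambda>s. s * g1 (y, t) - a * s)) (at y within cball x0 r)"
        by (intro has_derivative_diff deriv_x in_S(1) y t bounded_linear_imp_has_derivative bounded_linear_mult_right)
      show "onorm (\<lambda>s. s * g1 (y, t) - a * s) \<le> \<bar>a\<bar> / 2"
      proof (rule onorm_le)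
        fix s
        have "norm (s * g1 (y, t) - a * s) = \<bar>g1 (y, t) - a\<bar> * norm s"
          by (simp add: abs_mult[symmetric] algebra_simps)
        also have "\<dots> \<le> \<bar>a\<bar> / 2 * norm s"
          using in_S(2)[OF y t] by (intro mult_right_mono) auto
        finally show "norm (s * g1 (y, t) - a * s) \<le> \<bar>a\<bar> / 2 * norm s" .
      qed
    qed (use xx in auto)
    then show "norm (g (x, t) - g (x', t) - a * (x - x')) \<le> \<bar>a\<bar> / 2 * norm (x - x')"
      by (simp add: algebra_simps)
  qed (use x0(4) in \<open>auto intro!: linearI simp: add_divide_distrib\<close>)
  \<comment> \<open>For t near 0 the start \<open>x0\<close> is nearly a zero because
    \<open>g (x0, 0) = 0\<close>; r / 2 is what \<open>zero_exists\<close> admits for the scaled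
    residual.\<close>
  have "\<exists>\<rho>>0. \<forall>t. dist t 0 < \<rho> \<longrightarrow> 1 / \<bar>a\<bar> * norm (g (x0, t)) < r / 2"
  proof -
    have "isCont (\<lambda>t. g (x0, t)) 0"
    proof (rule isCont_o2[of _ "\<lambda>t. (x0, t)"])
      show "isCont g (x0, 0)" using c1(2) S x0(1) by (simp add: continuous_on_eq_continuous_at)
    qed (intro continuous_intros)
    then have "isCont (\<lambda>t. 1 / \<bar>a\<bar> * norm (g (x0, t))) 0" by (intro continuous_intros)
    then have "\<forall>\<^sub>F t in nhds 0. dist (1 / \<bar>a\<bar> * norm (g (x0, t))) 0 < r / 2"
      using x0(2) r by (intro tendstoD) (auto simp: continuous_at tendsto_nhds_iff)
    then show ?thesis by (simp add: eventually_nhds_metric dist_real_def)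
  qed
  then obtain \<rho>0 where \<rho>0: "\<rho>0 > 0" "\<And>t. \<bar>t\<bar> < \<rho>0 \<Longrightarrow> 1 / \<bar>a\<bar> * norm (g (x0, t)) < r / 2" by (auto simp: dist_real_def)
  define \<rho> where "\<rho> = min \<rho>0 r"
  have "\<exists>x. \<bar>x - x0\<bar> \<le> r \<and> g (x, t) = 0" if "\<bar>t\<bar> < \<rho>" for t
  proof -
    from that have tr: "\<bar>t\<bar> < r" "\<bar>t\<bar> < \<rho>0" by (auto simp: \<rho>_def)
    interpret near_isomorphism "\<lambda>x. a * x" "\<lambda>y. y / a" "1 / \<bar>a\<bar>" "\<bar>a\<bar> / 2" r x0 "\<lambda>x. g (x, t)"
      by (rule ni[OF tr(1)])
    obtain x where "x \<in> cball x0 r" "g (x, t) = 0"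
      by (rule zero_exists[of UNIV]) (use r \<rho>0(2)[OF tr(2)] x0(4) in auto)
    then show ?thesis by (intro exI[of _ x]) (simp add: dist_real_def abs_minus_commute)
  qed
  then obtain h where h: "\<And>t. \<bar>t\<bar> < \<rho> \<Longrightarrow> \<bar>h t - x0\<bar> \<le> r \<and> g (h t, t) = 0" by metis
  have \<rho>: "\<rho> > 0" "\<rho> \<le> r" using \<rho>0 r by (auto simp: \<rho>_def)
  have stab: "\<bar>x - h t\<bar> \<le> 2 / \<bar>a\<bar> * \<bar>g (x, t)\<bar>" if "\<bar>t\<bar> < \<rho>" "\<bar>x - x0\<bar> \<le> r" for t x
  proof -
    from that \<rho> have tr: "\<bar>t\<bar> < r" by simp
    interpret near_isomorphism "\<lambda>x. a * x" "\<lambda>y. y / a" "1 / \<bar>a\<bar>" "\<bar>a\<bar> / 2" r x0 "\<lambda>x. g (x, t)"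
      by (rule ni[OF tr])
    show ?thesis using stability[of x "h t"] h[OF that(1)] that(2)
      by (simp add: dist_real_def abs_minus_commute)
  qed
  let ?T = "{-\<rho><..<\<rho>}"
  have hS: "(h t, t) \<in> S" "g1 (h t, t) \<noteq> 0" if "\<bar>t\<bar> < \<rho>" for t
    using in_S[of "h t" t] h[OF that] that \<rho> by auto
  have h': "(h has_derivative (\<lambda>s. s * - (g2 (h t, t) * inverse (g1 (h t, t))))) (at t)" if "t \<in> ?T" for t
  proof -
    from that have t: "\<bar>t\<bar> < \<rho>" by auto
    define G where "G p = g (snd p, fst p)" for p :: "real \<times> real"
    define B where "B y = y * inverse (g1 (h t, t))" for y
    have ev: "\<forall>\<^sub>F s in nhds t. s \<in> ?T" using that by (intro eventually_nhds_in_open) auto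
    have sw: "((\<lambda>p :: real \<times> real. (snd p, fst p)) has_derivative (\<lambda>w. (snd w, fst w))) (at (t, h t))"
      by (auto intro!: derivative_eq_intros)
    have G: "(G has_derivative (\<lambda>w. snd w * g1 (h t, t) + fst w * g2 (h t, t))) (at (t, h t))"
      unfolding G_def using has_derivative_compose[OF sw, of g "\<lambda>w. fst w * g1 (h t, t) + snd w * g2 (h t, t)"]
        g12(1)[OF hS(1)[OF t]] by simp
    have "(h has_derivative (\<lambda>w. - B (snd (w, 0 :: real) * g1 (h t, t) + fst (w, 0 :: real) * g2 (h t, t)))) (at t)"
    proof (rule implicit_has_derivative[where U=h and C="2 / \<bar>a\<bar>", OF G])
      show "\<forall>\<^sub>F z in nhds t. G (z, h z) = 0"
        using ev by eventually_elim (use h in \<open>auto simp: G_def\<close>)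
      show "bounded_linear B" unfolding B_def by (rule bounded_linear_mult_left)
      show "B (snd (0 :: real, x) * g1 (h t, t) + fst (0 :: real, x) * g2 (h t, t)) = x" for x
        using hS(2)[OF t] by (simp add: B_def)
      show "\<forall>\<^sub>F z in nhds t. norm (h z - h t) \<le> 2 / \<bar>a\<bar> * norm (G (z, h t))"
        using ev
      proof eventually_elim
        case (elim z)
        then show ?case using stab[of z "h t"] h[OF t] by (auto simp: G_def abs_minus_commute)
      qed
    qed
    then show ?thesis by (simp add: B_def mult_ac)
  qed
  have "ndiff_on k ?T h" for k
  \<comment> \<open>The formula for the derivative contains h only through \<open>(h t, t)\<close>,
    so k orders for h give k orders for its derivative, hence k + 1 for h.\<close>
  proof (induction k)
    case (Suc k)
    have "ndiff_on k ?T (\<lambda>t. (h t, t))"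
      by (intro ndiff_on_Pair Suc ndiff_on_bounded_linear bounded_linear_ident)
    moreover have "(\<lambda>t. (h t, t)) ` ?T \<subseteq> S" using hS by auto
    ultimately have "ndiff_on k ?T (\<lambda>t. g1 (h t, t))" "ndiff_on k ?T (\<lambda>t. g2 (h t, t))"
      using ndiff_on_compose_plane[OF g12(2)] ndiff_on_compose_plane[OF g12(3)] by blast+
    then have "ndiff_on k ?T (\<lambda>t. s * - (g2 (h t, t) * inverse (g1 (h t, t))))" for s
      by (intro ndiff_on_mult ndiff_on_const ndiff_on_minus ndiff_on_inverse) (use hS in auto)
    with h' show ?case by (rule ndiff_on_SucI)
  qed simp
  then show ?thesis
  proof (rule that[OF r \<rho>(1)])
    show "\<bar>h t - x0\<bar> \<le> r \<and> (h t, t) \<in> S \<and> g (h t, t) = 0" if "\<bar>t\<bar> < \<rho>" for t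
      using h hS that by blast
    show "x = h t" if "\<bar>t\<bar> < \<rho>" "\<bar>x - x0\<bar> \<le> r" "g (x, t) = 0" for t x
      using stab[OF that(1,2)] that(3) by simp
  qed
qed

section \<open>Partial derivatives of a smooth map\<close>

text \<open>Difference quotients lie in Y, and a closed set contains their limit. Applied to F it
  keeps jets at symmetric points in \<open>Ysym\<close>; applied to a curve in \<open>Xsym\<close>
  it makes the tangent symmetric.\<close>

lemma vector_derivative_in_closed_subspace:
  fixes g :: "real \<Rightarrow> 'e::real_normed_vector"
  assumes Y: "subspace Y" "closed Y" and g: "(g has_vector_derivative g') (at t)"
    and ev: "\<forall>\<^sub>F s in nhds t. g s \<in> Y"
  shows "g' \<in> Y"
proof -
  have "\<exists>y\<in>Y. dist y g' < e" if "e > 0" for e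
  proof -
    obtain d where d: "d > 0" "\<And>s. norm (s - t) < d \<Longrightarrow> norm (g s - g t - (s - t) *\<^sub>R g') \<le> e / 2 * norm (s - t)"
      using g \<open>e > 0\<close> unfolding has_vector_derivative_def has_derivative_at_alt
      by (meson half_gt_zero)
    obtain d' where d': "d' > 0" "\<And>s. dist s t < d' \<Longrightarrow> g s \<in> Y"
      using ev by (auto simp: eventually_nhds_metric)
    define k where "k = min d d' / 2"
    have k: "k > 0" "k < d" "k < d'" using d d' by (auto simp: k_def)
    have "(g (t + k) - g t) /\<^sub>R k \<in> Y"
      using d' k by (intro subspace_scale subspace_diff Y) (auto simp: dist_real_def)
    moreover have "norm ((g (t + k) - g t) /\<^sub>R k - g') \<le> e / 2"
    proof -
      have "(g (t + k) - g t) /\<^sub>R k - g' = (g (t + k) - g t - k *\<^sub>R g') /\<^sub>R k"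
        using k by (simp add: scaleR_diff_right)
      then have "norm ((g (t + k) - g t) /\<^sub>R k - g') = norm (g (t + k) - g t - k *\<^sub>R g') / k"
        using k by (simp add: divide_inverse mult.commute)
      also have "\<dots> \<le> e / 2" using d(2)[of "t + k"] k by (simp add: divide_le_eq)
      finally show ?thesis .
    qed
    ultimately show ?thesis using \<open>e > 0\<close> by (intro bexI) (auto simp: dist_norm)
  qed
  then show ?thesis using Y(2) by (meson closed_approachable)
qed

section \<open>First and second order jets as bounded linear maps\<close>

context smooth_jet
begin

lemma bounded_linear_jet1: "bounded_linear (\<lambda>v. D 1 z [v])"
  using bounded_linear_multilinear_head[OF ml, of "[]" 0] by simp

lemma bounded_linear_jet2_left: "bounded_linear (\<lambda>w. D 2 z [w, v])"
  using bounded_linear_multilinear_head[OF ml, of "[v]" 1] by (simp add: numeral_2_eq_2)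

lemma bounded_linear_jet2_right: "bounded_linear (\<lambda>v. D 2 z [w, v])"
  unfolding second_derivative_symmetric[of z w] by (rule bounded_linear_jet2_left)

lemma has_derivative_jet0:
  "(\<gamma> has_derivative \<gamma>') (at t) \<Longrightarrow> ((\<lambda>z. D 0 (\<gamma> z) []) has_derivative (\<lambda>w. D 1 (\<gamma> t) [\<gamma>' w])) (at t)"
  using chain_has_derivative[of \<gamma> \<gamma>' t "[]"] by simp

lemma has_derivative_jet1:
  assumes "(\<gamma> has_derivative \<gamma>') (at t)" "(v has_derivative v') (at t)"
  shows "((\<lambda>z. D 1 (\<gamma> z) [v z]) has_derivative (\<lambda>w. D 2 (\<gamma> t) [\<gamma>' w, v t] + D 1 (\<gamma> t) [v' w])) (at t)"
  using chain_has_derivative[OF assms(1), of "[v]" "\<lambda>_. v'"] assms(2) by (simp add: numeral_2_eq_2)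

text \<open>\<open>D_lam_u\<close> and \<open>D_uu\<close> differentiate the operator-valued map
  \<open>D_u F\<close>, so the remainder must be small uniformly over unit vectors v; the jet
  estimate is uniform in just this way. J will be the embedding of the state space as second
  coordinate.\<close>

lemma jet1_operator_has_derivative:
  assumes J: "bounded_linear J"
  shows "((\<lambda>z. Blinfun (\<lambda>v. D 1 z [J v])) has_derivative (\<lambda>w. Blinfun (\<lambda>v. D 2 z [w, J v]))) (at z)"
proof -
  have bl1: "bounded_linear (\<lambda>v. D 1 z [J v])" for z
    using bounded_linear_compose[OF bounded_linear_jet1 J] .
  have bl2: "bounded_linear (\<lambda>v. D 2 z [w, J v])" for w
    using bounded_linear_compose[OF bounded_linear_jet2_right J] .
  note ap = bounded_linear_Blinfun_apply[OF bl1] bounded_linear_Blinfun_apply[OF bl2]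
  obtain j where j: "j \<ge> 0" "\<And>v. norm (J v) \<le> norm v * j"
    using bounded_linear.nonneg_bounded[OF J] by blast
  obtain K where K: "K \<ge> 0" "\<And>vs. length vs = 2 \<Longrightarrow> norm (D 2 z vs) \<le> K * prod_list (map norm vs)"
    using bounded_multilinear_bound[OF ml] by metis
  interpret l: bounded_linear "\<lambda>w. D 2 z [w, v]" for v by (rule bounded_linear_jet2_left)
  have "bounded_linear (\<lambda>w. Blinfun (\<lambda>v. D 2 z [w, J v]))"
  proof (rule bounded_linear_intro)
    show "Blinfun (\<lambda>v. D 2 z [x + y, J v]) = Blinfun (\<lambda>v. D 2 z [x, J v]) + Blinfun (\<lambda>v. D 2 z [y, J v])" for x y
      by (rule blinfun_eqI) (simp only: ap blinfun.add_left, rule l.add)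
    show "Blinfun (\<lambda>v. D 2 z [r *\<^sub>R x, J v]) = r *\<^sub>R Blinfun (\<lambda>v. D 2 z [x, J v])" for r x
      by (rule blinfun_eqI) (simp only: ap blinfun.scaleR_left, rule l.scaleR)
    show "norm (Blinfun (\<lambda>v. D 2 z [x, J v])) \<le> norm x * (K * j)" for x
    proof (rule norm_blinfun_bound)
      show "norm (blinfun_apply (Blinfun (\<lambda>v. D 2 z [x, J v])) v) \<le> norm x * (K * j) * norm v" for v
      proof -
        have "norm (D 2 z [x, J v]) \<le> K * (norm x * norm (J v))" using K(2)[of "[x, J v]"] by simp
        also have "\<dots> \<le> K * (norm x * (norm v * j))"
          using K j by (intro mult_left_mono) auto
        finally show ?thesis by (simp add: ap mult_ac)
      qed
    qed (use K j in simp)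
  qed
  moreover have "\<exists>d>0. \<forall>y. norm (y - z) < d \<longrightarrow>
      norm (Blinfun (\<lambda>v. D 1 y [J v]) - Blinfun (\<lambda>v. D 1 z [J v]) - Blinfun (\<lambda>v. D 2 z [y - z, J v])) \<le> e * norm (y - z)"
    if "e > 0" for e
  proof -
    define e' where "e' = e / (j + 1)"
    have e': "e' > 0" "e' * j \<le> e"
    proof -
      show "e' > 0" using \<open>e > 0\<close> j by (simp add: e'_def)
      then have "e' * j \<le> e' * (j + 1)" by (simp add: mult_left_mono)
      also have "\<dots> = e" using j(1) by (simp add: e'_def)
      finally show "e' * j \<le> e" .
    qed
    obtain d where d: "d > 0" "\<And>y vs. norm (y - z) < d \<Longrightarrow> length vs = 1 \<Longrightarrow>
        norm (D 1 y vs - D 1 z vs - D (Suc 1) z ((y - z) # vs)) \<le> e' * norm (y - z) * prod_list (map norm vs)"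
      using jet[OF e'(1), of z 1] by blast
    show ?thesis
    proof (intro exI[of _ d] conjI allI impI d(1))
      fix y assume y: "norm (y - z) < d"
      show "norm (Blinfun (\<lambda>v. D 1 y [J v]) - Blinfun (\<lambda>v. D 1 z [J v]) - Blinfun (\<lambda>v. D 2 z [y - z, J v])) \<le> e * norm (y - z)"
      proof (rule norm_blinfun_bound)
        fix v
        have "norm (D 1 y [J v] - D 1 z [J v] - D 2 z [y - z, J v]) \<le> e' * norm (y - z) * norm (J v)"
          using d(2)[OF y, of "[J v]"] by (simp add: numeral_2_eq_2)
        also have "\<dots> \<le> e' * norm (y - z) * (norm v * j)"
          using e' j by (intro mult_left_mono) auto
        also have "\<dots> \<le> e * norm (y - z) * norm v"
          using mult_right_mono[OF e'(2), of "norm (y - z) * norm v"] by (simp add: mult_ac)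
        finally show "norm (blinfun_apply (Blinfun (\<lambda>v. D 1 y [J v]) - Blinfun (\<lambda>v. D 1 z [J v]) - Blinfun (\<lambda>v. D 2 z [y - z, J v])) v)
            \<le> e * norm (y - z) * norm v"
          by (simp only: ap blinfun.diff_left)
      qed (use \<open>e > 0\<close> in simp)
    qed
  qed
  ultimately show ?thesis unfolding has_derivative_at_alt by blast
qed

end

section \<open>Partial derivatives as values of the jet\<close>

lemma bounded_linear_Pair_0: "bounded_linear (\<lambda>v. (0, v))" "bounded_linear (\<lambda>v. (v, 0))"
  by (intro bounded_linear_Pair bounded_linear_zero bounded_linear_ident)+

locale smooth_jet_of = smooth_jet D
  for D :: "nat \<Rightarrow> real \<times> 'a::real_normed_vector \<Rightarrow> (real \<times> 'a) list \<Rightarrow> 'b::real_normed_vector" +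
  fixes F :: "real \<times> 'a \<Rightarrow> 'b"
  assumes jet_0: "D 0 z [] = F z"
begin

lemma has_derivative_F:
  "(\<gamma> has_derivative \<gamma>') (at t) \<Longrightarrow> ((\<lambda>z. F (\<gamma> z)) has_derivative (\<lambda>w. D 1 (\<gamma> t) [\<gamma>' w])) (at t)"
  using has_derivative_jet0 by (simp add: jet_0)

lemma slice_u: "((\<lambda>v. (l, v)) has_derivative (\<lambda>w. (0, w))) (at u)"
  by (auto intro!: derivative_eq_intros)

lemma slice_lam: "((\<lambda>k. (k, u)) has_derivative (\<lambda>s. (s, 0))) (at l)"
  by (auto intro!: derivative_eq_intros)

lemma D_u_eq: "D_u F l u = Blinfun (\<lambda>v. D 1 (l, u) [(0, v)])"
  using frechet_derivative_at[OF has_derivative_F[OF slice_u]] by (simp add: D_u_def)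

lemma D_u_apply: "D_u F l u v = D 1 (l, u) [(0, v)]"
  unfolding D_u_eq
  by (rule bounded_linear_Blinfun_apply[OF bounded_linear_compose[OF bounded_linear_jet1 bounded_linear_Pair_0(1)], THEN fun_cong])

lemma D_lam_eq: "D_lam F l u = D 1 (l, u) [(1, 0)]"
proof -
  have "((\<lambda>k. F (k, u)) has_derivative (\<lambda>s. D 1 (l, u) [(s, 0)])) (at l)"
    using has_derivative_F[OF slice_lam] .
  moreover have "D 1 (l, u) [(s, 0)] = s *\<^sub>R D 1 (l, u) [(1, 0)]" for s
    using linear_scale[OF bounded_linear.linear[OF bounded_linear_jet1], of "(l, u)" s "(1, 0)"] by simp
  ultimately have "((\<lambda>k. F (k, u)) has_vector_derivative D 1 (l, u) [(1, 0)]) (at l)"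
    unfolding has_vector_derivative_def by (metis (no_types, lifting) ext has_derivative_eq_rhs)
  then show ?thesis unfolding D_lam_def by (rule vector_derivative_at)
qed

lemma operator_apply: "blinfun_apply (Blinfun (\<lambda>v. D 2 z [w, (0, v)])) v = D 2 z [w, (0, v)]"
  by (rule bounded_linear_Blinfun_apply[OF bounded_linear_compose[OF bounded_linear_jet2_right bounded_linear_Pair_0(1)], THEN fun_cong])

lemma D_lam_u_apply: "D_lam_u F l u v = D 2 (l, u) [(1, 0), (0, v)]"
proof -
  let ?E = "\<lambda>w. Blinfun (\<lambda>v. D 2 (l, u) [w, (0, v)])"
  have "((\<lambda>k. D_u F k u) has_derivative (\<lambda>s. ?E (s, 0))) (at l)"
    unfolding D_u_eq
    by (rule has_derivative_compose[OF slice_lam jet1_operator_has_derivative[OF bounded_linear_Pair_0(1)]])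
  moreover have "?E (s, 0) = s *\<^sub>R ?E (1, 0)" for s
  proof (rule blinfun_eqI)
    fix v
    interpret bounded_linear "\<lambda>w. D 2 (l, u) [w, (0, v)]" by (rule bounded_linear_jet2_left)
    show "blinfun_apply (?E (s, 0)) v = blinfun_apply (s *\<^sub>R ?E (1, 0)) v"
      using scaleR[of s "(1, 0)"] by (simp add: operator_apply blinfun.scaleR_left)
  qed
  ultimately have "((\<lambda>k. D_u F k u) has_vector_derivative ?E (1, 0)) (at l)"
    unfolding has_vector_derivative_def by (metis (no_types, lifting) ext has_derivative_eq_rhs)
  then have "D_lam_u F l u = ?E (1, 0)" unfolding D_lam_u_def by (rule vector_derivative_at)
  then show ?thesis by (simp add: operator_apply)
qed

lemma D_uu_apply: "D_uu F l u w v = D 2 (l, u) [(0, w), (0, v)]"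
proof -
  let ?E = "\<lambda>w. Blinfun (\<lambda>v. D 2 (l, u) [(0, w), (0, v)])"
  have d: "((\<lambda>v. D_u F l v) has_derivative ?E) (at u)"
    unfolding D_u_eq
    by (rule has_derivative_compose[OF slice_u jet1_operator_has_derivative[OF bounded_linear_Pair_0(1)]])
  have "D_uu F l u = Blinfun ?E"
    unfolding D_uu_def frechet_derivative_at[OF d, symmetric] ..
  then show ?thesis
    using bounded_linear_Blinfun_apply[OF has_derivative_bounded_linear[OF d]] by (simp add: operator_apply)
qed

end

section \<open>Lyapunov--Schmidt reduction\<close>

declare One_nat_def [simp del] \<comment> \<open>keeps \<open>D 1\<close> from turning into \<open>D (Suc 0)\<close>\<close>

text \<open>The hypotheses in terms of the jet and free of dimensions; \<open>onto_sym\<close> is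
  the form in which index zero on the symmetry spaces is used.\<close>

locale symmetric_setting = smooth_jet_of D F
  for D :: "nat \<Rightarrow> real \<times> 'a::banach \<Rightarrow> (real \<times> 'a) list \<Rightarrow> 'b::banach" and F +
  fixes l0 :: real and u0 phi0 :: 'a and psi0 :: "'b \<Rightarrow>\<^sub>L real" and Xsym :: "'a set" and Ysym :: "'b set"
  assumes F0: "F (l0, u0) = 0"
    and kernel: "D 1 (l0, u0) [(0, phi0)] = 0" "\<And>v. D 1 (l0, u0) [(0, v)] = 0 \<Longrightarrow> \<exists>c. v = c *\<^sub>R phi0"
    and range: "\<And>y. psi0 y = 0 \<longleftrightarrow> (\<exists>v. y = D 1 (l0, u0) [(0, v)])" and psi0: "psi0 \<noteq> 0"
    and Xsym: "subspace Xsym" "closed Xsym" and Ysym: "subspace Ysym" "closed Ysym"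
    and F_sym: "\<And>l v. v \<in> Xsym \<Longrightarrow> F (l, v) \<in> Ysym"
    and onto_sym: "\<And>y. y \<in> Ysym \<Longrightarrow> \<exists>v\<in>Xsym. y = D 1 (l0, u0) [(0, v)]"
    and u0: "u0 \<in> Xsym" and phi0: "phi0 \<notin> Xsym"
begin

abbreviation L :: "'a \<Rightarrow> 'b" where "L v \<equiv> D 1 (l0, u0) [(0, v)]"

lemma bounded_linear_L: "bounded_linear L"
  using bounded_linear_compose[OF bounded_linear_jet1 bounded_linear_Pair_0(1)] .

sublocale L: bounded_linear L by (rule bounded_linear_L)

lemma psi0_L: "psi0 (L v) = 0" using range by blast

lemma psi0_Ysym: "y \<in> Ysym \<Longrightarrow> psi0 y = 0" using onto_sym range by blast

text \<open>Each direction in the list stands for one differentiation along a line that keeps the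
  state in \<open>Xsym\<close>, and the closed subspace \<open>Ysym\<close> is never left. The
  newest direction is the head, which fits the induction on the list.\<close>

lemma jet_in_Ysym:
  assumes "v \<in> Xsym" "\<And>w. w \<in> set ws \<Longrightarrow> snd w \<in> Xsym"
  shows "D (length ws) (l, v) ws \<in> Ysym"
  using assms
proof (induction ws arbitrary: l v)
  case Nil
  then show ?case by (simp add: jet_0 F_sym)
next
  case (Cons w ws)
  let ?g = "\<lambda>s. D (length ws) ((l, v) + s *\<^sub>R w) ws"
  have "((\<lambda>s. (l, v) + s *\<^sub>R w) has_derivative (\<lambda>s. s *\<^sub>R w)) (at 0)"
    by (auto intro!: derivative_eq_intros)
  from has_derivative_compose[OF this, of "\<lambda>z. D (length ws) z ws"]
    has_derivative_const_args[of ws "(l, v)"]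
  have "(?g has_derivative (\<lambda>s. D (Suc (length ws)) (l, v) (s *\<^sub>R w # ws))) (at 0)" by simp
  then have "(?g has_vector_derivative D (length (w # ws)) (l, v) (w # ws)) (at 0)"
    unfolding has_vector_derivative_def
    by (rule has_derivative_eq_rhs) (simp add: linear_scale[OF linear_multilinear_head[OF ml refl]])
  moreover have "?g s \<in> Ysym" for s
  proof -
    have "v + s *\<^sub>R snd w \<in> Xsym"
      using Cons.prems by (intro subspace_add subspace_scale Xsym) auto
    from Cons.IH[OF this, of "l + s * fst w"] Cons.prems(2) show ?thesis
      by (simp add: plus_prod_def)
  qed
  ultimately show ?case
    by (intro vector_derivative_in_closed_subspace[OF Ysym]) auto
qed

lemma jet1_in_Ysym: "v \<in> Xsym \<Longrightarrow> D 1 (l0, u0) [(a, v)] \<in> Ysym"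
  using jet_in_Ysym[OF u0, of "[(a, v)]" l0] by (simp add: One_nat_def)

lemma jet2_in_Ysym:
  assumes "v \<in> Xsym" "v' \<in> Xsym"
  shows "D 2 (l0, u0) [(a, v), (b, v')] \<in> Ysym"
proof -
  have "D (length [(a, v), (b, v')]) (l0, u0) [(a, v), (b, v')] \<in> Ysym"
    by (rule jet_in_Ysym[OF u0]) (use assms in auto)
  then show ?thesis by (simp add: numeral_2_eq_2)
qed

text \<open>Existence holds since the parameter derivative of F at a symmetric point lies in
  \<open>Ysym\<close>. Two solutions differ by a multiple of \<open>phi0\<close>; a nonzero multiple
  in \<open>Xsym\<close> would put \<open>phi0\<close> itself there.\<close>

lemma symmetric_solution_unique: "\<exists>!xi. xi \<in> Xsym \<and> L xi + D 1 (l0, u0) [(1, 0)] = 0"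
proof -
  have "D 1 (l0, u0) [(1, 0)] \<in> Ysym"
    by (intro jet1_in_Ysym subspace_0 Xsym)
  then have "- D 1 (l0, u0) [(1, 0)] \<in> Ysym" by (rule subspace_neg[OF Ysym(1)])
  then obtain xi where xi: "xi \<in> Xsym" "- D 1 (l0, u0) [(1, 0)] = L xi" using onto_sym by blast
  show ?thesis
  proof (intro ex1I[of _ xi] conjI)
    show "L xi + D 1 (l0, u0) [(1, 0)] = 0" by (simp flip: xi(2))
    fix x assume x: "x \<in> Xsym \<and> L x + D 1 (l0, u0) [(1, 0)] = 0"
    then have "L x = - D 1 (l0, u0) [(1, 0)]" by (simp add: eq_neg_iff_add_eq_0)
    then have "L (x - xi) = 0" using xi(2) by (simp add: L.diff)
    then obtain c where c: "x - xi = c *\<^sub>R phi0" using kernel(2) by blast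
    have "x - xi \<in> Xsym" using x xi by (intro subspace_diff Xsym) auto
    then have "c = 0"
      using c phi0 subspace_scale[OF Xsym(1), of "c *\<^sub>R phi0" "inverse c"] by (cases "c = 0") auto
    then show "x = xi" using c by simp
  qed (rule xi)
qed

end

text \<open>The two terms of the nondegeneracy condition combine into one value of the second
  derivative, at \<open>(1, xi)\<close>, which turns out to be the tangent of the primary branch,
  and \<open>(0, phi0)\<close>.\<close>

locale nondegenerate_setting = symmetric_setting +
  fixes xi
  assumes xi: "xi \<in> Xsym" "D 1 (l0, u0) [(0, xi)] + D 1 (l0, u0) [(1, 0)] = 0"
    and nondegenerate: "psi0 (D 2 (l0, u0) [(1, xi), (0, phi0)]) \<noteq> 0"
begin

text \<open>A bordering functional has to be 1 at \<open>phi0\<close> and 0 on \<open>Xsym\<close>.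
  Hahn-Banach would provide one abstractly; here the second derivative of F supplies it
  explicitly.\<close>

definition \<alpha> :: "'a \<Rightarrow> real" where
  "\<alpha> v = psi0 (D 2 (l0, u0) [(1, xi), (0, v)]) / psi0 (D 2 (l0, u0) [(1, xi), (0, phi0)])"

lemma bounded_linear_\<alpha>: "bounded_linear \<alpha>"
  unfolding \<alpha>_def[abs_def]
  using bounded_linear_compose[OF bounded_linear_divide bounded_linear_compose[OF blinfun.bounded_linear_right
    bounded_linear_compose[OF bounded_linear_jet2_right bounded_linear_Pair_0(1)]]] .

sublocale \<alpha>: bounded_linear \<alpha> by (rule bounded_linear_\<alpha>)

lemma \<alpha>_phi0: "\<alpha> phi0 = 1" using nondegenerate by (simp add: \<alpha>_def)

lemma \<alpha>_Xsym: "v \<in> Xsym \<Longrightarrow> \<alpha> v = 0"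
  using psi0_Ysym[OF jet2_in_Ysym[OF xi(1)]] by (simp add: \<alpha>_def)

text \<open>The parameter derivative of F equals \<open>- L xi\<close>, so it adds nothing to the
  range of L; hence \<open>psi0\<close> annihilates the total first derivative.\<close>

lemma jet1_eq_L: "D 1 (l0, u0) [w] = L (snd w - fst w *\<^sub>R xi)"
proof -
  interpret J: bounded_linear "\<lambda>w. D 1 (l0, u0) [w]" by (rule bounded_linear_jet1)
  have "D 1 (l0, u0) [w] = fst w *\<^sub>R D 1 (l0, u0) [(1, 0)] + L (snd w)"
    using J.add[of "fst w *\<^sub>R (1, 0)" "(0, snd w)"] J.scaleR[of "fst w" "(1, 0)"] by simp
  also have "D 1 (l0, u0) [(1, 0)] = - L xi" using xi(2) by (simp add: eq_neg_iff_add_eq_0 add.commute)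
  finally show ?thesis by (simp add: L.diff L.scaleR)
qed

lemma psi0_jet1: "psi0 (D 1 (l0, u0) [w]) = 0"
  by (subst jet1_eq_L) (rule psi0_L)

text \<open>With \<open>u' 0 = \<eta> xi + c phi0\<close> and \<open>\<eta> = h' 0\<close>, the second derivative of \<open>psi0 (F (h a, u a)) = 0\<close>
  at \<open>a = 0\<close> is \<open>2 \<eta> c psi0 (D\<^sup>2F[(1, xi), (0, phi0)]) + c\<^sup>2 psi0 (D\<^sup>2F[(0, phi0), (0, phi0)]) = 0\<close>.\<close>

lemma branch_direction:
  assumes d: "d > 0" and h: "smooth_on {-d<..<d} h" and u: "smooth_on {-d<..<d} u"
    and init: "h 0 = l0" "u 0 = u0" and sol: "\<And>a. a \<in> {-d<..<d} \<Longrightarrow> F (h a, u a) = 0"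
    and dir: "vector_derivative u (at 0) \<notin> Xsym"
  shows "deriv h 0 = 0 \<longleftrightarrow> psi0 (D 2 (l0, u0) [(0, phi0), (0, phi0)]) = 0"
proof -
  let ?I = "{-d<..<d}"
  obtain hs where hs: "\<And>x. x \<in> ?I \<Longrightarrow> hs 0 x = h x"
    "\<And>n x. x \<in> ?I \<Longrightarrow> (hs n has_vector_derivative hs (Suc n) x) (at x)"
    using smooth_on_real_derivatives[OF h] by blast
  obtain us where us: "\<And>x. x \<in> ?I \<Longrightarrow> us 0 x = u x"
    "\<And>n x. x \<in> ?I \<Longrightarrow> (us n has_vector_derivative us (Suc n) x) (at x)"
    using smooth_on_real_derivatives[OF u] by blast
  have h1: "(h has_vector_derivative hs 1 a) (at a)" and u1: "(u has_vector_derivative us 1 a) (at a)"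
    if "a \<in> ?I" for a
    using has_vector_derivative_transform_within_open[OF hs(2)[of a 0], of ?I h]
      has_vector_derivative_transform_within_open[OF us(2)[of a 0], of ?I u] hs(1) us(1) that
    by (auto simp: One_nat_def)
  have D1: "((\<lambda>a. (h a, u a)) has_derivative (\<lambda>s. (s * hs 1 a, s *\<^sub>R us 1 a))) (at a)" if "a \<in> ?I" for a
    using h1[OF that] u1[OF that] by (auto simp: has_vector_derivative_def intro!: has_derivative_Pair)
  have sol1: "D 1 (h a, u a) [(hs 1 a, us 1 a)] = 0" if a: "a \<in> ?I" for a
  proof -
    have "((\<lambda>a. F (h a, u a)) has_derivative (\<lambda>s. D 1 (h a, u a) [(s * hs 1 a, s *\<^sub>R us 1 a)])) (at a)"
      by (rule has_derivative_F[OF D1[OF a]])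
    moreover have "((\<lambda>a. F (h a, u a)) has_derivative (\<lambda>s. 0)) (at a)"
      by (rule has_derivative_transform_within_open[OF has_derivative_const[of 0], of ?I]) (use a sol in auto)
    ultimately have "(\<lambda>s. D 1 (h a, u a) [(s * hs 1 a, s *\<^sub>R us 1 a)]) = (\<lambda>s. 0)"
      by (rule has_derivative_unique)
    from fun_cong[OF this, of 1] show ?thesis by simp
  qed
  have I0: "0 \<in> ?I" using d by simp
  define \<eta> where "\<eta> = hs 1 0"
  define v where "v = us 1 0"
  have deriv_h: "deriv h 0 = \<eta>"
    using h1[OF I0] by (simp add: \<eta>_def has_real_derivative_iff_has_vector_derivative[symmetric] DERIV_imp_deriv)
  have v_notin: "v \<notin> Xsym" using dir u1[OF I0] by (simp add: v_def vector_derivative_at)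
  have "L (v - \<eta> *\<^sub>R xi) = 0"
    using sol1[OF I0] jet1_eq_L[of "(\<eta>, v)"] by (simp add: init \<eta>_def v_def)
  then obtain c where c: "v - \<eta> *\<^sub>R xi = c *\<^sub>R phi0" using kernel(2) by blast
  have v: "v = \<eta> *\<^sub>R xi + c *\<^sub>R phi0" by (simp flip: c)
  \<comment> \<open>With c = 0 the tangent v would be a multiple of \<open>xi\<close> and so
    symmetric.\<close>
  have "c \<noteq> 0" using v v_notin xi(1) Xsym(1) by (auto simp: subspace_scale)
  have "((\<lambda>a. (hs 1 a, us 1 a)) has_derivative (\<lambda>s. (s * hs 2 0, s *\<^sub>R us 2 0))) (at 0)"
    using hs(2)[OF I0, of 1] us(2)[OF I0, of 1]
    by (auto simp: has_vector_derivative_def numeral_2_eq_2 intro!: has_derivative_Pair)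
  from has_derivative_jet1[OF D1[OF I0] this]
  have "((\<lambda>a. D 1 (h a, u a) [(hs 1 a, us 1 a)]) has_derivative
     (\<lambda>s. D 2 (l0, u0) [(s * \<eta>, s *\<^sub>R v), (\<eta>, v)] + D 1 (l0, u0) [(s * hs 2 0, s *\<^sub>R us 2 0)])) (at 0)"
    by (simp add: init \<eta>_def v_def)
  moreover have "((\<lambda>a. D 1 (h a, u a) [(hs 1 a, us 1 a)]) has_derivative (\<lambda>s. 0)) (at 0)"
    by (rule has_derivative_transform_within_open[OF has_derivative_const[of 0], of ?I]) (use I0 sol1 in auto)
  ultimately have "(\<lambda>s. D 2 (l0, u0) [(s * \<eta>, s *\<^sub>R v), (\<eta>, v)] + D 1 (l0, u0) [(s * hs 2 0, s *\<^sub>R us 2 0)]) = (\<lambda>s. 0)"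
    by (rule has_derivative_unique)
  from fun_cong[OF this, of 1]
  have "D 2 (l0, u0) [(\<eta>, v), (\<eta>, v)] + D 1 (l0, u0) [(hs 2 0, us 2 0)] = 0" by simp
  \<comment> \<open>\<open>psi0\<close> removes the second derivatives of h and u, which enter only
    through the first derivative of F.\<close>
  from arg_cong[OF this, of "blinfun_apply psi0"]
  have second: "psi0 (D 2 (l0, u0) [(\<eta>, v), (\<eta>, v)]) = 0"
    by (simp only: blinfun.add_right psi0_jet1 blinfun.zero_right add_0_right)
  define Q where "Q a b = psi0 (D 2 (l0, u0) [a, b])" for a b
  interpret Ql: bounded_linear "\<lambda>a. Q a b" for b
    unfolding Q_def using bounded_linear_compose[OF blinfun.bounded_linear_right bounded_linear_jet2_left] .
  interpret Qr: bounded_linear "\<lambda>b. Q a b" for a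
    unfolding Q_def using bounded_linear_compose[OF blinfun.bounded_linear_right bounded_linear_jet2_right] .
  have Qsym: "Q a b = Q b a" for a b by (simp add: Q_def second_derivative_symmetric[of _ a])
  \<comment> \<open>This kills the term quadratic in \<eta>, so a factor c can be cancelled and a
    linear relation between \<eta> and c remains.\<close>
  have Qxi: "Q (1, xi) (1, xi) = 0"
    using psi0_Ysym[OF jet2_in_Ysym[OF xi(1) xi(1)]] by (simp add: Q_def)
  have "(\<eta>, v) = \<eta> *\<^sub>R (1, xi) + c *\<^sub>R (0, phi0)" by (simp add: v)
  then have "Q (\<eta>, v) (\<eta>, v) = 2 * \<eta> * c * Q (1, xi) (0, phi0) + c * c * Q (0, phi0) (0, phi0)"
    using Qsym[of "(0, phi0)" "(1, xi)"]
    by (simp only: Ql.add Qr.add Ql.scaleR Qr.scaleR Qxi) (simp add: algebra_simps)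
  then have "c * (2 * \<eta> * Q (1, xi) (0, phi0) + c * Q (0, phi0) (0, phi0)) = 0"
    using second by (simp add: Q_def algebra_simps)
  then have "2 * \<eta> * Q (1, xi) (0, phi0) + c * Q (0, phi0) (0, phi0) = 0" using \<open>c \<noteq> 0\<close> by simp
  moreover have "Q (1, xi) (0, phi0) \<noteq> 0" using nondegenerate by (simp add: Q_def)
  ultimately show ?thesis using \<open>c \<noteq> 0\<close> unfolding deriv_h Q_def[symmetric] by auto
qed

text \<open>The border repairs both defects of L: \<open>y1\<close> supplies the missing direction
  of the range, and \<alpha> detects the kernel. A symmetric right-hand side has a symmetric
  preimage under L, on which \<alpha> vanishes, so it is the bordered preimage too.\<close>

lemma bordered_inverse:
  assumes y1: "psi0 y1 = 1"
  obtains B M where "bounded_linear B" "M > 0" "\<And>y. norm (B y) \<le> M * norm y"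
    "\<And>v. B (L v + \<alpha> v *\<^sub>R y1) = v" "\<And>y. L (B y) + \<alpha> (B y) *\<^sub>R y1 = y"
    "\<And>y. y \<in> Ysym \<Longrightarrow> B y \<in> Xsym"
proof -
  define A where "A v = L v + \<alpha> v *\<^sub>R y1" for v
  have blA: "bounded_linear A" unfolding A_def
    by (intro bounded_linear_add bounded_linear_L
        bounded_linear_compose[OF bounded_linear_scaleR_left bounded_linear_\<alpha>])
  interpret A: bounded_linear A by (rule blA)
  have "v = 0" if "A v = 0" for v
  proof -
    have "psi0 (A v) = 0" using that by (simp add: blinfun.zero_right)
    then have "\<alpha> v = 0" by (simp add: A_def blinfun.bilinear_simps psi0_L y1)
    moreover from this that obtain c where "v = c *\<^sub>R phi0" using kernel(2) by (auto simp: A_def)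
    ultimately show ?thesis by (simp add: \<alpha>.scaleR \<alpha>_phi0)
  qed
  then have "inj A" using A.linear_axioms by (simp add: linear_injective_0)
  moreover have "surj A"
  proof (rule surjI[where f="\<lambda>y. SOME v. A v = y"])
    fix y
    have "psi0 (y - psi0 y *\<^sub>R y1) = 0" by (simp add: blinfun.bilinear_simps y1)
    then obtain v where v: "y - psi0 y *\<^sub>R y1 = L v" using range by blast
    \<comment> \<open>Adding a multiple of \<open>phi0\<close> adjusts the value of \<alpha> to
      \<open>psi0 y\<close> without changing L v.\<close>
    have "A (v + (psi0 y - \<alpha> v) *\<^sub>R phi0) = y"
      using kernel(1) by (simp add: A_def L.add L.scaleR \<alpha>.add \<alpha>.scaleR \<alpha>_phi0 flip: v)
    then show "A (SOME v. A v = y) = y" by (rule someI)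
  qed
  ultimately have "bij A" by (simp add: bij_def)
  have BL: "bounded_linear (inv A)" by (rule bounded_linear_inv[OF blA \<open>bij A\<close>])
  obtain M where M: "M > 0" "\<And>y. norm (inv A y) \<le> norm y * M"
    using bounded_linear.pos_bounded[OF BL] by blast
  show ?thesis
  proof (rule that[OF BL M(1)])
    show "norm (inv A y) \<le> M * norm y" for y using M(2)[of y] by (simp add: mult.commute)
    show BA: "inv A (L v + \<alpha> v *\<^sub>R y1) = v" for v
      using inv_f_f[OF \<open>inj A\<close>] by (simp add: A_def)
    show "L (inv A y) + \<alpha> (inv A y) *\<^sub>R y1 = y" for y
      using surj_f_inv_f[OF \<open>surj A\<close>, of y] by (simp add: A_def)
    show "inv A y \<in> Xsym" if y: "y \<in> Ysym" for y
    proof -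
      obtain v where "v \<in> Xsym" "y = L v" using onto_sym[OF y] by blast
      then show ?thesis using BA[of v] \<alpha>_Xsym[of v] by simp
    qed
  qed
qed

text \<open>The bordered equation \<open>F (l, u) = (t - \<alpha> (u - u0)) y1\<close> has a regular linearization. The
  point \<open>(l, u)\<close> solves \<open>F (l, u) = 0\<close> iff \<open>u = U (l, t)\<close> for \<open>t = \<alpha> (u - u0)\<close>.\<close>

lemma lyapunov_schmidt:
  assumes y1: "psi0 y1 = 1"
  obtains r \<rho> U where "r > 0" "\<rho> > 0"
    "\<And>k. ndiff_on k ({l0 - \<rho><..<l0 + \<rho>} \<times> {-\<rho><..<\<rho>}) U"
    "\<And>l t. \<bar>l - l0\<bar> < \<rho> \<Longrightarrow> \<bar>t\<bar> < \<rho> \<Longrightarrow> F (l, U (l, t)) = (t - \<alpha> (U (l, t) - u0)) *\<^sub>R y1"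
    "\<And>l t x. \<bar>l - l0\<bar> < \<rho> \<Longrightarrow> \<bar>t\<bar> < \<rho> \<Longrightarrow> norm (x - u0) \<le> r \<Longrightarrow>
        F (l, x) = (t - \<alpha> (x - u0)) *\<^sub>R y1 \<Longrightarrow> x = U (l, t)"
    "\<And>l. \<bar>l - l0\<bar> < \<rho> \<Longrightarrow> U (l, 0) \<in> Xsym"
proof -
  obtain B M where B: "bounded_linear B" and M: "M > 0" "\<And>y. norm (B y) \<le> M * norm y"
    and BA: "\<And>v. B (L v + \<alpha> v *\<^sub>R y1) = v" and AB: "\<And>y. L (B y) + \<alpha> (B y) *\<^sub>R y1 = y"
    and B_sym: "\<And>y. y \<in> Ysym \<Longrightarrow> B y \<in> Xsym"
    using bordered_inverse[OF y1] by blast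
  interpret B: bounded_linear B by (rule B)
  let ?A = "\<lambda>v. L v + \<alpha> v *\<^sub>R y1"
  have blK: "bounded_linear (\<lambda>v. \<alpha> v *\<^sub>R y1)"
    by (rule bounded_linear_compose[OF bounded_linear_scaleR_left bounded_linear_\<alpha>])
  have blA: "bounded_linear ?A" by (intro bounded_linear_add bounded_linear_L blK)
  define e where "e = 1 / (2 * M)"
  have e: "e > 0" "M * e \<le> 1 / 2" using M by (auto simp: e_def)
  obtain \<delta> where \<delta>: "\<delta> > 0" "\<And>z vs. dist z (l0, u0) < \<delta> \<Longrightarrow> length vs = 1 \<Longrightarrow>
      norm (D 1 z vs - D 1 (l0, u0) vs) \<le> e * prod_list (map norm vs)"
    using uniformly_continuous_args[OF e(1), where x="(l0, u0)" and n=1] unfolding eventually_nhds_metric by blast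
  define r where "r = \<delta> / 2"
  have r: "r > 0" using \<delta> by (simp add: r_def)
  have close: "norm (D 1 (l, x) [(0, v)] - L v) \<le> e * norm v" if "\<bar>l - l0\<bar> < r" "norm (x - u0) \<le> r" for l x v
  proof -
    have "dist (l, x) (l0, u0) \<le> \<bar>l - l0\<bar> + norm (x - u0)"
      using norm_Pair_le[of "l - l0" "x - u0"] by (simp add: dist_norm)
    then have "dist (l, x) (l0, u0) < \<delta>" using that by (simp add: r_def)
    from \<delta>(2)[OF this, of "[(0, v)]"] show ?thesis by simp
  qed
  define \<Phi> where "\<Phi> z x = F (fst z, x) + (\<alpha> (x - u0) - snd z) *\<^sub>R y1" for z :: "real \<times> real" and x
  have ni: "near_isomorphism ?A B M e r u0 (\<Phi> z)" if z: "\<bar>fst z - l0\<bar> < r" for z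
  proof (rule near_isomorphism.intro[OF B.linear_axioms BA M(2,1) e(2)])
    fix x x' assume xx: "x \<in> cball u0 r" "x' \<in> cball u0 r"
    have "norm ((F (fst z, x) - L x) - (F (fst z, x') - L x')) \<le> e * norm (x - x')"
    proof (rule differentiable_bound[of "cball u0 r" _ "\<lambda>x v. D 1 (fst z, x) [(0, v)] - L v"])
      fix y assume "y \<in> cball u0 r"
      then have y: "norm (y - u0) \<le> r" by (simp add: dist_norm norm_minus_commute)
      have "((\<lambda>v. F (fst z, v)) has_derivative (\<lambda>v. D 1 (fst z, y) [(0, v)])) (at y within cball u0 r)"
        using has_derivative_F[OF slice_u] by (rule has_derivative_at_withinI)
      then show "((\<lambda>x. F (fst z, x) - L x) has_derivative (\<lambda>v. D 1 (fst z, y) [(0, v)] - L v)) (at y within cball u0 r)"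
        by (intro has_derivative_diff bounded_linear_imp_has_derivative[OF bounded_linear_L])
      show "onorm (\<lambda>v. D 1 (fst z, y) [(0, v)] - L v) \<le> e"
        by (rule onorm_bound[OF less_imp_le[OF e(1)]]) (rule close[OF z y])
    qed (use xx in auto)
    moreover have "\<Phi> z x - \<Phi> z x' - ?A (x - x') = (F (fst z, x) - L x) - (F (fst z, x') - L x')"
      by (simp add: \<Phi>_def \<alpha>.diff L.diff algebra_simps)
    ultimately show "norm (\<Phi> z x - \<Phi> z x' - ?A (x - x')) \<le> e * norm (x - x')" by simp
  qed
  have "isCont (\<lambda>z :: real \<times> real. M * norm (F (fst z, u0) - snd z *\<^sub>R y1)) (l0, 0)"
  proof -
    have "((\<lambda>z :: real \<times> real. (fst z, u0)) has_derivative (\<lambda>w. (fst w, 0))) (at (l0, 0))"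
      by (auto intro!: derivative_eq_intros)
    from has_derivative_continuous[OF has_derivative_F[OF this]] show ?thesis
      by (intro continuous_intros) auto
  qed
  then have "\<forall>\<^sub>F z in nhds (l0, 0). dist (M * norm (F (fst z, u0) - snd z *\<^sub>R y1)) 0 < r / 2"
    using F0 r by (intro tendstoD) (auto simp: continuous_at tendsto_nhds_iff)
  then obtain \<rho>0 where \<rho>0: "\<rho>0 > 0"
    "\<And>z. dist z (l0, 0) < \<rho>0 \<Longrightarrow> M * norm (F (fst z, u0) - snd z *\<^sub>R y1) < r / 2"
    unfolding eventually_nhds_metric dist_real_def by fastforce
  \<comment> \<open>Half of \<open>\<rho>0\<close>, as the distance in the plane is bounded by the
    sum of both coordinates; \<open>\<rho> \<le> r\<close> keeps l where \<open>ni\<close>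
    applies.\<close>
  define \<rho> where "\<rho> = min (\<rho>0 / 2) r"
  have \<rho>: "\<rho> > 0" "\<rho> \<le> r" "\<rho> \<le> \<rho>0 / 2" using \<rho>0 r by (auto simp: \<rho>_def)
  let ?S = "{l0 - \<rho><..<l0 + \<rho>} \<times> {-\<rho><..<\<rho>}"
  have S: "open ?S" by (intro open_Times open_greaterThanLessThan)
  have S_iff: "z \<in> ?S \<longleftrightarrow> \<bar>fst z - l0\<bar> < \<rho> \<and> \<bar>snd z\<bar> < \<rho>" for z
    by (cases z) auto
  have start: "M * norm (\<Phi> z u0) \<le> r / 2" if "z \<in> ?S" for z
  proof -
    have "dist z (l0, 0) \<le> \<bar>fst z - l0\<bar> + \<bar>snd z\<bar>"
      using norm_Pair_le[of "fst z - l0" "snd z"] by (cases z) (simp add: dist_norm)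
    then have "dist z (l0, 0) < \<rho>0" using \<rho>(3) that unfolding S_iff by linarith
    from \<rho>0(2)[OF this] show ?thesis by (simp add: \<Phi>_def)
  qed
  have inj: "y = 0" if "B y = 0" for y
    using AB[of y] L.zero \<alpha>.zero unfolding that by simp
  have "\<exists>x. norm (x - u0) \<le> r \<and> \<Phi> z x = 0 \<and> (snd z = 0 \<longrightarrow> x \<in> Xsym)" if z: "z \<in> ?S" for z
  proof -
    have "\<bar>fst z - l0\<bar> < r" using z \<rho> unfolding S_iff by simp
    then interpret near_isomorphism ?A B M e r u0 "\<Phi> z" by (rule ni)
    \<comment> \<open>Choosing the constraint set by cases yields existence for all t and symmetry
      for t = 0 from one iteration.\<close>
    obtain x where "x \<in> (if snd z = 0 then Xsym else UNIV)" "x \<in> cball u0 r" "\<Phi> z x = 0"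
    proof (rule zero_exists[OF less_imp_le[OF r] start[OF z] inj])
      show "closed (if snd z = 0 then Xsym else UNIV)" using Xsym by simp
      show "u0 \<in> (if snd z = 0 then Xsym else UNIV)" using u0 by simp
      fix x assume x: "x \<in> (if snd z = 0 then Xsym else UNIV)"
      show "x - B (\<Phi> z x) \<in> (if snd z = 0 then Xsym else UNIV)"
      proof (cases "snd z = 0")
        case True
        with x have "x \<in> Xsym" by simp
        then have "\<alpha> (x - u0) = 0" using u0 by (intro \<alpha>_Xsym subspace_diff Xsym)
        with True have "\<Phi> z x \<in> Ysym" using F_sym[OF \<open>x \<in> Xsym\<close>] by (simp add: \<Phi>_def)
        then have "x - B (\<Phi> z x) \<in> Xsym" using \<open>x \<in> Xsym\<close> B_sym by (intro subspace_diff Xsym)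
        with True show ?thesis by simp
      qed simp
    qed auto
    then show ?thesis by (intro exI[of _ x]) (auto simp: dist_norm norm_minus_commute)
  qed
  then obtain U where U: "\<And>z. z \<in> ?S \<Longrightarrow> norm (U z - u0) \<le> r" "\<And>z. z \<in> ?S \<Longrightarrow> \<Phi> z (U z) = 0"
    "\<And>z. z \<in> ?S \<Longrightarrow> snd z = 0 \<Longrightarrow> U z \<in> Xsym" by metis
  have stab: "norm (U z - x) \<le> 2 * M * norm (\<Phi> z x)" if z: "z \<in> ?S" and x: "norm (x - u0) \<le> r" for z x
  proof -
    have "\<bar>fst z - l0\<bar> < r" using z \<rho> unfolding S_iff by simp
    then interpret near_isomorphism ?A B M e r u0 "\<Phi> z" by (rule ni)
    show ?thesis using stability[of "U z" x] U(1,2)[OF z] x by (simp add: dist_norm norm_minus_commute)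
  qed
  \<comment> \<open>Invertibility of the bordered derivative along the graph of U. The common bound
    \<open>2 * M\<close> for all z is what \<open>ndiff_on_linear_solution\<close> asks for.\<close>
  have "\<exists>B'. linear B' \<and> (\<forall>v. B' (D 1 (fst z, U z) [(0, v)] + \<alpha> v *\<^sub>R y1) = v) \<and>
      (\<forall>y. D 1 (fst z, U z) [(0, B' y)] + \<alpha> (B' y) *\<^sub>R y1 = y) \<and> (\<forall>y. norm (B' y) \<le> 2 * M * norm y)"
    if z: "z \<in> ?S" for z
  proof -
    have "\<bar>fst z - l0\<bar> < r" using z \<rho> unfolding S_iff by simp
    note cl = close[OF this U(1)[OF z]]
    have "bounded_linear (\<lambda>v. D 1 (fst z, U z) [(0, v)] + \<alpha> v *\<^sub>R y1)"
      by (intro bounded_linear_add blK bounded_linear_compose[OF bounded_linear_jet1 bounded_linear_Pair_0(1)])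
    from isomorphism_perturbation[OF B.linear_axioms BA AB M(2,1) e(2) bounded_linear.linear[OF this]
        _ bounded_linear.linear[OF blA]] cl
    show ?thesis by (metis (no_types, lifting) add_diff_cancel_right)
  qed
  then obtain BB where BB: "\<And>z. z \<in> ?S \<Longrightarrow> linear (BB z)"
    "\<And>z v. z \<in> ?S \<Longrightarrow> BB z (D 1 (fst z, U z) [(0, v)] + \<alpha> v *\<^sub>R y1) = v"
    "\<And>z y. z \<in> ?S \<Longrightarrow> D 1 (fst z, U z) [(0, BB z y)] + \<alpha> (BB z y) *\<^sub>R y1 = y"
    "\<And>z y. z \<in> ?S \<Longrightarrow> norm (BB z y) \<le> 2 * M * norm y"
    by metis
  define U' where "U' z w = - BB z (D 1 (fst z, U z) [(fst w, 0)] - snd w *\<^sub>R y1)" for z and w :: "real \<times> real"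
  have U': "(U has_derivative U' z) (at z)" if z: "z \<in> ?S" for z
  proof -
    define G where "G p = \<Phi> (fst p) (snd p)" for p
    define G' where "G' w = D 1 (fst z, U z) [(fst (fst w), snd w)] + (\<alpha> (snd w) - snd (fst w)) *\<^sub>R y1"
      for w :: "(real \<times> real) \<times> 'a"
    have "((\<lambda>p :: (real \<times> real) \<times> 'a. (fst (fst p), snd p)) has_derivative (\<lambda>w. (fst (fst w), snd w))) (at (z, U z))"
      by (auto intro!: derivative_eq_intros)
    from has_derivative_F[OF this]
    have 1: "((\<lambda>p. F (fst (fst p), snd p)) has_derivative (\<lambda>w. D 1 (fst z, U z) [(fst (fst w), snd w)])) (at (z, U z))"
      by simp
    have "((\<lambda>p. \<alpha> (snd p - u0)) has_derivative (\<lambda>w. \<alpha> (snd w))) (at (z, U z))"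
      by (intro \<alpha>.has_derivative) (auto intro!: derivative_eq_intros)
    then have 2: "((\<lambda>p. (\<alpha> (snd p - u0) - snd (fst p)) *\<^sub>R y1) has_derivative (\<lambda>w. (\<alpha> (snd w) - snd (fst w)) *\<^sub>R y1)) (at (z, U z))"
      by (auto intro!: derivative_eq_intros)
    have G: "(G has_derivative G') (at (z, U z))"
      unfolding G_def[abs_def] G'_def[abs_def] \<Phi>_def by (rule has_derivative_add[OF 1 2])
    have ev: "\<forall>\<^sub>F y in nhds z. y \<in> ?S" using S z by (rule eventually_nhds_in_open)
    have "(U has_derivative (\<lambda>w. - BB z (G' (w, 0)))) (at z)"
    proof (rule implicit_has_derivative[where U=U and C="2 * M", OF G])
      show "\<forall>\<^sub>F y in nhds z. G (y, U y) = 0"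
        using ev by eventually_elim (simp add: G_def U(2))
      show "\<forall>\<^sub>F y in nhds z. norm (U y - U z) \<le> 2 * M * norm (G (y, U z))"
        using ev by eventually_elim (simp add: G_def stab U(1)[OF z])
      show "bounded_linear (BB z)"
        using BB(4)[OF z]
        by (intro bounded_linear_intro[where K="2 * M"] linear_add[OF BB(1)[OF z]] linear_scale[OF BB(1)[OF z]])
          (simp add: mult.commute)
      show "BB z (G' (0, x)) = x" for x
        using BB(2)[OF z] by (simp add: G'_def)
    qed
    moreover have "- BB z (G' (w, 0)) = U' z w" for w
      by (simp add: G'_def U'_def \<alpha>.zero)
    ultimately show ?thesis by simp
  qed
  have U'_eq: "D 1 (fst z, U z) [(0, U' z w)] + \<alpha> (U' z w) *\<^sub>R y1 = snd w *\<^sub>R y1 - D 1 (fst z, U z) [(fst w, 0)]"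
    if "z \<in> ?S" for z w
    unfolding U'_def linear_neg[OF BB(1)[OF that], symmetric] BB(3)[OF that] by simp
  \<comment> \<open>If U has k orders, so has \<open>U'\<close>, as it solves a linear equation with
    coefficients along the graph of U; then U has k + 1.\<close>
  have smooth: "ndiff_on k ?S U" for k
  proof (induction k)
    case (Suc k)
    have \<gamma>: "ndiff_on k ?S (\<lambda>z. (fst z, U z))"
      by (intro ndiff_on_Pair Suc ndiff_on_bounded_linear bounded_linear_fst)
    have "ndiff_on k ?S (\<lambda>z. U' z w)" for w
    proof (rule ndiff_on_linear_solution[OF S bounded_linear_Pair_0(1) blK BB(1) BB(4) BB(2) BB(3) \<gamma> _ U'_eq])
      let ?vs = "[\<lambda>_ :: real \<times> real. (fst w, 0 :: 'a)]"
      have "ndiff_on k ?S (\<lambda>z. D (length ?vs) (fst z, U z) (map (\<lambda>v. v z) ?vs))"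
        by (rule ndiff_on_compose[OF \<gamma>]) (auto intro: ndiff_on_const)
      then have "ndiff_on k ?S (\<lambda>z. D 1 (fst z, U z) [(fst w, 0)])" by (simp add: One_nat_def)
      then show "ndiff_on k ?S (\<lambda>z. snd w *\<^sub>R y1 - D 1 (fst z, U z) [(fst w, 0)])"
        by (rule ndiff_on_diff[OF ndiff_on_const])
    qed assumption+
    with U' show ?case by (rule ndiff_on_SucI)
  qed simp
  show ?thesis
  proof (rule that[OF r \<rho>(1) smooth])
    show "F (l, U (l, t)) = (t - \<alpha> (U (l, t) - u0)) *\<^sub>R y1" if "\<bar>l - l0\<bar> < \<rho>" "\<bar>t\<bar> < \<rho>" for l t
    proof -
      have "\<Phi> (l, t) (U (l, t)) = 0" using that by (intro U(2)) (simp add: S_iff)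
      then show ?thesis by (simp add: \<Phi>_def algebra_simps eq_neg_iff_add_eq_0)
    qed
    show "x = U (l, t)" if "\<bar>l - l0\<bar> < \<rho>" "\<bar>t\<bar> < \<rho>" "norm (x - u0) \<le> r" "F (l, x) = (t - \<alpha> (x - u0)) *\<^sub>R y1" for l t x
    proof -
      have "\<Phi> (l, t) x = 0" using that(4) by (simp add: \<Phi>_def algebra_simps)
      moreover have "(l, t) \<in> ?S" using that by (simp add: S_iff)
      ultimately show ?thesis using stab[of "(l, t)" x] that(3) by simp
    qed
    show "U (l, 0) \<in> Xsym" if "\<bar>l - l0\<bar> < \<rho>" for l
      using that \<rho>(1) by (intro U(3)) (simp_all add: S_iff)
  qed
qed

end

section \<open>Existence of the bifurcating branch\<close>

context nondegenerate_setting
begin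

text \<open>The reduced function \<open>f (l, t) = t - \<alpha> (U (l, t) - u0)\<close> satisfies \<open>F (l, U (l, t)) = f (l, t) y1\<close>
  and vanishes for \<open>t = 0\<close>; \<open>g = f / t\<close> has a simple zero in \<open>l\<close> at the bifurcation point.\<close>

lemma reduced_equation:
  assumes y1: "psi0 y1 = 1" and \<rho>: "\<rho> > 0"
    and U: "\<And>k. ndiff_on k ({l0 - \<rho><..<l0 + \<rho>} \<times> {-\<rho><..<\<rho>}) U"
    and U_eq: "\<And>l t. \<bar>l - l0\<bar> < \<rho> \<Longrightarrow> \<bar>t\<bar> < \<rho> \<Longrightarrow> F (l, U (l, t)) = (t - \<alpha> (U (l, t) - u0)) *\<^sub>R y1"
    and U_sym: "\<And>l. \<bar>l - l0\<bar> < \<rho> \<Longrightarrow> U (l, 0) \<in> Xsym"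
    and U0: "U (l0, 0) = u0"
  obtains g a b where "a \<noteq> 0" "g (l0, 0) = 0"
    "\<And>k. ndiff_on k ({l0 - \<rho><..<l0 + \<rho>} \<times> {-\<rho><..<\<rho>}) g"
    "(g has_derivative (\<lambda>w. fst w * a + snd w * b)) (at (l0, 0))"
    "\<And>l t. \<bar>l - l0\<bar> < \<rho> \<Longrightarrow> \<bar>t\<bar> < \<rho> \<Longrightarrow> t * g (l, t) = t - \<alpha> (U (l, t) - u0)"
proof -
  let ?S = "{l0 - \<rho><..<l0 + \<rho>} \<times> {-\<rho><..<\<rho>}" and ?z = "(l0, 0::real)"
  have S: "open ?S" "convex ?S"
    by (intro open_Times open_greaterThanLessThan, intro convex_Times) auto
  have S_iff: "z \<in> ?S \<longleftrightarrow> \<bar>fst z - l0\<bar> < \<rho> \<and> \<bar>snd z\<bar> < \<rho>" for z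
    by (cases z) auto
  have star: "(x, \<tau> * t) \<in> ?S" if "(x, t) \<in> ?S" "0 \<le> \<tau>" "\<tau> \<le> 1" for x t \<tau>
  proof -
    have "\<bar>\<tau> * t\<bar> \<le> 1 * \<bar>t\<bar>" unfolding abs_mult using that by (intro mult_right_mono) auto
    then show ?thesis using that unfolding S_iff by auto
  qed
  have z: "?z \<in> ?S" using \<rho> by simp
  obtain U' where U': "\<And>z. z \<in> ?S \<Longrightarrow> (U has_derivative U' z) (at z)" "\<And>k w. ndiff_on k ?S (\<lambda>z. U' z w)"
    using ndiff_on_derivativeE[OF S(1) U] by blast
  define f where "f z = snd z - \<alpha> (U z - u0)" for z
  define f2 where "f2 z = 1 - \<alpha> (U' z (0, 1))" for z
  define f1 where "f1 z = - \<alpha> (U' z (1, 0))" for z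
  have F_eq: "F (fst z, U z) = f z *\<^sub>R y1" if "z \<in> ?S" for z
    using U_eq[of "fst z" "snd z"] that unfolding S_iff by (simp add: f_def)
  have f': "(f has_derivative (\<lambda>w. snd w - \<alpha> (U' z w))) (at z)" if "z \<in> ?S" for z
  proof -
    have "((\<lambda>z. U z - u0) has_derivative U' z) (at z)"
      using has_derivative_diff[OF U'(1)[OF that] has_derivative_const[of u0]] by simp
    from has_derivative_diff[OF has_derivative_snd[OF has_derivative_ident] \<alpha>.has_derivative[OF this]]
    show ?thesis by (simp add: f_def[abs_def])
  qed
  have f'': "(f has_derivative (\<lambda>w. fst w * f1 z + snd w * f2 z)) (at z)" if "z \<in> ?S" for z
  proof (rule has_derivative_eq_rhs[OF f'[OF that]], rule ext)
    fix w
    interpret U': linear "U' z" using U'(1)[OF that] by (rule has_derivative_linear)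
    have "U' z w = U' z (fst w *\<^sub>R (1, 0) + snd w *\<^sub>R (0, 1))" by simp
    also have "\<dots> = fst w *\<^sub>R U' z (1, 0) + snd w *\<^sub>R U' z (0, 1)" by (simp only: U'.add U'.scale)
    finally have "U' z w = fst w *\<^sub>R U' z (1, 0) + snd w *\<^sub>R U' z (0, 1)" .
    then show "snd w - \<alpha> (U' z w) = fst w * f1 z + snd w * f2 z"
      by (simp add: f1_def f2_def \<alpha>.scaleR \<alpha>.add right_diff_distrib)
  qed
  have graph: "((\<lambda>z. (fst z, U z)) has_derivative (\<lambda>w. (fst w, U' z w))) (at z)" if "z \<in> ?S" for z
    by (intro has_derivative_Pair has_derivative_fst has_derivative_ident U'(1) that)
  have eq1: "D 1 (fst z, U z) [(fst w, U' z w)] = (snd w - \<alpha> (U' z w)) *\<^sub>R y1" if z: "z \<in> ?S" for z w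
  proof -
    have "((\<lambda>z. F (fst z, U z)) has_derivative (\<lambda>w. (snd w - \<alpha> (U' z w)) *\<^sub>R y1)) (at z)"
      by (rule has_derivative_transform_within_open[OF has_derivative_scaleR_left[OF f'[OF z]] S(1) z])
        (simp add: F_eq)
    from has_derivative_unique[OF has_derivative_F[OF graph[OF z]] this] show ?thesis by meson
  qed
  \<comment> \<open>\<open>psi0\<close> splits the differentiated bordered equation: the coefficient
    of \<open>y1\<close> must vanish, what remains lies in the kernel of L, and the value of
    \<alpha> fixes the multiple of \<open>phi0\<close>. The derivative in l is treated
    alike.\<close>
  have U'2: "U' ?z (0, 1) = phi0"
  proof -
    have L: "L (U' ?z (0, 1)) = (1 - \<alpha> (U' ?z (0, 1))) *\<^sub>R y1" using eq1[OF z, of "(0, 1)"] by (simp add: U0)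
    from arg_cong[OF this, of "blinfun_apply psi0"] have \<alpha>: "\<alpha> (U' ?z (0, 1)) = 1"
      by (simp add: psi0_L blinfun.scaleR_right y1)
    with L obtain c where "U' ?z (0, 1) = c *\<^sub>R phi0" using kernel(2) by auto
    with \<alpha> show ?thesis by (simp add: \<alpha>.scaleR \<alpha>_phi0)
  qed
  have U'1: "U' ?z (1, 0) = xi"
  proof -
    have L: "L (U' ?z (1, 0) - xi) = (- \<alpha> (U' ?z (1, 0))) *\<^sub>R y1"
      using eq1[OF z, of "(1, 0)"] jet1_eq_L[of "(1, U' ?z (1, 0))"] by (simp add: U0)
    from arg_cong[OF this, of "blinfun_apply psi0"] have \<alpha>: "\<alpha> (U' ?z (1, 0)) = 0"
      by (simp add: psi0_L blinfun.bilinear_simps y1)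
    with L obtain c where c: "U' ?z (1, 0) - xi = c *\<^sub>R phi0" using kernel(2) by auto
    from arg_cong[OF c, of \<alpha>] \<alpha> have "c = 0" by (simp add: \<alpha>.diff \<alpha>.scaleR \<alpha>_phi0 \<alpha>_Xsym[OF xi(1)])
    with c show ?thesis by simp
  qed
  obtain V' where "\<And>z. z \<in> ?S \<Longrightarrow> ((\<lambda>z. U' z (0, 1)) has_derivative V' z) (at z)"
    using U'(2)[of "Suc 0" "(0, 1)"] by (metis ndiff_on_SucE)
  from this[OF z] obtain V where V: "((\<lambda>z. U' z (0, 1)) has_derivative V) (at ?z)" by blast
  \<comment> \<open>The t-derivative of the bordered equation is differentiated once more, in l;
    \<open>psi0\<close> discards \<open>L (V (1, 0))\<close> and leaves the nondegeneracy
    quantity.\<close>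
  have cross: "\<alpha> (V (1, 0)) = - psi0 (D 2 (l0, u0) [(1, xi), (0, phi0)])"
  proof -
    have "((\<lambda>z. (0, U' z (0, 1))) has_derivative (\<lambda>w. (0, V w))) (at ?z)"
      by (intro has_derivative_Pair has_derivative_const V)
    from has_derivative_jet1[OF graph[OF z] this]
    have 1: "((\<lambda>z. D 1 (fst z, U z) [(0, U' z (0, 1))]) has_derivative
        (\<lambda>w. D 2 (l0, u0) [(fst w, U' ?z w), (0, phi0)] + L (V w))) (at ?z)"
      by (simp add: U0 U'2)
    have "((\<lambda>z. (1 - \<alpha> (U' z (0, 1))) *\<^sub>R y1) has_derivative (\<lambda>w. (0 - \<alpha> (V w)) *\<^sub>R y1)) (at ?z)"
      by (intro has_derivative_scaleR_left has_derivative_diff has_derivative_const \<alpha>.has_derivative V)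
    then have 2: "((\<lambda>z. D 1 (fst z, U z) [(0, U' z (0, 1))]) has_derivative (\<lambda>w. (0 - \<alpha> (V w)) *\<^sub>R y1)) (at ?z)"
      by (rule has_derivative_transform_within_open[OF _ S(1) z]) (use eq1[of _ "(0, 1)"] in simp)
    have "D 2 (l0, u0) [(1, xi), (0, phi0)] + L (V (1, 0)) = (0 - \<alpha> (V (1, 0))) *\<^sub>R y1"
      using fun_cong[OF has_derivative_unique[OF 1 2], of "(1, 0)"] by (simp add: U'1)
    from arg_cong[OF this, of "blinfun_apply psi0"] show ?thesis
      by (simp add: blinfun.bilinear_simps psi0_L y1)
  qed
  have nd2: "ndiff_on k ?S f2" for k
    unfolding f2_def by (intro ndiff_on_diff ndiff_on_const ndiff_on_compose_linear[OF bounded_linear_\<alpha>] U'(2))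
  obtain f21 f22 where f2': "\<And>z. z \<in> ?S \<Longrightarrow> (f2 has_derivative (\<lambda>w. fst w * f21 z + snd w * f22 z)) (at z)"
    "\<And>k. ndiff_on k ?S f21" "\<And>k. ndiff_on k ?S f22"
    using ndiff_on_plane_derivativeE[OF S(1) nd2] by blast
  have f2z: "f2 ?z = 0" by (simp add: f2_def U'2 \<alpha>_phi0)
  have f21z: "f21 ?z = psi0 (D 2 (l0, u0) [(1, xi), (0, phi0)])"
  proof -
    have "(f2 has_derivative (\<lambda>w. 0 - \<alpha> (V w))) (at ?z)"
      unfolding f2_def[abs_def] by (intro has_derivative_diff has_derivative_const \<alpha>.has_derivative V)
    from fun_cong[OF has_derivative_unique[OF this f2'(1)[OF z]], of "(1, 0)"]
    show ?thesis using cross by simp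
  qed
  \<comment> \<open>At t = 0 the integrand is constant in \<tau>.\<close>
  have int_const: "hadamard 0 k ?z = k ?z" for k by (simp add: hadamard_def)
  show ?thesis
  proof (rule that[of "f21 ?z" "hadamard 0 f2" "hadamard 1 f22 ?z"])
    show "f21 ?z \<noteq> 0" using nondegenerate f21z by simp
    show "hadamard 0 f2 ?z = 0" by (simp add: int_const f2z)
    show "ndiff_on k ?S (hadamard 0 f2)" for k
      by (rule ndiff_on_hadamard[OF S star nd2]) auto
    show "(hadamard 0 f2 has_derivative (\<lambda>w. fst w * f21 ?z + snd w * hadamard 1 f22 ?z)) (at ?z)"
      using hadamard_has_derivative[OF S star f2'(1) f2'(2,3)[of 1, unfolded One_nat_def, THEN ndiff_on_continuous] z, of 0]
      by (simp add: int_const One_nat_def)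
    show "t * hadamard 0 f2 (l, t) = t - \<alpha> (U (l, t) - u0)" if lt: "\<bar>l - l0\<bar> < \<rho>" "\<bar>t\<bar> < \<rho>" for l t
    proof -
      have "(l, t) \<in> ?S" using lt by (simp add: S_iff)
      then have "t * hadamard 0 f2 (l, t) = f (l, t) - f (l, 0)"
        by (intro hadamard_division[where S="?S" and ?f1.0=f1] star f'')
      moreover have "f (l, 0) = 0"
        using \<alpha>_Xsym[OF subspace_diff[OF Xsym(1) U_sym[OF lt(1)] u0]] by (simp add: f_def)
      ultimately show ?thesis by (simp add: f_def)
    qed
  qed
qed

text \<open>The reduced equation factors as \<open>t * g (l, t) = 0\<close>: the factor t gives the
  primary branch, g the other one.\<close>

theorem bifurcation: "bifurcation_point F Xsym l0 u0"
proof -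
  obtain y where "psi0 y \<noteq> 0" using psi0 by (metis blinfun_eqI blinfun.zero_left)
  then have "psi0 (y /\<^sub>R psi0 y) = 1" by (simp add: blinfun.scaleR_right)
  then obtain y1 where y1: "psi0 y1 = 1" by blast
  obtain r \<rho> U where r: "r > 0" and \<rho>: "\<rho> > 0"
    and U: "\<And>k. ndiff_on k ({l0 - \<rho><..<l0 + \<rho>} \<times> {-\<rho><..<\<rho>}) U"
    and U_eq: "\<And>l t. \<bar>l - l0\<bar> < \<rho> \<Longrightarrow> \<bar>t\<bar> < \<rho> \<Longrightarrow> F (l, U (l, t)) = (t - \<alpha> (U (l, t) - u0)) *\<^sub>R y1"
    and U_unique: "\<And>l t x. \<bar>l - l0\<bar> < \<rho> \<Longrightarrow> \<bar>t\<bar> < \<rho> \<Longrightarrow> norm (x - u0) \<le> r \<Longrightarrow>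
        F (l, x) = (t - \<alpha> (x - u0)) *\<^sub>R y1 \<Longrightarrow> x = U (l, t)"
    and U_sym: "\<And>l. \<bar>l - l0\<bar> < \<rho> \<Longrightarrow> U (l, 0) \<in> Xsym"
    by (rule lyapunov_schmidt[OF y1]) (rule that; assumption)
  let ?S = "{l0 - \<rho><..<l0 + \<rho>} \<times> {-\<rho><..<\<rho>}"
  have S: "open ?S" by (intro open_Times open_greaterThanLessThan)
  have U0: "U (l0, 0) = u0"
    using U_unique[of l0 0 u0] \<rho> r F0 by (simp add: \<alpha>.zero)
  obtain g a b where g: "a \<noteq> 0" "g (l0, 0) = 0" "\<And>k. ndiff_on k ?S g"
    "(g has_derivative (\<lambda>w. fst w * a + snd w * b)) (at (l0, 0))"
    and g_eq: "\<And>l t. \<bar>l - l0\<bar> < \<rho> \<Longrightarrow> \<bar>t\<bar> < \<rho> \<Longrightarrow> t * g (l, t) = t - \<alpha> (U (l, t) - u0)"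
    by (rule reduced_equation[OF y1 \<rho> U U_eq U_sym U0]) (assumption | rule that; assumption)+
  have z: "(l0, 0) \<in> ?S" using \<rho> by simp
  obtain r1 \<rho>1 h where r1: "r1 > 0" and \<rho>1: "\<rho>1 > 0" and h: "\<And>k. ndiff_on k {-\<rho>1<..<\<rho>1} h"
    and h_eq: "\<And>t. \<bar>t\<bar> < \<rho>1 \<Longrightarrow> \<bar>h t - l0\<bar> \<le> r1 \<and> (h t, t) \<in> ?S \<and> g (h t, t) = 0"
    and h_unique: "\<And>t l. \<bar>t\<bar> < \<rho>1 \<Longrightarrow> \<bar>l - l0\<bar> \<le> r1 \<Longrightarrow> g (l, t) = 0 \<Longrightarrow> l = h t"
    by (rule implicit_curve[OF S g(3) z g(2,4,1)]) (rule that; assumption)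
  have h0: "h 0 = l0" using h_unique[of 0 l0] \<rho>1 r1 g(2) by simp
  define p where "p l = U (l, 0)" for l
  define u where "u t = U (h t, t)" for t
  let ?P = "{l0 - \<rho><..<l0 + \<rho>}" and ?T = "{-\<rho>1<..<\<rho>1}"
  have nd_p: "ndiff_on k ?P p" for k
    unfolding p_def
    by (rule ndiff_on_compose_plane[OF U]) (use \<rho> in \<open>auto intro!: ndiff_on_bounded_linear bounded_linear_Pair_0 ndiff_on_Pair ndiff_on_const bounded_linear_ident\<close>)
  have nd_u: "ndiff_on k ?T u" for k
    unfolding u_def
  proof (rule ndiff_on_compose_plane[OF U])
    show "ndiff_on k ?T (\<lambda>t. (h t, t))"
      by (intro ndiff_on_Pair h ndiff_on_bounded_linear bounded_linear_ident)
    show "(\<lambda>t. (h t, t)) ` ?T \<subseteq> ?S"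
    proof clarify
      fix t assume "t \<in> ?T"
      then have "(h t, t) \<in> ?S" using h_eq[of t] by (simp add: abs_less_iff)
      then show "h t \<in> ?P \<and> t \<in> {-\<rho><..<\<rho>}" by blast
    qed
  qed
  have cont: "continuous_on ?P p" "continuous_on ?T u" "continuous_on ?T h"
    using ndiff_on_continuous[OF nd_p[of "Suc 0"]] ndiff_on_continuous[OF nd_u[of "Suc 0"]]
      ndiff_on_continuous[OF h[of "Suc 0"]] .
  have p0: "p l0 = u0" and u_0: "u 0 = u0" by (simp_all add: p_def u_def h0 U0)
  have "\<forall>\<^sub>F l in nhds l0. dist (p l) u0 < r"
    using cont(1) \<rho> r p0 by (intro tendstoD)
      (auto simp: continuous_on_eq_continuous_at continuous_at tendsto_nhds_iff)
  then obtain e0 where e0: "e0 > 0" "\<And>l. \<bar>l - l0\<bar> < e0 \<Longrightarrow> norm (p l - u0) < r"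
    by (auto simp: eventually_nhds_metric dist_norm)
  \<comment> \<open>\<open>e0\<close> keeps p near \<open>u0\<close>, \<rho> keeps l in the domain
    of U, and \<open>r1\<close> makes the uniqueness of h available.\<close>
  define e where "e = min e0 (min \<rho> r1)"
  have e: "e > 0" "e \<le> e0" "e \<le> \<rho>" "e \<le> r1" using e0 \<rho> r1 by (auto simp: e_def)
  have "\<forall>\<^sub>F t in nhds 0. dist (u t) u0 < r"
    using cont(2) \<rho>1 r u_0 by (intro tendstoD)
      (auto simp: continuous_on_eq_continuous_at continuous_at tendsto_nhds_iff)
  moreover have "\<forall>\<^sub>F t in nhds 0. dist (h t) l0 < e"
    using cont(3) \<rho>1 e h0 by (intro tendstoD)
      (auto simp: continuous_on_eq_continuous_at continuous_at tendsto_nhds_iff)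
  ultimately have "\<forall>\<^sub>F t in nhds 0. dist (u t) u0 < r \<and> dist (h t) l0 < e"
    by eventually_elim simp
  then obtain d0 where d0: "d0 > 0" "\<And>t. \<bar>t\<bar> < d0 \<Longrightarrow> norm (u t - u0) < r \<and> \<bar>h t - l0\<bar> < e"
    by (auto simp: eventually_nhds_metric dist_norm)
  define d where "d = min d0 (min \<rho> \<rho>1)"
  have d: "d > 0" "d \<le> d0" "d \<le> \<rho>" "d \<le> \<rho>1" using d0 \<rho> \<rho>1 by (auto simp: d_def)
  have \<alpha>_u: "\<alpha> (u t - u0) = t" if "\<bar>t\<bar> < d" for t
    using g_eq[of "h t" t] h_eq[of t] that d by (auto simp: u_def abs_less_iff)
  have F_u: "F (h t, u t) = 0" if "\<bar>t\<bar> < d" for t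
  proof -
    have "F (h t, u t) = (t - \<alpha> (u t - u0)) *\<^sub>R y1"
      unfolding u_def using h_eq[of t] that d by (intro U_eq) (auto simp: abs_less_iff)
    then show ?thesis by (simp add: \<alpha>_u[OF that])
  qed
  have p_sym: "p l \<in> Xsym" if "\<bar>l - l0\<bar> < e" for l
    unfolding p_def using that e by (intro U_sym) simp
  then have \<alpha>_p: "\<alpha> (p l - u0) = 0" if "\<bar>l - l0\<bar> < e" for l
    using that u0 by (intro \<alpha>_Xsym subspace_diff Xsym)
  have F_p: "F (l, p l) = 0" if "\<bar>l - l0\<bar> < e" for l
  proof -
    have "F (l, p l) = (0 - \<alpha> (p l - u0)) *\<^sub>R y1"
      unfolding p_def using that e \<rho> by (intro U_eq) auto
    then show ?thesis by (simp add: \<alpha>_p[OF that])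
  qed
  \<comment> \<open>The third condition restricts the amplitude, which is 0 along p and t along u;
    with it the solutions in N are exactly the two curves over the chosen intervals.\<close>
  define N where "N = {z. \<bar>fst z - l0\<bar> < e \<and> norm (snd z - u0) < r \<and> \<bar>\<alpha> (snd z - u0)\<bar> < d}"
  have "{z \<in> N. F z = 0} = (\<lambda>l. (l, p l)) ` {l0 - e<..<l0 + e} \<union> (\<lambda>a. (h a, u a)) ` {-d<..<d}" (is "?lhs = ?rhs")
  proof
    show "?lhs \<subseteq> ?rhs"
    proof clarify
      fix l x assume N: "(l, x) \<in> N" and F: "F (l, x) = 0" and not: "(l, x) \<notin> (\<lambda>a. (h a, u a)) ` {-d<..<d}"
      define t where "t = \<alpha> (x - u0)"
      have lt: "\<bar>l - l0\<bar> < e" "\<bar>t\<bar> < d" "norm (x - u0) \<le> r" using N by (auto simp: N_def t_def)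
      have x: "x = U (l, t)"
        using lt e d F by (intro U_unique) (auto simp: t_def)
      have "t * g (l, t) = t - \<alpha> (U (l, t) - u0)" using lt e d by (intro g_eq) auto
      also have "\<dots> = 0" unfolding x[symmetric] t_def[symmetric] by simp
      finally have "t * g (l, t) = 0" .
      moreover have "t \<noteq> 0 \<Longrightarrow> g (l, t) \<noteq> 0"
      proof
        assume "g (l, t) = 0"
        then have "l = h t" using lt e d by (intro h_unique) auto
        then have "(l, x) = (h t, u t)" using x unfolding u_def by (metis (no_types))
        then show False using not lt(2) by (auto simp: abs_less_iff)
      qed
      ultimately have "t = 0" by auto
      then have "x = p l" using x unfolding p_def by (simp only:)
      then show "(l, x) \<in> (\<lambda>l. (l, p l)) ` {l0 - e<..<l0 + e}" using lt(1) by (auto simp: abs_less_iff)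
    qed
    show "?rhs \<subseteq> ?lhs"
    proof (intro Un_least image_subsetI)
      fix l assume "l \<in> {l0 - e<..<l0 + e}"
      then have l: "\<bar>l - l0\<bar> < e" by auto
      then show "(l, p l) \<in> ?lhs" using F_p[OF l] \<alpha>_p[OF l] e0(2)[of l] e d by (simp add: N_def)
    next
      fix t assume "t \<in> {-d<..<d}"
      then have t: "\<bar>t\<bar> < d" by auto
      then show "(h t, u t) \<in> ?lhs" using F_u[OF t] \<alpha>_u[OF t] d0(2)[of t] d by (simp add: N_def)
    qed
  qed
  moreover have "open N"
  proof -
    have "continuous_on UNIV (\<lambda>z :: real \<times> 'a. \<alpha> (snd z - u0))"
      by (intro continuous_intros \<alpha>.continuous_on)
    then show ?thesis unfolding N_def
      by (intro open_Collect_conj open_Collect_less continuous_intros)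
  qed
  moreover have "(l0, u0) \<in> N" using e r d by (simp add: N_def \<alpha>.zero)
  moreover have "vector_derivative u (at 0) \<notin> Xsym"
  proof
    \<comment> \<open>Along the branch \<open>\<alpha> (u t - u0) = t\<close> has derivative 1,
      while \<alpha> would vanish on a symmetric tangent.\<close>
    assume Xs: "vector_derivative u (at 0) \<in> Xsym"
    have "u differentiable (at 0)" using nd_u[of "Suc 0"] \<rho>1 by (auto simp: differentiable_def)
    then have du: "(u has_vector_derivative vector_derivative u (at 0)) (at 0)" by (simp add: vector_derivative_works)
    have "((\<lambda>t. u t - u0) has_vector_derivative vector_derivative u (at 0)) (at 0)"
      using has_vector_derivative_diff[OF du has_vector_derivative_const[of u0]] by simp
    from \<alpha>.has_vector_derivative[OF this]
    have "((\<lambda>t. \<alpha> (u t - u0)) has_vector_derivative 0) (at 0)" using \<alpha>_Xsym[OF Xs] by simp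
    moreover have "((\<lambda>t. \<alpha> (u t - u0)) has_vector_derivative 1) (at 0)"
      by (rule has_vector_derivative_transform_within_open[where S="{-d<..<d}", OF has_vector_derivative_id])
        (use d \<alpha>_u in \<open>auto simp: abs_less_iff\<close>)
    ultimately show False using vector_derivative_unique_at by fastforce
  qed
  moreover have "smooth_on {l0 - e<..<l0 + e} p"
    by (intro smooth_on_realI open_greaterThanLessThan ndiff_on_subset[OF nd_p]) (use e in auto)
  moreover have "smooth_on {-d<..<d} u" "smooth_on {-d<..<d} h"
    by (intro smooth_on_realI open_greaterThanLessThan ndiff_on_subset[OF nd_u] ndiff_on_subset[OF h]; use d in auto)+
  moreover have "p ` {l0 - e<..<l0 + e} \<subseteq> Xsym" using p_sym by (auto simp: abs_less_iff)
  ultimately have "bifurcation_branches F Xsym l0 u0 e p d h u"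
    unfolding bifurcation_branches_def using e(1) d(1) p0 h0 u_0 by blast
  then show ?thesis unfolding bifurcation_point_def by blast
qed

end

section \<open>The Fredholm hypotheses\<close>

lemma has_dim_singleton_0: "has_dim {0} n \<longleftrightarrow> n = 0"
proof
  assume "has_dim {0::'a::real_vector} n"
  then obtain B :: "'a set" where B: "independent B" "card B = n" "span B = {0}" unfolding has_dim_def by blast
  have "B \<subseteq> {0}" unfolding B(3)[symmetric] by (rule span_superset)
  moreover have "0 \<notin> B" using B(1) dependent_zero by blast
  ultimately have "B = {}" by blast
  then show "n = 0" using B(2) by simp
qed (auto simp: has_dim_def independent_empty intro!: exI[of _ "{}"])

text \<open>With trivial kernel, index zero forces codimension zero, so the complement of the range
  is {0}.\<close>

lemma fredholm_index_0_surj: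
  assumes "fredholm_of_index A B T 0" and "{x\<in>A. blinfun_apply T x = 0} = {0}"
  shows "T ` A = B"
proof -
  obtain m n where mn: "has_dim {x\<in>A. T x = 0} m" "has_codim (T ` A) B n" "0 = int m - int n"
    using assms(1) unfolding fredholm_of_index_def by (elim conjE exE) (rule that)
  have "m = 0" using mn(1) unfolding assms(2) has_dim_singleton_0 .
  then have "n = 0" using mn(3) by simp
  then obtain W where W: "has_dim W 0" "{r + w |r w. r \<in> T ` A \<and> w \<in> W} = B"
    using mn(2) unfolding has_codim_def by blast
  have "W = {0}" using W(1) by (auto simp: has_dim_def)
  then show ?thesis using W(2) by auto
qed

theorem theorem2p4:
  fixes F :: "real \<times> 'a::banach \<Rightarrow> 'b::banach"
    and l0 :: real and u0 :: 'a
    and L :: "'a \<Rightarrow>\<^sub>L 'b"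
    and phi0 :: 'a and psi0 :: "'b \<Rightarrow>\<^sub>L real"
    and Xsym :: "'a set" and Ysym :: "'b set"
  assumes "smooth_on UNIV F"
    and "F (l0, u0) = 0"
    and "L = D_u F l0 u0"
    and "fredholm_of_index UNIV UNIV L 0"
    and "has_dim {x. L x = 0} 1"
    and "phi0 \<noteq> 0" and "{x. L x = 0} = span {phi0}"
    and "psi0 \<noteq> 0" and "range L = {y. psi0 y = 0}"
    and "subspace Xsym" and "closed Xsym"
    and "subspace Ysym" and "closed Ysym"
    and "\<And>l v. v \<in> Xsym \<Longrightarrow> F (l, v) \<in> Ysym"
    and "fredholm_of_index Xsym Ysym L 0"
    and "u0 \<in> Xsym" and "phi0 \<notin> Xsym"
  shows "(\<exists>!xi. xi \<in> Xsym \<and> L xi + D_lam F l0 u0 = 0) \<and>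
    (\<forall>xi. xi \<in> Xsym \<and> L xi + D_lam F l0 u0 = 0 \<and>
        D_lam_u F l0 u0 phi0 + D_uu F l0 u0 phi0 xi \<notin> range L \<longrightarrow>
      bifurcation_point F Xsym l0 u0 \<and>
      (D_uu F l0 u0 phi0 phi0 \<notin> range L \<longrightarrow> transcritical_bifurcation F Xsym l0 u0) \<and>
      (D_uu F l0 u0 phi0 phi0 \<in> range L \<longrightarrow> pitchfork_bifurcation F Xsym l0 u0) \<and>
      symmetry_breaking_bifurcation F Xsym l0 u0)"
proof -
  obtain D where D: "smooth_jet D" "\<And>x. D 0 x [] = F x"
    using smooth_on_UNIV_jet[OF assms(1)] by blast
  interpret J: smooth_jet_of D F
    using D by (simp add: smooth_jet_of_def smooth_jet_of_axioms_def)
  have L: "L v = D 1 (l0, u0) [(0, v)]" for v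
    unfolding assms(3) by (rule J.D_u_apply)
  have ker: "L v = 0 \<longleftrightarrow> (\<exists>c. v = c *\<^sub>R phi0)" for v
    using assms(7) by (auto simp: span_singleton set_eq_iff)
  have "{x\<in>Xsym. L x = 0} = {0}"
  proof (intro equalityI subsetI)
    fix x assume "x \<in> {x\<in>Xsym. L x = 0}"
    then obtain c where c: "x = c *\<^sub>R phi0" "c *\<^sub>R phi0 \<in> Xsym" using ker by auto
    then show "x \<in> {0}"
      using assms(17) subspace_scale[OF assms(10) c(2), of "inverse c"] by (cases "c = 0") auto
  qed (use subspace_0[OF assms(10)] in \<open>auto simp: blinfun.zero_right\<close>)
  then have onto: "L ` Xsym = Ysym" by (rule fredholm_index_0_surj[OF assms(15)])
  interpret symmetric_setting D F l0 u0 phi0 psi0 Xsym Ysym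
  proof unfold_locales
    show "psi0 y = 0 \<longleftrightarrow> (\<exists>v. y = D 1 (l0, u0) [(0, v)])" for y
      using assms(9) by (auto simp: L[symmetric] set_eq_iff image_iff)
    show "\<exists>v\<in>Xsym. y = D 1 (l0, u0) [(0, v)]" if "y \<in> Ysym" for y
      using onto that by (auto simp: L[symmetric])
    show "D 1 (l0, u0) [(0, phi0)] = 0" using ker[of phi0] by (simp add: L[symmetric] exI[of _ 1])
    show "\<exists>c. v = c *\<^sub>R phi0" if "D 1 (l0, u0) [(0, v)] = 0" for v
      using ker[of v] that by (simp add: L[symmetric])
  qed (use assms in auto)
  have range_iff: "y \<in> range L \<longleftrightarrow> psi0 y = 0" for y using assms(9) by auto
  have "bifurcation_point F Xsym l0 u0 \<and>
      (D_uu F l0 u0 phi0 phi0 \<notin> range L \<longrightarrow> transcritical_bifurcation F Xsym l0 u0) \<and>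
      (D_uu F l0 u0 phi0 phi0 \<in> range L \<longrightarrow> pitchfork_bifurcation F Xsym l0 u0) \<and>
      symmetry_breaking_bifurcation F Xsym l0 u0"
    if xi: "xi \<in> Xsym" "L xi + D_lam F l0 u0 = 0"
      and nd: "D_lam_u F l0 u0 phi0 + D_uu F l0 u0 phi0 xi \<notin> range L" for xi
  proof -
    interpret Q: bounded_linear "\<lambda>w. D 2 (l0, u0) [w, (0, phi0)]" by (rule J.bounded_linear_jet2_left)
    \<comment> \<open>Additivity in the first direction combines the two terms, once the symmetry of
      the second derivative has put \<open>phi0\<close> last in both.\<close>
    have "D_lam_u F l0 u0 phi0 + D_uu F l0 u0 phi0 xi = D 2 (l0, u0) [(1, xi), (0, phi0)]"
      using Q.add[of "(1, 0)" "(0, xi)"]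
      by (simp add: J.D_lam_u_apply J.D_uu_apply J.second_derivative_symmetric[of _ "(0, phi0)" "(0, xi)"])
    then have "psi0 (D 2 (l0, u0) [(1, xi), (0, phi0)]) \<noteq> 0" using nd by (simp only: range_iff not_False_eq_True)
    then interpret nondegenerate_setting D F l0 u0 phi0 psi0 Xsym Ysym xi
      using xi by unfold_locales (simp_all add: L J.D_lam_eq)
    have direction: "deriv h 0 = 0 \<longleftrightarrow> D_uu F l0 u0 phi0 phi0 \<in> range L"
      if "bifurcation_branches F Xsym l0 u0 e p d h u" for e p d h u
      unfolding range_iff J.D_uu_apply
    proof (rule branch_direction)
      note b = that[unfolded bifurcation_branches_def]
      show "F (h a, u a) = 0" if "a \<in> {-d<..<d}" for a using b that by blast
    qed (use that in \<open>auto simp: bifurcation_branches_def\<close>)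
    \<comment> \<open>A branch inside the closed subspace \<open>Xsym\<close> would have its tangent
      there, against the definition of a bifurcating branch.\<close>
    have breaking: "\<not> u ` {-d<..<d} \<subseteq> Xsym"
      if "bifurcation_branches F Xsym l0 u0 e p d h u" for e p d h u
    proof
      assume *: "u ` {-d<..<d} \<subseteq> Xsym"
      from that have d: "d > 0" "smooth_on {-d<..<d} u" "vector_derivative u (at 0) \<notin> Xsym"
        unfolding bifurcation_branches_def by blast+
      obtain us where us: "\<And>x. x \<in> {-d<..<d} \<Longrightarrow> us 0 x = u x"
        "\<And>n x. x \<in> {-d<..<d} \<Longrightarrow> (us n has_vector_derivative us (Suc n) x) (at x)"
        using smooth_on_real_derivatives[OF d(2)] by blast
      have "(u has_vector_derivative us (Suc 0) 0) (at 0)"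
        by (rule has_vector_derivative_transform_within_open[where S="{-d<..<d}", OF us(2)]) (use d us(1) in auto)
      moreover from this have "us (Suc 0) 0 \<in> Xsym"
      proof (rule vector_derivative_in_closed_subspace[OF assms(10,11)])
        have "\<forall>\<^sub>F s in nhds 0. s \<in> {-d<..<d}" using d(1) by (intro eventually_nhds_in_open) auto
        then show "\<forall>\<^sub>F s in nhds 0. u s \<in> Xsym" by eventually_elim (use * in auto)
      qed
      ultimately show False using d(3) by (simp add: vector_derivative_at)
    qed
    show ?thesis
      using bifurcation direction breaking
      unfolding transcritical_bifurcation_def pitchfork_bifurcation_def symmetry_breaking_bifurcation_def
      by blast
  qed
  moreover have "\<exists>!xi. xi \<in> Xsym \<and> L xi + D_lam F l0 u0 = 0"
    using symmetric_solution_unique by (simp add: L J.D_lam_eq)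
  ultimately show ?thesis by blast
qed

end
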